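(* There is an algorithm that, given a positive integer $k$ and a rooted graph $G=(V+r,E)$ with $n$ vertices, decides in time $2^{O(k^2 \log k)}\cdot n^{O(1)}$ whether $G$ contains two edge-disjoint $(r,k)$-safe spanning trees, and, if they exist, computes two such edge-disjoint $(r,k)$-safe spanning trees within the same running time. In particular, this decision problem is fixed-parameter tractable with parameter $k$.
   Context: Graphs are loopless but may have parallel edges. A rooted graph $G=(V+r,E)$ is a graph with vertex set $V\cup\{r\}$ and a special vertex $r$ (the root). For a tree $T=(V'+r,E')$ and $v\in V'$, $C_T^v$ denotes the subgraph of $T-v$ obtained by deleting the component of $T-v$ containing $r$. The tree $T$ is $(r,k)$-safe if $|V'\setminus V(C_T^v)|\ge k$ for every $v\in V'$. A spanning tree of $G$ is a subgraph that is a tree with vertex set $V\cup\{r\}$. A problem is fixed-parameter tractable with parameter $k$ if it can be solved in time $f(k)\cdot |I|^{c}$ for a computable $f$ and constant $c$. *)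

theory Defs
  imports Complex_Main "HOL-Library.Landau_Symbols" "HOL-Library.Log_Nat"
begin

section \<open>Rooted multigraphs and safe spanning trees\<close>

text \<open>Undirected multigraphs: edges are abstract objects, and \<open>ends\<close> maps an edge to the set of
  its two end vertices, so parallel edges are distinct elements of \<open>edges\<close>.\<close>

record ('v, 'e) multigraph =
  verts :: "'v set"
  edges :: "'e set"
  ends :: "'e \<Rightarrow> 'v set"

definition loopless_multigraph :: "('v, 'e) multigraph \<Rightarrow> bool" where
  "loopless_multigraph G \<longleftrightarrow> finite (verts G) \<and> finite (edges G) \<and>
     (\<forall>e \<in> edges G. ends G e \<subseteq> verts G \<and> card (ends G e) = 2)"

definition subgraph :: "('v, 'e) multigraph \<Rightarrow> ('v, 'e) multigraph \<Rightarrow> bool" where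
  "subgraph H G \<longleftrightarrow> loopless_multigraph H \<and> verts H \<subseteq> verts G \<and> edges H \<subseteq> edges G \<and>
     (\<forall>e \<in> edges H. ends H e = ends G e)"

definition del_verts :: "('v, 'e) multigraph \<Rightarrow> 'v set \<Rightarrow> ('v, 'e) multigraph" where
  "del_verts G X = G\<lparr>verts := verts G - X, edges := {e \<in> edges G. ends G e \<inter> X = {}}\<rparr>"

definition adjacency :: "('v, 'e) multigraph \<Rightarrow> ('v \<times> 'v) set" where
  "adjacency G = {(u, v). \<exists>e \<in> edges G. ends G e = {u, v}}"

definition component_verts :: "('v, 'e) multigraph \<Rightarrow> 'v \<Rightarrow> 'v set" where
  "component_verts G u = {v \<in> verts G. (u, v) \<in> (adjacency G)\<^sup>*}"

definition connected_graph :: "('v, 'e) multigraph \<Rightarrow> bool" where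
  "connected_graph G \<longleftrightarrow> verts G \<noteq> {} \<and> (\<forall>u \<in> verts G. component_verts G u = verts G)"

text \<open>Two parallel edges form a cycle of length 2.\<close>

definition is_cycle :: "('v, 'e) multigraph \<Rightarrow> 'v list \<Rightarrow> 'e list \<Rightarrow> bool" where
  "is_cycle G vs es \<longleftrightarrow> 2 \<le> length vs \<and> length es = length vs \<and> distinct vs \<and> distinct es \<and>
     set vs \<subseteq> verts G \<and> set es \<subseteq> edges G \<and>
     (\<forall>i < length vs. ends G (es ! i) = {vs ! i, vs ! (Suc i mod length vs)})"

definition tree :: "('v, 'e) multigraph \<Rightarrow> bool" where
  "tree T \<longleftrightarrow> loopless_multigraph T \<and> connected_graph T \<and> \<not> (\<exists>vs es. is_cycle T vs es)"

definition spanning_tree :: "('v, 'e) multigraph \<Rightarrow> ('v, 'e) multigraph \<Rightarrow> bool" where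
  "spanning_tree T G \<longleftrightarrow> subgraph T G \<and> tree T \<and> verts T = verts G"

text \<open>\<open>cut_part T r v\<close> is the graph $C_T^v$.\<close>

definition cut_part :: "('v, 'e) multigraph \<Rightarrow> 'v \<Rightarrow> 'v \<Rightarrow> ('v, 'e) multigraph" where
  "cut_part T r v = del_verts (del_verts T {v}) (component_verts (del_verts T {v}) r)"

definition safe :: "'v \<Rightarrow> nat \<Rightarrow> ('v, 'e) multigraph \<Rightarrow> bool" where
  "safe r k T \<longleftrightarrow>
     (\<forall>v \<in> verts T - {r}. k \<le> card ((verts T - {r}) - verts (cut_part T r v)))"

definition disjoint_safe_spanning_trees ::
  "('v, 'e) multigraph \<Rightarrow> 'v \<Rightarrow> nat \<Rightarrow> ('v, 'e) multigraph \<Rightarrow> ('v, 'e) multigraph \<Rightarrow> bool" where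
  "disjoint_safe_spanning_trees G r k T1 T2 \<longleftrightarrow>
     spanning_tree T1 G \<and> safe r k T1 \<and> spanning_tree T2 G \<and> safe r k T2 \<and>
     edges T1 \<inter> edges T2 = {}"

section \<open>Random access machine programs with running time\<close>

text \<open>The machine has random access memory holding natural numbers, with unit-cost addition and
  truncated subtraction. There is deliberately no multiplication: in \<open>t\<close> steps numbers grow
  by a factor of at most \<open>2 ^ t\<close>, so running times are polynomially related to
  those of Turing machines. The memory is split into banks; since bank names are constants
  of the program, a program uses only finitely many of them, and interleaving the banks simulates
  a single memory with constant overhead.\<close>

type_synonym memory = "nat \<Rightarrow> nat \<Rightarrow> nat"

datatype expr =
    Const nat
  | Cell nat expr
  | Plus expr expr
  | Monus expr expr

fun eval_expr :: "expr \<Rightarrow> memory \<Rightarrow> nat" where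
  "eval_expr (Const c) s = c"
| "eval_expr (Cell b e) s = s b (eval_expr e s)"
| "eval_expr (Plus e1 e2) s = eval_expr e1 s + eval_expr e2 s"
| "eval_expr (Monus e1 e2) s = eval_expr e1 s - eval_expr e2 s"

fun cost_expr :: "expr \<Rightarrow> nat" where
  "cost_expr (Const c) = 1"
| "cost_expr (Cell b e) = 1 + cost_expr e"
| "cost_expr (Plus e1 e2) = 1 + cost_expr e1 + cost_expr e2"
| "cost_expr (Monus e1 e2) = 1 + cost_expr e1 + cost_expr e2"

datatype prog =
    Skip
  | Store nat expr expr
  | Seq prog prog
  | Cond expr prog prog
  | While expr prog

text \<open>\<open>exec p s t s'\<close>: started in \<open>s\<close>, the program halts in \<open>s'\<close> after exactly \<open>t\<close> steps.
  \<open>Store b a e\<close> writes the value of \<open>e\<close> to the address \<open>a\<close> of bank \<open>b\<close>; a test succeeds iff its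
  value is nonzero.\<close>

inductive exec :: "prog \<Rightarrow> memory \<Rightarrow> nat \<Rightarrow> memory \<Rightarrow> bool" where
  Skip: "exec Skip s 1 s"
| Store: "exec (Store b a e) s (1 + cost_expr a + cost_expr e)
            (s(b := (s b)(eval_expr a s := eval_expr e s)))"
| Seq: "exec p s t s' \<Longrightarrow> exec q s' t' s'' \<Longrightarrow> exec (Seq p q) s (t + t') s''"
| CondTrue: "eval_expr e s \<noteq> 0 \<Longrightarrow> exec p s t s' \<Longrightarrow>
    exec (Cond e p q) s (1 + cost_expr e + t) s'"
| CondFalse: "eval_expr e s = 0 \<Longrightarrow> exec q s t s' \<Longrightarrow>
    exec (Cond e p q) s (1 + cost_expr e + t) s'"
| WhileFalse: "eval_expr e s = 0 \<Longrightarrow> exec (While e p) s (1 + cost_expr e) s"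
| WhileTrue: "eval_expr e s \<noteq> 0 \<Longrightarrow> exec p s t s' \<Longrightarrow> exec (While e p) s' t' s'' \<Longrightarrow>
    exec (While e p) s (1 + cost_expr e + t + t') s''"

inductive_cases SkipE: "exec Skip s t s'"
  and StoreE: "exec (Store b a e) s t s'"
  and SeqE: "exec (Seq p q) s t s'"
  and CondE: "exec (Cond e p q) s t s'"
  and WhileE: "exec (While e p) s t s'"

lemma exec_deterministic:
  "exec p s t s1 \<Longrightarrow> exec p s u s2 \<Longrightarrow> u = t \<and> s2 = s1"
proof (induction arbitrary: u s2 rule: exec.induct)
  case (Skip s)
  then show ?case by (auto elim: SkipE)
next
  case (Store b a e s)
  then show ?case by (auto elim: StoreE)
next
  case (Seq p s t s' q t' s'')
  then show ?case by (blast elim: SeqE)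
next
  case (CondTrue e s p t s' q)
  from CondTrue.prems CondTrue.hyps obtain t1 where
      "exec p s t1 s2" "u = 1 + cost_expr e + t1"
    by (auto elim: CondE)
  then show ?case using CondTrue.IH by blast
next
  case (CondFalse e s q t s' p)
  from CondFalse.prems CondFalse.hyps obtain t1 where
      "exec q s t1 s2" "u = 1 + cost_expr e + t1"
    by (auto elim: CondE)
  then show ?case using CondFalse.IH by blast
next
  case (WhileFalse e s p)
  then show ?case by (auto elim: WhileE)
next
  case (WhileTrue e s p t s' t' s'')
  from WhileTrue.prems WhileTrue.hyps obtain t1 s1 t2 where
      "exec p s t1 s1" "exec (While e p) s1 t2 s2" "u = 1 + cost_expr e + t1 + t2"
    by (auto elim: WhileE)
  then show ?case using WhileTrue.IH by blast
qed

text \<open>The input is a list of numbers in bank 0, the output a list of numbers in bank 1; in both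
  banks address 0 holds the length of the list. All other cells are initially 0.\<close>

definition input_memory :: "nat list \<Rightarrow> memory" where
  "input_memory ws b a =
     (if b = 0 \<and> a = 0 then length ws
      else if b = 0 \<and> a \<le> length ws then ws ! (a - 1) else 0)"

definition output_of :: "memory \<Rightarrow> nat list" where
  "output_of s = map (s 1) [1..<Suc (s 1 0)]"

definition runs :: "prog \<Rightarrow> nat list \<Rightarrow> nat \<Rightarrow> nat list \<Rightarrow> bool" where
  "runs p ws t out \<longleftrightarrow> (\<exists>s. exec p (input_memory ws) t s \<and> output_of s = out)"

definition computable :: "(nat \<Rightarrow> nat) \<Rightarrow> bool" where
  "computable f \<longleftrightarrow> (\<exists>p. \<forall>x. \<exists>t. runs p [x] t [f x])"

text \<open>Number of bits of an input, counting one delimiter per word.\<close>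

definition bit_size :: "nat list \<Rightarrow> nat" where
  "bit_size ws = (\<Sum>w \<leftarrow> ws. floorlog 2 w + 1)"

text \<open>A parameterized problem consists of the instances \<open>D\<close>, their encoding, their
  parameter, and the set \<open>Y\<close> of yes-instances.\<close>

definition fixed_parameter_tractable ::
  "'i set \<Rightarrow> ('i \<Rightarrow> nat list) \<Rightarrow> ('i \<Rightarrow> nat) \<Rightarrow> 'i set \<Rightarrow> bool" where
  "fixed_parameter_tractable D enc par Y \<longleftrightarrow>
     (\<exists>p f c. computable f \<and>
        (\<forall>x \<in> D. \<exists>t. runs p (enc x) t (if x \<in> Y then [1] else [0]) \<and>
           t \<le> f (par x) * bit_size (enc x) ^ c))"

section \<open>The problem as a computational problem\<close>

text \<open>Up to isomorphism a finite loopless multigraph is given by its number \<open>n\<close> of vertices and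
  the multiplicities \<open>\<mu> u v\<close> for \<open>u < v < n\<close>. The triple \<open>(u, v, i)\<close> names the \<open>i\<close>-th of the
  \<open>\<mu> u v\<close> parallel edges joining \<open>u\<close> and \<open>v\<close>.\<close>

definition mult_graph :: "nat \<Rightarrow> (nat \<Rightarrow> nat \<Rightarrow> nat) \<Rightarrow> (nat, nat \<times> nat \<times> nat) multigraph" where
  "mult_graph n \<mu> =
     \<lparr>verts = {..<n},
      edges = {(u, v, i). u < v \<and> v < n \<and> i < \<mu> u v},
      ends = (\<lambda>(u, v, i). {u, v})\<rparr>"

lemma loopless_mult_graph: "loopless_multigraph (mult_graph n \<mu>)"
proof -
  let ?E = "{(u, v, i). u < v \<and> v < n \<and> i < \<mu> u v}"
  have "?E \<subseteq> (\<Union>u<n. \<Union>v<n. (\<lambda>i. (u, v, i)) ` {..<\<mu> u v})" by (auto simp: image_iff)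
  then have "finite ?E" by (rule finite_subset) auto
  then show ?thesis by (auto simp: loopless_multigraph_def mult_graph_def)
qed

text \<open>An instance \<open>(k, n, r, \<mu>)\<close> has root \<open>r\<close>, and \<open>n\<close> counts all vertices including the root.
  It is encoded by \<open>k\<close>, \<open>n\<close>, \<open>r\<close> and the symmetric multiplicity matrix, row by row.\<close>

type_synonym inst = "nat \<times> nat \<times> nat \<times> (nat \<Rightarrow> nat \<Rightarrow> nat)"

definition instances :: "inst set" where
  "instances = {(k, n, r, \<mu>). 1 \<le> k \<and> r < n}"

definition yes_instances :: "inst set" where
  "yes_instances = {(k, n, r, \<mu>). (k, n, r, \<mu>) \<in> instances \<and>
     (\<exists>T1 T2. disjoint_safe_spanning_trees (mult_graph n \<mu>) r k T1 T2)}"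

fun encode_inst :: "inst \<Rightarrow> nat list" where
  "encode_inst (k, n, r, \<mu>) =
     k # n # r # [if u = v then 0 else \<mu> (min u v) (max u v). u \<leftarrow> [0..<n], v \<leftarrow> [0..<n]]"

definition encode_edges :: "(nat \<times> nat \<times> nat) list \<Rightarrow> nat list" where
  "encode_edges es = length es # concat (map (\<lambda>(u, v, i). [u, v, i]) es)"

text \<open>The output is \<open>[0]\<close> on a no-instance; on a yes-instance it is \<open>1\<close> followed by the edge lists
  of two trees on the vertices of the graph.\<close>

fun correct_output :: "inst \<Rightarrow> nat list \<Rightarrow> bool" where
  "correct_output (k, n, r, \<mu>) out \<longleftrightarrow>
     (if (k, n, r, \<mu>) \<in> yes_instances then
        (\<exists>es1 es2. out = 1 # encode_edges es1 @ encode_edges es2 \<and>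
           disjoint_safe_spanning_trees (mult_graph n \<mu>) r k
             ((mult_graph n \<mu>)\<lparr>edges := set es1\<rparr>) ((mult_graph n \<mu>)\<lparr>edges := set es2\<rparr>))
      else out = [0])"

end

theory Submission
  imports Defs
begin

text \<open>A tree is safe iff for every non-root \<open>v\<close> at least \<open>k - 1\<close> further non-root vertices can be
  reached from the root without using \<open>v\<close>. This property is monotone in the edge set, and every safe
  tree contains a safe subtree at the root with at most \<open>k\<^sup>2\<close> edges, a core: take a subtree with
  \<open>k - 1\<close> non-root vertices and, for each of them, such a subtree that avoids it. Hence one looks for
  two cores that extend to disjoint spanning trees; whether given cores extend is decided by
  augmenting paths in the union of the two contracted cycle matroids.

  The cores are grown edge by edge from the root. At an inner vertex \<open>x\<close> it is enough to branch over
  \<open>O(k\<^sup>2)\<close> of the edges leaving the current tree: if none of them belongs to the core \<open>F\<close> of some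
  solution, then a symmetric exchange between the two spanning trees shows that one of them, say
  \<open>xy\<close>, can be added to \<open>F\<close>, and a leaf of \<open>F\<close> behind the next core edge at \<open>x\<close> can be dropped
  instead without destroying safety. So \<open>2k\<^sup>2\<close> choices with \<open>k\<^bsup>O(1)\<^esup>\<close> alternatives each have to be
  tried.

  The algorithm is written as a program with bounded loops only, whose meaning is a total function
  on memories and whose running time is bounded by the loop bounds and the nesting depth.\<close>

section \<open>Connectivity and forests\<close>

text \<open>The bound on the branching comes from counting failures. Fix a solution and a vertex
  \<open>x\<close> of one of its cores. An edge at \<open>x\<close> resists the exchange only if it
  lies in the other core, runs into the vertex set of its own core, or belongs to the other tree and
  cuts off \<open>x\<close> or another core vertex there when removed. Among the edges at
  \<open>x\<close> only one can cut off a given vertex, and at most two parallel ones lead to it, so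
  the number of such edges is linear in the core sizes. This is one reason why multiplicities are
  truncated to two, and it yields \<open>4 * N + 5\<close> with \<open>N = k * k\<close>. The core
  of the solution is not fixed in advance: a step may replace it by another one of equal size.
  Soundness never depends on this, since trees are checked before they are printed. Recursion is
  replaced by a counter whose digits in base \<open>B\<close> are the choices, \<open>N\<close> for
  each tree. With \<open>B\<close> polynomial in \<open>k\<close> there are
  \<open>B ^ (2 * N)\<close> counters, which is 2 to the O(k^2 log k). Loop nesting raises this
  number and a polynomial in \<open>n\<close> to a constant power only.\<close>

locale edge_ends =
  fixes ends :: "'e \<Rightarrow> 'v set"
begin

definition adj :: "'e set \<Rightarrow> ('v \<times> 'v) set" where
  "adj X = {(a, b). \<exists>e\<in>X. ends e = {a, b}}"

definition conn :: "'e set \<Rightarrow> 'v \<Rightarrow> 'v \<Rightarrow> bool" where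
  "conn X a b \<longleftrightarrow> (a, b) \<in> (adj X)\<^sup>*"

text \<open>Acyclicity is phrased as every edge being a bridge, so that exchange arguments are
  statements about \<open>conn\<close> alone. Agreement with the absence of \<open>is_cycle\<close>
  is shown once, in \<open>forest_iff_acyclic\<close>.\<close>

definition forest :: "'e set \<Rightarrow> bool" where
  "forest X \<longleftrightarrow> (\<forall>e\<in>X. \<forall>a b. ends e = {a, b} \<longrightarrow> \<not> conn (X - {e}) a b)"

lemma conn_refl [simp]: "conn X a a"
  by (simp add: conn_def)

lemma adj_sym: "(a, b) \<in> adj X \<Longrightarrow> (b, a) \<in> adj X"
  by (auto simp: adj_def insert_commute)

lemma conn_sym: "conn X a b \<Longrightarrow> conn X b a"
  unfolding conn_def by (meson adj_sym symI sym_rtrancl symD)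

lemma conn_trans: "conn X a b \<Longrightarrow> conn X b c \<Longrightarrow> conn X a c"
  by (simp add: conn_def)

lemma conn_mono: "conn X a b \<Longrightarrow> X \<subseteq> Y \<Longrightarrow> conn Y a b"
  unfolding conn_def by (rule rtrancl_mono[THEN subsetD]) (auto simp: adj_def)

lemma conn_edge: "e \<in> X \<Longrightarrow> ends e = {a, b} \<Longrightarrow> conn X a b"
  unfolding conn_def by (rule r_into_rtrancl) (auto simp: adj_def)

text \<open>Stands in for walking along a path: whatever passes across every edge reaches all
  connected vertices. Explicit vertex lists appear only where cycles have to be exhibited.\<close>

lemma conn_closed:
  assumes "conn X a b" "a \<in> A"
    and "\<And>e c d. e \<in> X \<Longrightarrow> ends e = {c, d} \<Longrightarrow> c \<in> A \<Longrightarrow> d \<in> A"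
  shows "b \<in> A"
  using assms(1) unfolding conn_def
  by (induction rule: rtrancl_induct) (use assms in \<open>auto simp: adj_def\<close>)

lemma conn_subsume:
  assumes "conn X a b" and "\<And>e c d. e \<in> X \<Longrightarrow> ends e = {c, d} \<Longrightarrow> conn Y c d"
  shows "conn Y a b"
proof -
  have "b \<in> {b. conn Y a b}"
    by (rule conn_closed[OF assms(1)]) (auto intro: conn_trans assms(2))
  then show ?thesis by simp
qed

text \<open>A walk can be shortened until it uses the new edge at most once, in one of two
  directions. Most exchange facts reduce to this case distinction.\<close>

lemma conn_insert:
  assumes e: "ends e = {u, v}"
  shows "conn (insert e X) a b \<longleftrightarrow>
    conn X a b \<or> conn X a u \<and> conn X v b \<or> conn X a v \<and> conn X u b" (is "?L \<longleftrightarrow> ?R")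
proof
  assume L: ?L
  have "b \<in> {b. conn X a b \<or> conn X a u \<and> conn X v b \<or> conn X a v \<and> conn X u b}"
  proof (rule conn_closed[OF L])
    fix f c d
    assume f: "f \<in> insert e X" "ends f = {c, d}"
      and c: "c \<in> {b. conn X a b \<or> conn X a u \<and> conn X v b \<or> conn X a v \<and> conn X u b}"
    show "d \<in> {b. conn X a b \<or> conn X a u \<and> conn X v b \<or> conn X a v \<and> conn X u b}"
    proof (cases "f \<in> X")
      case True
      then have "conn X c d" using f conn_edge by blast
      then show ?thesis using c conn_trans by blast
    next
      case False
      then have "{c, d} = {u, v}" using f e by auto
      then have "c = u \<and> d = v \<or> c = v \<and> d = u" by (auto simp: doubleton_eq_iff)
      then show ?thesis using c conn_trans conn_refl by blast
    qed
  qed auto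
  then show ?R by simp
next
  assume ?R
  moreover have "conn (insert e X) u v" using e by (auto intro: conn_edge)
  moreover have "\<And>a b. conn X a b \<Longrightarrow> conn (insert e X) a b" by (erule conn_mono) auto
  ultimately show ?L by (meson conn_trans conn_sym)
qed

lemma conn_isolated:
  assumes "conn X a b" "\<And>e. e \<in> X \<Longrightarrow> a \<notin> ends e"
  shows "b = a"
proof -
  have "b \<in> {a}" by (rule conn_closed[OF assms(1)]) (use assms(2) in auto)
  then show ?thesis by simp
qed

lemma forest_empty [simp]: "forest {}"
  by (simp add: forest_def)

lemma forest_subset: "forest X \<Longrightarrow> Y \<subseteq> X \<Longrightarrow> forest Y"
  unfolding forest_def by (meson Diff_mono conn_mono order_refl subsetD)

lemma forestD: "forest X \<Longrightarrow> e \<in> X \<Longrightarrow> ends e = {a, b} \<Longrightarrow> \<not> conn (X - {e}) a b"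
  by (auto simp: forest_def)

lemma forest_insert:
  assumes X: "forest X" and e: "ends e = {u, v}" and n: "\<not> conn X u v"
  shows "forest (insert e X)"
  unfolding forest_def
proof (intro ballI allI impI notI)
  fix g a b
  assume g: "g \<in> insert e X" "ends g = {a, b}" and c: "conn (insert e X - {g}) a b"
  show False
  proof (cases "g = e")
    case True
    have "conn X a b" using c by (rule conn_mono) (use True in auto)
    then show False using True g e n by (auto simp: doubleton_eq_iff dest: conn_sym)
  next
    case False
    then have gX: "g \<in> X" using g by simp
    have "insert e X - {g} = insert e (X - {g})" using False by auto
    then have "conn (X - {g}) a b \<or> conn (X - {g}) a u \<and> conn (X - {g}) v b
        \<or> conn (X - {g}) a v \<and> conn (X - {g}) u b"
      using c conn_insert[OF e] by simp
    moreover have "\<not> conn (X - {g}) a b" using X gX g forestD by blast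
    moreover have "conn X a b" using gX g conn_edge by blast
    moreover have "\<And>p q. conn (X - {g}) p q \<Longrightarrow> conn X p q" by (erule conn_mono) auto
    ultimately show False using n by (meson conn_trans conn_sym)
  qed
qed

text \<open>The path between two vertices of a forest is represented by the set of edges whose
  removal separates them. A smallest connecting subset \<open>Q\<close> consists of such edges only:
  if \<open>X\<close> still connected \<open>u\<close> and \<open>v\<close> without one of them,
  that edge would lie on a cycle.\<close>

lemma path_edges:
  assumes X: "forest X" "finite X" and c: "conn X u v"
  shows "conn {f \<in> X. \<not> conn (X - {f}) u v} u v"
proof -
  define P where "P Q \<longleftrightarrow> Q \<subseteq> X \<and> conn Q u v" for Q
  have "P X" using c by (simp add: P_def)
  then obtain Q where Q: "P Q" "\<And>Q'. P Q' \<Longrightarrow> card Q \<le> card Q'"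
    using ex_has_least_nat[of P X card] by blast
  have "Q \<subseteq> {f \<in> X. \<not> conn (X - {f}) u v}"
  proof
    fix f assume f: "f \<in> Q"
    have finQ: "finite Q" using Q(1) X(2) by (auto simp: P_def intro: finite_subset)
    have nc: "\<not> conn (Q - {f}) u v"
    proof
      assume "conn (Q - {f}) u v"
      then have "P (Q - {f})" using Q(1) by (auto simp: P_def)
      then have "card Q \<le> card (Q - {f})" by (rule Q(2))
      then show False using f finQ by (metis card_Diff1_less not_less)
    qed
    have fX: "f \<in> X" using f Q(1) by (auto simp: P_def)
    have cQ: "conn Q u v" using Q(1) by (simp add: P_def)
    \<comment> \<open>\<open>ends\<close> is arbitrary in this locale. An edge whose end set is not
      of this form contributes no adjacency, so a smallest \<open>Q\<close> would not contain
      it.\<close>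
    have "\<exists>a b. ends f = {a, b}"
    proof (rule ccontr)
      assume n: "\<not> ?thesis"
      have "conn (Q - {f}) u v"
        by (rule conn_subsume[OF cQ]) (use n in \<open>auto intro: conn_edge\<close>)
      then show False using nc by simp
    qed
    then obtain a b where ab: "ends f = {a, b}" by blast
    have "insert f (Q - {f}) = Q" using f by auto
    then have or: "conn (Q - {f}) u a \<and> conn (Q - {f}) b v \<or> conn (Q - {f}) u b \<and> conn (Q - {f}) a v"
      using conn_insert[OF ab, of "Q - {f}" u v] cQ nc by simp
    have mono: "\<And>p q. conn (Q - {f}) p q \<Longrightarrow> conn (X - {f}) p q"
      by (erule conn_mono) (use Q(1) in \<open>auto simp: P_def\<close>)
    have "\<not> conn (X - {f}) u v"
      using forestD[OF X(1) fX ab] or mono by (meson conn_trans conn_sym)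
    then show "f \<in> {f \<in> X. \<not> conn (X - {f}) u v}" using fX by simp
  qed
  moreover have "conn Q u v" using Q(1) by (simp add: P_def)
  ultimately show ?thesis by (rule conn_mono[rotated])
qed

text \<open>\<open>f\<close> lies on the path of \<open>X\<close> between the ends of
  \<open>e\<close>, so after the swap the ends of each of the two edges are still connected, and the
  components stay the same.\<close>

lemma exchange_conn:
  assumes f: "f \<in> X" "ends f = {c, d}" and e: "ends e = {u, v}"
    and uv: "conn X u v" "\<not> conn (X - {f}) u v"
  shows "conn (insert e (X - {f})) a b \<longleftrightarrow> conn X a b"
proof
  assume "conn (insert e (X - {f})) a b"
  then show "conn X a b"
    by (rule conn_subsume) (use e uv in \<open>auto simp: doubleton_eq_iff intro: conn_edge dest: conn_sym\<close>)
next
  assume X: "conn X a b"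
  let ?Y = "insert e (X - {f})"
  have "insert f (X - {f}) = X" using f by auto
  then have "conn (X - {f}) u c \<and> conn (X - {f}) d v \<or> conn (X - {f}) u d \<and> conn (X - {f}) c v"
    using conn_insert[OF f(2), of "X - {f}" u v] uv by simp
  moreover have "\<And>p q. conn (X - {f}) p q \<Longrightarrow> conn ?Y p q" by (erule conn_mono) auto
  moreover have "conn ?Y u v" using e by (auto intro: conn_edge)
  ultimately have cd: "conn ?Y c d" by (meson conn_trans conn_sym)
  show "conn ?Y a b"
    using X
  proof (rule conn_subsume)
    fix g p q assume g: "g \<in> X" "ends g = {p, q}"
    show "conn ?Y p q"
    proof (cases "g = f")
      case True
      then show ?thesis using f g cd by (auto simp: doubleton_eq_iff dest: conn_sym)
    next
      case False
      then show ?thesis using g by (auto intro: conn_edge)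
    qed
  qed
qed

lemma exchange_forest:
  assumes "forest X" "ends e = {u, v}" "\<not> conn (X - {f}) u v"
  shows "forest (insert e (X - {f}))"
  by (rule forest_insert[OF forest_subset[OF assms(1)] assms(2,3)]) auto

text \<open>Steinitz exchange for the cycle matroid.\<close>

lemma card_forest_le:
  assumes "finite S" "finite K" "forest S"
    and "\<And>e. e \<in> S \<Longrightarrow> card (ends e) = 2"
    and "\<And>e. e \<in> K \<Longrightarrow> card (ends e) = 2"
    and "\<And>e a b. e \<in> S \<Longrightarrow> ends e = {a, b} \<Longrightarrow> conn K a b"
  shows "card S \<le> card K"
  using assms
\<comment> \<open>Each round trades an edge of \<open>S\<close> outside \<open>K\<close> for an edge
  of \<open>K\<close>. The size of \<open>S\<close> is unchanged while \<open>S - K\<close> shrinks,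
  until \<open>S\<close> is a subset of \<open>K\<close>.\<close>
proof (induction "card (S - K)" arbitrary: S rule: less_induct)
  case less
  show ?case
  proof (cases "S \<subseteq> K")
    case True
    then show ?thesis using less.prems card_mono by blast
  next
    case False
    then obtain e where e: "e \<in> S" "e \<notin> K" by blast
    obtain u v where uv: "ends e = {u, v}" using less.prems(4)[OF e(1)] by (auto simp: card_2_iff)
    have nuv: "\<not> conn (S - {e}) u v" using less.prems(3) e uv forestD by blast
    have "\<exists>f\<in>K. \<exists>a b. ends f = {a, b} \<and> \<not> conn (S - {e}) a b"
    proof (rule ccontr)
      assume "\<not> ?thesis"
      then have "conn (S - {e}) u v"
        using conn_subsume[OF less.prems(6)[OF e(1) uv], of "S - {e}"] by blast
      then show False using nuv by simp
    qed
    then obtain f a b where f: "f \<in> K" "ends f = {a, b}" "\<not> conn (S - {e}) a b" by (elim bexE exE conjE)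
    let ?S = "insert f (S - {e})"
    have fS: "f \<notin> S - {e}"
    proof
      assume "f \<in> S - {e}"
      then have "conn (S - {e}) a b" by (rule conn_edge[OF _ f(2)])
      then show False using f(3) by contradiction
    qed
    have fe: "f \<noteq> e" using e(2) f(1) by auto
    have cS: "card ?S = card S"
      using fS e less.prems(1) by (metis card.remove card_insert_disjoint finite_Diff)
    have "?S - K = (S - K) - {e}" using f by auto
    then have "card (?S - K) < card (S - K)"
      using e less.prems(1) by (metis DiffI card_Diff1_less finite_Diff)
    moreover have "forest ?S" by (rule exchange_forest[OF less.prems(3) f(2,3)])
    moreover have "conn K p q" if "g \<in> ?S" "ends g = {p, q}" for g p q
      using that f less.prems(6) by (auto intro: conn_edge)
    moreover have "card (ends g) = 2" if "g \<in> ?S" for g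
      using that f less.prems(4,5) by auto
    ultimately have "card ?S \<le> card K"
      using less.hyps[of ?S] less.prems(1,2,5) by blast
    then show ?thesis using cS by simp
  qed
qed

end

section \<open>Disjoint spanning trees and rooted subtrees\<close>

text \<open>The limit on parallel edges bounds the edges from a vertex into a set \<open>W\<close>
  by \<open>2 * card W\<close>. It loses no solutions, since two trees together use at most two
  copies between any pair of vertices.\<close>

locale rooted_multigraph = edge_ends ends
  for ends :: "'e \<Rightarrow> 'v set" +
  fixes V :: "'v set" and r :: 'v and E :: "'e set"
  assumes finV: "finite V" and finE: "finite E" and rV: "r \<in> V"
    and ends_E: "\<And>e. e \<in> E \<Longrightarrow> \<exists>a b. a \<noteq> b \<and> a \<in> V \<and> b \<in> V \<and> ends e = {a, b}"
    and parallel_le_2: "\<And>a b. card {e \<in> E. ends e = {a, b}} \<le> 2"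
begin

definition stree :: "'e set \<Rightarrow> bool" where
  "stree X \<longleftrightarrow> X \<subseteq> E \<and> forest X \<and> (\<forall>v\<in>V. conn X r v)"

definition extendable :: "'e set \<Rightarrow> 'e set \<Rightarrow> bool" where
  "extendable A B \<longleftrightarrow> (\<exists>S T. stree S \<and> stree T \<and> S \<inter> T = {} \<and> A \<subseteq> S \<and> B \<subseteq> T)"

definition avoid :: "'e set \<Rightarrow> 'v \<Rightarrow> 'e set" where
  "avoid X v = {e \<in> X. v \<notin> ends e}"

text \<open>Safety for arbitrary edge sets, hence monotone. The set counted by \<open>safe\<close>
  consists of \<open>v\<close> itself, accounted for by \<open>Suc\<close>, and of the non-root
  vertices that the root reaches without \<open>v\<close>.\<close>

definition safe_edges :: "nat \<Rightarrow> 'e set \<Rightarrow> bool" where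
  "safe_edges k X \<longleftrightarrow>
     (\<forall>v\<in>V - {r}. k \<le> Suc (card {w \<in> V - {r, v}. conn (avoid X v) r w}))"

text \<open>A tree at the root is given by an order of growth, with its vertex set carried along.
  Each step is what the algorithm does when it adds a crossing edge.\<close>

inductive rtree :: "'e set \<Rightarrow> 'v set \<Rightarrow> bool" where
  rtree_base: "rtree {} {r}"
| rtree_step: "rtree F W \<Longrightarrow> e \<in> E \<Longrightarrow> ends e = {a, b} \<Longrightarrow> a \<in> W \<Longrightarrow> b \<notin> W \<Longrightarrow>
    rtree (insert e F) (insert b W)"

lemma card_ends: "e \<in> E \<Longrightarrow> card (ends e) = 2"
  using ends_E[of e] by auto

lemma extendable_commute: "extendable A B \<Longrightarrow> extendable B A"
  unfolding extendable_def by (metis inf_commute)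

lemma safe_edges_mono:
  assumes "safe_edges k X" "X \<subseteq> Y"
  shows "safe_edges k Y"
  unfolding safe_edges_def
proof
  fix v assume v: "v \<in> V - {r}"
  have "card {w \<in> V - {r, v}. conn (avoid X v) r w} \<le> card {w \<in> V - {r, v}. conn (avoid Y v) r w}"
  proof (rule card_mono)
    show "finite {w \<in> V - {r, v}. conn (avoid Y v) r w}" using finV by simp
    have "avoid X v \<subseteq> avoid Y v" using assms(2) by (auto simp: avoid_def)
    then show "{w \<in> V - {r, v}. conn (avoid X v) r w} \<subseteq> {w \<in> V - {r, v}. conn (avoid Y v) r w}"
      by (auto intro: conn_mono)
  qed
  then show "k \<le> Suc (card {w \<in> V - {r, v}. conn (avoid Y v) r w})"
    using assms(1) v by (force simp: safe_edges_def)
qed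

lemma rtree_props:
  assumes "rtree F W"
  shows "F \<subseteq> E" "W \<subseteq> V" "finite F" "finite W" "card W = Suc (card F)" "r \<in> W"
    "\<And>e. e \<in> F \<Longrightarrow> ends e \<subseteq> W" "\<And>w. conn F r w \<longleftrightarrow> w \<in> W" "forest F"
proof -
  have 1: "F \<subseteq> E \<and> W \<subseteq> V \<and> r \<in> W \<and> (\<forall>e\<in>F. ends e \<subseteq> W) \<and> finite F \<and> finite W \<and> card W = Suc (card F)"
    using assms
  proof (induction rule: rtree.induct)
    case rtree_base
    then show ?case using rV by simp
  next
    case (rtree_step F W e a b)
    then have "e \<notin> F" "b \<in> V" using ends_E[OF rtree_step.hyps(2)] by (auto simp: doubleton_eq_iff)
    then show ?case using rtree_step by auto
  qed
  then show "F \<subseteq> E" "W \<subseteq> V" "finite F" "finite W" "card W = Suc (card F)" "r \<in> W"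
    "\<And>e. e \<in> F \<Longrightarrow> ends e \<subseteq> W" by auto
  have 2: "(\<forall>w. conn F r w \<longleftrightarrow> w \<in> W) \<and> forest F"
    using assms
  proof (induction rule: rtree.induct)
    case rtree_base
    then show ?case using conn_isolated[of "{}" r] by auto
  next
    case (rtree_step F W e a b)
    have ne: "\<And>f. f \<in> F \<Longrightarrow> b \<notin> ends f"
    proof -
      fix f assume "f \<in> F"
      have "ends f \<subseteq> W" using rtree_step.hyps(1) \<open>f \<in> F\<close>
      proof (induction rule: rtree.induct)
      qed auto
      then show "b \<notin> ends f" using rtree_step.hyps(5) by auto
    qed
    have b: "conn F b w \<longleftrightarrow> w = b" for w using conn_isolated[OF _ ne] by auto
    have nab: "\<not> conn F a b" using b[of a] conn_sym[of F a b] rtree_step.hyps by auto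
    have "conn (insert e F) r w \<longleftrightarrow> w \<in> insert b W" for w
      using conn_insert[OF rtree_step.hyps(3), of F r w] rtree_step.IH rtree_step.hyps b by auto
    moreover have "forest (insert e F)"
      using forest_insert[OF _ rtree_step.hyps(3) nab] rtree_step.IH by simp
    ultimately show ?case by simp
  qed
  then show "\<And>w. conn F r w \<longleftrightarrow> w \<in> W" "forest F" by auto
qed

lemma rtree_unique: "rtree F W \<Longrightarrow> rtree F W' \<Longrightarrow> W = W'"
  using rtree_props(8) by blast

lemma rtree_mono:
  assumes "rtree F W" "rtree F' W'" "F \<subseteq> F'"
  shows "W \<subseteq> W'"
proof
  fix w assume "w \<in> W"
  then have "conn F r w" using rtree_props(8)[OF assms(1)] by simp
  then have "conn F' r w" using assms(3) by (rule conn_mono)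
  then show "w \<in> W'" using rtree_props(8)[OF assms(2)] by simp
qed

lemma stree_card:
  assumes "stree X"
  shows "forest Y \<Longrightarrow> Y \<subseteq> E \<Longrightarrow> card Y \<le> card X"
proof -
  assume Y: "forest Y" "Y \<subseteq> E"
  show ?thesis
  proof (rule card_forest_le)
    show "finite Y" "finite X" using Y assms finE by (auto simp: stree_def intro: finite_subset)
    show "forest Y" by fact
    show "card (ends e) = 2" if "e \<in> Y" for e using that Y card_ends by auto
    show "card (ends e) = 2" if "e \<in> X" for e using that assms card_ends by (auto simp: stree_def)
    fix e a b assume e: "e \<in> Y" "ends e = {a, b}"
    then have "a \<in> V" "b \<in> V" using ends_E[of e] Y(2) by (auto simp: doubleton_eq_iff)
    then have "conn X r a" "conn X r b" using assms by (auto simp: stree_def)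
    then show "conn X a b" using conn_trans conn_sym by blast
  qed
qed

text \<open>A forest that misses some vertex could be enlarged by an edge of the given spanning
  tree. Spanning is thus detected by counting.\<close>

lemma stree_if_card:
  assumes "stree X" "forest Y" "Y \<subseteq> E" "card X \<le> card Y"
  shows "stree Y"
proof (rule ccontr)
  assume "\<not> stree Y"
  then obtain v where v: "v \<in> V" "\<not> conn Y r v" using assms by (auto simp: stree_def)
  have "conn X r v" using v assms(1) by (simp add: stree_def)
  have "\<exists>f\<in>X. \<exists>a b. ends f = {a, b} \<and> \<not> conn Y a b"
  proof (rule ccontr)
    assume "\<not> ?thesis"
    then have "conn Y r v" using conn_subsume[OF \<open>conn X r v\<close>, of Y] by blast
    then show False using v by simp
  qed
  then obtain f a b where f: "f \<in> X" "ends f = {a, b}" "\<not> conn Y a b" by (elim bexE exE conjE)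
  have "f \<notin> Y" using f(3) conn_edge[OF _ f(2)] by auto
  have "card (insert f Y) \<le> card X"
    using assms f by (intro stree_card forest_insert) (auto simp: stree_def)
  then show False using \<open>f \<notin> Y\<close> assms finite_subset[OF assms(3) finE] by simp
qed

lemma exchange_stree:
  assumes X: "stree X" and f: "f \<in> X" and e: "e \<in> E" "ends e = {u, v}"
    and n: "\<not> conn (X - {f}) u v"
  shows "stree (insert e (X - {f}))"
  unfolding stree_def
proof (intro conjI ballI)
  show "insert e (X - {f}) \<subseteq> E" using X e by (auto simp: stree_def)
  show "forest (insert e (X - {f}))"
    using X e n by (intro exchange_forest) (auto simp: stree_def)
  fix w assume "w \<in> V"
  obtain c d where cd: "ends f = {c, d}" using X f ends_E[of f] by (auto simp: stree_def)
  have "u \<in> V" "v \<in> V" using ends_E[OF e(1)] e(2) by (auto simp: doubleton_eq_iff)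
  then have "conn X r u" "conn X r v" using X by (auto simp: stree_def)
  then have "conn X u v" using conn_trans conn_sym by blast
  then show "conn (insert e (X - {f})) r w"
    using exchange_conn[OF f cd e(2) _ n] X \<open>w \<in> V\<close> by (auto simp: stree_def)
qed

text \<open>The set \<open>T \<inter> R \<union> F\<close> spans all edges of \<open>R\<close>: the
  path in \<open>T\<close> between the ends of an edge of \<open>R\<close> outside \<open>T\<close>
  consists of edges of \<open>F\<close> and of edges that closedness puts into \<open>R\<close>.
  Steinitz exchange compares it with \<open>S \<inter> R \<union> F\<close>, and \<open>F\<close>
  cancels on both sides.\<close>

lemma closed_set_bound:
  assumes "T \<subseteq> E" "forest T" "F \<subseteq> T" "S \<subseteq> E" "forest S" "F \<subseteq> S" "R \<subseteq> E" "R \<inter> F = {}"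
    and cl: "\<And>e a b. e \<in> R \<Longrightarrow> e \<notin> T \<Longrightarrow> ends e = {a, b} \<Longrightarrow>
      conn T a b \<and> (\<forall>f\<in>T - F. \<not> conn (T - {f}) a b \<longrightarrow> f \<in> R)"
  shows "card (S \<inter> R) \<le> card (T \<inter> R)"
proof -
  have fin: "finite T" "finite S" "finite F" "finite R"
    using assms finE by (meson finite_subset)+
  have "card (S \<inter> R \<union> F) \<le> card (T \<inter> R \<union> F)"
  proof (rule card_forest_le)
    show "forest (S \<inter> R \<union> F)" by (rule forest_subset[OF assms(5)]) (use assms in auto)
    fix e a b assume e: "e \<in> S \<inter> R \<union> F" "ends e = {a, b}"
    show "conn (T \<inter> R \<union> F) a b"
    proof (cases "e \<in> T \<inter> R \<union> F")
      case True
      then show ?thesis by (rule conn_edge[OF _ e(2)])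
    next
      case False
      then have eR: "e \<in> R" "e \<notin> T" using e by auto
      then have 1: "conn T a b" "\<And>f. f \<in> T - F \<Longrightarrow> \<not> conn (T - {f}) a b \<Longrightarrow> f \<in> R"
        using cl e(2) by auto
      show ?thesis
        by (rule conn_mono[OF path_edges[OF assms(2) fin(1) 1(1)]]) (use 1(2) in auto)
    qed
  qed (use assms card_ends fin in auto)
  moreover have "card (S \<inter> R \<union> F) = card (S \<inter> R) + card F"
    using fin assms by (intro card_Un_disjoint) auto
  moreover have "card (T \<inter> R \<union> F) = card (T \<inter> R) + card F"
    using fin assms by (intro card_Un_disjoint) auto
  ultimately show ?thesis by simp
qed

text \<open>Optimality criterion for the matroid union: \<open>R\<close> is the set of edges reachable from the
  uncovered ones in the exchange graph.\<close>

lemma closed_set_maximum: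
  assumes T: "T \<subseteq> E" "forest T" "F \<subseteq> T" "T' \<subseteq> E" "forest T'" "F' \<subseteq> T'" "T \<inter> T' = {}"
    and S: "S \<subseteq> E" "forest S" "F \<subseteq> S" "S' \<subseteq> E" "forest S'" "F' \<subseteq> S'" "S \<inter> S' = {}"
    and R: "R \<subseteq> E" "R \<inter> F = {}" "R \<inter> F' = {}" "E - (T \<union> T') \<subseteq> R"
    and cl: "\<And>e a b. e \<in> R \<Longrightarrow> e \<notin> T \<Longrightarrow> ends e = {a, b} \<Longrightarrow>
      conn T a b \<and> (\<forall>f\<in>T - F. \<not> conn (T - {f}) a b \<longrightarrow> f \<in> R)"
    and cl': "\<And>e a b. e \<in> R \<Longrightarrow> e \<notin> T' \<Longrightarrow> ends e = {a, b} \<Longrightarrow>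
      conn T' a b \<and> (\<forall>f\<in>T' - F'. \<not> conn (T' - {f}) a b \<longrightarrow> f \<in> R)"
  shows "card S + card S' \<le> card T + card T'"
proof -
  have fin: "finite T" "finite S" "finite T'" "finite S'" using T S finE finite_subset by blast+
  have split: "card A = card (A \<inter> R) + card (A - R)" if "finite A" for A :: "'e set"
    using that card_Int_Diff by blast
  have a: "card (S \<inter> R) \<le> card (T \<inter> R)" by (rule closed_set_bound[OF T(1-3) S(1-3) R(1,2) cl])
  have b: "card (S' \<inter> R) \<le> card (T' \<inter> R)"
    by (rule closed_set_bound[OF T(4-6) S(4-6) R(1,3) cl'])
  \<comment> \<open>Outside \<open>R\<close> every edge is covered by \<open>T\<close> or
    \<open>T'\<close>, and \<open>S\<close>, \<open>S'\<close> are disjoint, so they cannot have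
    more edges there.\<close>
  have "card (S - R) + card (S' - R) = card ((S - R) \<union> (S' - R))"
    using fin S(7) by (intro card_Un_disjoint[symmetric]) auto
  also have "\<dots> \<le> card ((T - R) \<union> (T' - R))"
    using fin S R by (intro card_mono) auto
  also have "\<dots> = card (T - R) + card (T' - R)"
    using fin T(7) by (intro card_Un_disjoint) auto
  finally show ?thesis using a b split[OF fin(1)] split[OF fin(2)] split[OF fin(3)] split[OF fin(4)]
    by linarith
qed

section \<open>Separating edges at a vertex and the exchange count\<close>

text \<open>Only the last edge of the path from the root can separate \<open>x\<close> from it. If
  \<open>e\<close> and \<open>e'\<close> both did, the far end of \<open>e\<close> would be reached
  without either edge, and \<open>e\<close> would then lead to \<open>x\<close> in the absence of
  \<open>e'\<close>.\<close>

lemma separating_edge_unique_self: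
  assumes T: "stree T" and e: "e \<in> T" "ends e = {x, y}" and e': "e' \<in> T" "ends e' = {x, y'}"
    and n: "\<not> conn (T - {e}) r x" "\<not> conn (T - {e'}) r x"
  shows "e = e'"
proof (rule ccontr)
  assume ne: "e \<noteq> e'"
  have TE: "T \<subseteq> E" using T by (simp add: stree_def)
  have x: "x \<in> V" using ends_E[of e] e TE by (auto simp: doubleton_eq_iff)
  have 1: "insert e (T - {e}) = T" using e by auto
  have rx: "conn T r x" using T x by (simp add: stree_def)
  have ry: "conn (T - {e}) r y"
    using conn_insert[OF e(2), of "T - {e}" r x] rx n(1) unfolding 1 by auto
  let ?T = "T - {e, e'}"
  have 2: "insert e' ?T = T - {e}" using e' ne by auto
  have m: "conn (T - {e}) p q" "conn (T - {e'}) p q" if "conn ?T p q" for p q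
    using that by (auto intro: conn_mono)
  have "conn ?T r y"
  proof (rule ccontr)
    assume "\<not> conn ?T r y"
    then have or: "conn ?T r x \<or> conn ?T r y' \<and> conn ?T x y"
      using conn_insert[OF e'(2), of ?T r y] ry unfolding 2 by auto
    have "conn (T - {e}) y' x" using conn_edge[of e' "T - {e}" x y'] e' ne conn_sym by auto
    then have "conn (T - {e}) r x" using or m conn_trans by blast
    then show False using n by simp
  qed
  moreover have "conn (T - {e'}) y x" using conn_edge[of e "T - {e'}" x y] e ne conn_sym by auto
  ultimately have "conn (T - {e'}) r x" using m conn_trans by blast
  then show False using n by simp
qed

text \<open>While \<open>x\<close> itself stays connected to the root, only the edge by which the
  connection to \<open>w\<close> leaves \<open>x\<close> can cut off \<open>w\<close>.\<close>

lemma separating_edge_unique: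
  assumes e: "e \<in> T" "ends e = {x, y}" and e': "e' \<in> T" "ends e' = {x, y'}"
    and c: "conn (T - {e}) r x" "conn (T - {e'}) r x"
    and w: "conn T r w" and n: "\<not> conn (T - {e}) r w" "\<not> conn (T - {e'}) r w"
  shows "e = e'"
proof (rule ccontr)
  assume ne: "e \<noteq> e'"
  have 1: "insert e (T - {e}) = T" using e by auto
  have nxw: "\<not> conn (T - {e}) x w" using c n conn_trans by blast
  then have yw: "conn (T - {e}) y w"
    using conn_insert[OF e(2), of "T - {e}" r w] w n(1) unfolding 1 by auto
  let ?T = "T - {e, e'}"
  have 2: "insert e' ?T = T - {e}" using e' ne by auto
  have m: "conn (T - {e}) p q" "conn (T - {e'}) p q" if "conn ?T p q" for p q
    using that by (auto intro: conn_mono)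
  have x': "conn (T - {e}) x y'" using conn_edge[of e' "T - {e}" x y'] e' ne by auto
  have "conn ?T y w"
  proof (rule ccontr)
    assume "\<not> conn ?T y w"
    then have "conn ?T x w \<or> conn ?T y' w"
      using conn_insert[OF e'(2), of ?T y w] yw unfolding 2 by auto
    then have "conn (T - {e}) x w" using m x' conn_trans by blast
    then show False using nxw by simp
  qed
  moreover have "conn (T - {e'}) x y" using conn_edge[of e "T - {e'}" x y] e ne by auto
  ultimately have "conn (T - {e'}) r w" using m c(2) conn_trans by blast
  then show False using n by simp
qed

text \<open>Supplies the edge to be given up in an exchange: it lies on the cycle closed by an edge
  \<open>uv\<close>, and the choice of \<open>A\<close> controls where it is found.\<close>

lemma conn_path_crosses:
  assumes X: "forest X" "finite X" and c: "conn X u v" and A: "u \<in> A" "v \<notin> A" and XE: "X \<subseteq> E"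
  obtains f c d where "f \<in> X" "\<not> conn (X - {f}) u v" "ends f = {c, d}" "c \<in> A" "d \<notin> A"
proof -
  let ?P = "{f \<in> X. \<not> conn (X - {f}) u v}"
  have "\<exists>f\<in>?P. \<exists>c d. ends f = {c, d} \<and> c \<in> A \<and> d \<notin> A"
  proof (rule ccontr)
    assume n: "\<not> ?thesis"
    have "v \<in> A" by (rule conn_closed[OF path_edges[OF X c] A(1)]) (use n in blast)
    then show False using A by simp
  qed
  then show ?thesis using that by blast
qed

text \<open>In the last case of \<open>good\<close>, the path of \<open>T\<close> from \<open>x\<close> to \<open>y\<close> leaves the part of \<open>T'\<close> that stays
  connected to the root when \<open>e\<close> is removed; the leaving edge is exchanged for \<open>e\<close>.\<close>

lemma extend_by_swap:
  assumes T: "stree T" "stree T'" "T \<inter> T' = {}" "F \<subseteq> T" "F' \<subseteq> T'"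
    and F: "rtree F W" and x: "x \<in> W" and e: "e \<in> E - F" "ends e = {x, y}" "y \<noteq> x"
    and good: "e \<in> T \<or> e \<notin> T \<and> e \<notin> T' \<and> y \<notin> W \<or>
      e \<in> T' - F' \<and> (\<forall>w\<in>W. conn (T' - {e}) r w)"
  shows "extendable (insert e F) F'"
proof -
  note rt = rtree_props[OF F]
  have fin: "finite T" "finite T'" and TE: "T \<subseteq> E" "T' \<subseteq> E" and fo: "forest T" "forest T'"
    using T finE finite_subset by (auto simp: stree_def)
  have xy: "x \<in> V" "y \<in> V" using ends_E[of e] e by (auto simp: doubleton_eq_iff)
  then have "conn T r x" "conn T r y" using T by (auto simp: stree_def)
  then have cxy: "conn T x y" using conn_sym conn_trans by blast
  consider "e \<in> T" | "e \<notin> T" "e \<notin> T'" "y \<notin> W" | "e \<in> T' - F'" "\<forall>w\<in>W. conn (T' - {e}) r w"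
    using good by blast
  then show ?thesis
  proof cases
    case 1
    then have "insert e F \<subseteq> T" using T(4) by simp
    then show ?thesis using T(1-3,5) unfolding extendable_def by blast
  next
    case 2
    obtain f c d where f: "f \<in> T" "\<not> conn (T - {f}) x y" "ends f = {c, d}" "c \<in> W" "d \<notin> W"
      using conn_path_crosses[OF fo(1) fin(1) cxy x 2(3) TE(1)] by blast
    \<comment> \<open>Core edges have both ends in \<open>W\<close>, whereas \<open>f\<close> leaves
      \<open>W\<close>; dropping \<open>f\<close> therefore keeps the core.\<close>
    have fF: "f \<notin> F" using rt(7)[of f] f by auto
    have "stree (insert e (T - {f}))"
      by (rule exchange_stree[OF T(1) f(1) _ e(2) f(2)]) (use e in auto)
    moreover have "insert e F \<subseteq> insert e (T - {f})" "insert e (T - {f}) \<inter> T' = {}"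
      using T fF 2 by auto
    ultimately show ?thesis using T(2,5) unfolding extendable_def by blast
  next
    case 3
    define A where "A = {w. conn (T' - {e}) r w}"
    have xA: "x \<in> A" using 3 x by (simp add: A_def)
    have nxy: "\<not> conn (T' - {e}) x y" using forestD[OF fo(2) _ e(2)] 3 by simp
    have yA: "y \<notin> A"
    proof
      assume "y \<in> A"
      then have "conn (T' - {e}) x y" using xA conn_sym conn_trans unfolding A_def by blast
      then show False using nxy by simp
    qed
    obtain f c d where f: "f \<in> T" "\<not> conn (T - {f}) x y" "ends f = {c, d}" "c \<in> A" "d \<notin> A"
      using conn_path_crosses[OF fo(1) fin(1) cxy xA yA TE(1)] by blast
    \<comment> \<open>All of \<open>W\<close> stays with the root in \<open>T' - {e}\<close>, so
      \<open>W\<close> is contained in \<open>A\<close>, and an edge leaving \<open>A\<close> is not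
      a core edge.\<close>
    have fF: "f \<notin> F"
    proof
      assume "f \<in> F"
      then have "d \<in> W" using rt(7)[of f] f by auto
      then show False using 3 f by (simp add: A_def)
    qed
    have s1: "stree (insert e (T - {f}))"
      by (rule exchange_stree[OF T(1) f(1) _ e(2) f(2)]) (use e in auto)
    \<comment> \<open>\<open>f\<close> joins the two parts of \<open>T'\<close> that are separated
      by removing \<open>e\<close>, so it can replace \<open>e\<close> there, just as
      \<open>e\<close> replaces \<open>f\<close> in \<open>T\<close>.\<close>
    have ncd: "\<not> conn (T' - {e}) c d" using f conn_trans unfolding A_def by blast
    have s2: "stree (insert f (T' - {e}))"
      by (rule exchange_stree[OF T(2) _ _ f(3) ncd]) (use 3 f TE in auto)
    have "e \<noteq> f" using 3 f T(3) by auto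
    then have "insert e (T - {f}) \<inter> insert f (T' - {e}) = {}" using T(3) by auto
    moreover have "insert e F \<subseteq> insert e (T - {f})" "F' \<subseteq> insert f (T' - {e})"
      using fF T 3 by auto
    ultimately show ?thesis using s1 s2 unfolding extendable_def by blast
  qed
qed

text \<open>If no edge of the star could be added, all of them would fail the test of
  \<open>extend_by_swap\<close>. Failing edges lie in \<open>F'\<close>, lead into \<open>W\<close>
  (at most two per vertex), or lie in \<open>T'\<close> and cut off \<open>x\<close> (at most one)
  or a vertex of \<open>W\<close> while sparing \<open>x\<close> (at most one for each). This sums
  up to \<open>card F' + 1 + 3 * card W\<close>.\<close>

lemma star_extends:
  assumes ex: "extendable F F'" and F: "rtree F W" and x: "x \<in> W"
    and S: "S \<subseteq> E - F" "\<And>e. e \<in> S \<Longrightarrow> x \<in> ends e"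
    and big: "card F' + 1 + 3 * card W < card S"
  shows "\<exists>e\<in>S. extendable (insert e F) F'"
proof (rule ccontr)
  assume none: "\<not> ?thesis"
  obtain T T' where T: "stree T" "stree T'" "T \<inter> T' = {}" "F \<subseteq> T" "F' \<subseteq> T'"
    using ex unfolding extendable_def by blast
  note rt = rtree_props[OF F]
  have finS: "finite S" using S(1) finE finite_subset by blast
  have finT': "finite T'" using T(2) finE finite_subset by (auto simp: stree_def)
  have other: "\<exists>y. ends e = {x, y} \<and> y \<noteq> x" if e: "e \<in> S" for e
  proof -
    obtain a b where "a \<noteq> b" "ends e = {a, b}" using e S(1) ends_E[of e] by blast
    then show ?thesis using S(2)[OF e] by (auto simp: insert_commute)
  qed
  have bad: "e \<notin> T \<and> (e \<in> T' \<or> y \<in> W) \<and> (e \<in> F' \<or> e \<notin> T' \<or> (\<exists>w\<in>W. \<not> conn (T' - {e}) r w))"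
    if e: "e \<in> S" "ends e = {x, y}" "y \<noteq> x" for e y
  proof -
    have eE: "e \<in> E - F" using e S(1) by blast
    have ne: "\<not> extendable (insert e F) F'" using e none by blast
    show ?thesis using extend_by_swap[OF T F x eE e(2,3)] ne by blast
  qed
  define B0 where "B0 = (\<Union>y\<in>W. {e \<in> E. ends e = {x, y}})"
  define B2 where "B2 = {e \<in> S \<inter> T'. \<not> conn (T' - {e}) r x}"
  define B3 where "B3 w = {e \<in> S \<inter> T'. conn (T' - {e}) r x \<and> \<not> conn (T' - {e}) r w}" for w
  have "S \<subseteq> F' \<union> B0 \<union> B2 \<union> (\<Union>w\<in>W. B3 w)"
  proof
    fix e assume e: "e \<in> S"
    obtain y where y: "ends e = {x, y}" "y \<noteq> x" using other[OF e] by blast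
    have eE: "e \<in> E" using e S(1) by blast
    have b: "e \<notin> T" "e \<in> T' \<or> y \<in> W" "e \<in> F' \<or> e \<notin> T' \<or> (\<exists>w\<in>W. \<not> conn (T' - {e}) r w)"
      using bad[OF e y] by auto
    show "e \<in> F' \<union> B0 \<union> B2 \<union> (\<Union>w\<in>W. B3 w)"
    proof (cases "e \<in> T'")
      case True
      then show ?thesis using b e x unfolding B2_def B3_def by blast
    next
      case False
      then have "e \<in> B0" using b y eE unfolding B0_def by blast
      then show ?thesis by blast
    qed
  qed
  moreover have finB3: "finite (B3 w)" for w using finS by (simp add: B3_def)
  moreover have finF': "finite F'" using T(5) finT' finite_subset by blast
  moreover have finB0: "finite B0" unfolding B0_def using rt(4) finE by auto
  moreover have finB2: "finite B2" using finS by (simp add: B2_def)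
  ultimately have "card S \<le> card (F' \<union> B0 \<union> B2 \<union> (\<Union>w\<in>W. B3 w))"
    using rt(4) by (intro card_mono) auto
  also have "\<dots> \<le> card F' + card B0 + card B2 + card (\<Union>w\<in>W. B3 w)"
    by (meson card_Un_le order_trans add_right_mono)
  finally have le: "card S \<le> card F' + card B0 + card B2 + card (\<Union>w\<in>W. B3 w)" .
  have "card B0 \<le> (\<Sum>y\<in>W. card {e \<in> E. ends e = {x, y}})"
    unfolding B0_def by (rule card_UN_le[OF rt(4)])
  also have "\<dots> \<le> (\<Sum>y\<in>W. 2)" by (rule sum_mono) (rule parallel_le_2)
  finally have c0: "card B0 \<le> 2 * card W" by simp
  have c2: "card B2 \<le> 1"
  proof -
    have "e = e'" if "e \<in> B2" "e' \<in> B2" for e e'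
    proof -
      have S: "e \<in> S" "e' \<in> S" using that by (auto simp: B2_def)
      obtain y where y: "ends e = {x, y}" using other[OF S(1)] by blast
      obtain y' where y': "ends e' = {x, y'}" using other[OF S(2)] by blast
      show ?thesis
        by (rule separating_edge_unique_self[OF T(2) _ y _ y']) (use that in \<open>auto simp: B2_def\<close>)
    qed
    then show ?thesis using finB2 by (simp add: card_le_Suc0_iff_eq)
  qed
  have c3: "card (B3 w) \<le> 1" if w: "w \<in> W" for w
  proof -
    have rw: "conn T' r w" using w rt(2) T(2) by (auto simp: stree_def)
    have "e = e'" if "e \<in> B3 w" "e' \<in> B3 w" for e e'
    proof -
      have S: "e \<in> S" "e' \<in> S" using that by (auto simp: B3_def)
      obtain y where y: "ends e = {x, y}" using other[OF S(1)] by blast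
      obtain y' where y': "ends e' = {x, y'}" using other[OF S(2)] by blast
      show ?thesis
        by (rule separating_edge_unique[OF _ y _ y' _ _ rw]) (use that in \<open>auto simp: B3_def\<close>)
    qed
    then show ?thesis using finB3 by (simp add: card_le_Suc0_iff_eq)
  qed
  have "card (\<Union>w\<in>W. B3 w) \<le> (\<Sum>w\<in>W. card (B3 w))" by (rule card_UN_le[OF rt(4)])
  also have "\<dots> \<le> (\<Sum>w\<in>W. 1)" by (rule sum_mono) (rule c3)
  finally show False using le c0 c2 big by simp
qed

section \<open>Subtrees at the root: crossing edges, leaves and maximality\<close>

lemma closed_under_crossing:
  assumes c: "conn X r w" and W: "r \<in> W"
    and n: "\<And>e a b. e \<in> X \<Longrightarrow> ends e = {a, b} \<Longrightarrow> a \<in> W \<Longrightarrow> b \<in> W"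
  shows "w \<in> W"
  by (rule conn_closed[OF c W]) (rule n)

lemma rtree_crossing:
  assumes F: "rtree F W" and c: "conn X r w" "w \<notin> W"
  obtains e a b where "e \<in> X" "ends e = {a, b}" "a \<in> W" "b \<notin> W"
proof -
  have "\<exists>e a b. e \<in> X \<and> ends e = {a, b} \<and> a \<in> W \<and> b \<notin> W"
  proof (rule ccontr)
    assume n: "\<not> ?thesis"
    have "w \<in> W"
      by (rule closed_under_crossing[OF c(1) rtree_props(6)[OF F]]) (use n in blast)
    then show False using c by simp
  qed
  then show ?thesis using that by blast
qed

lemma rtree_psubset_vertex:
  assumes "rtree F W" "rtree F' W'" "F \<subset> F'"
  shows "\<exists>w\<in>W'. w \<notin> W"
proof (rule ccontr)
  assume "\<not> ?thesis"
  then have "card W' \<le> card W"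
    using rtree_props(4)[OF assms(1)] by (intro card_mono) auto
  moreover have "card F < card F'" using psubset_card_mono[OF rtree_props(3)[OF assms(2)] assms(3)] .
  ultimately show False using rtree_props(5)[OF assms(1)] rtree_props(5)[OF assms(2)] by simp
qed

lemma rtree_extension_edge:
  assumes "rtree F W" "rtree F' W'" "F \<subset> F'"
  obtains e a b where "e \<in> F'" "e \<notin> F" "ends e = {a, b}" "a \<in> W" "b \<notin> W" "rtree (insert e F) (insert b W)"
proof -
  obtain w where w: "w \<in> W'" "w \<notin> W" using rtree_psubset_vertex[OF assms] by blast
  have "conn F' r w" using w rtree_props(8)[OF assms(2)] by simp
  then obtain e a b where e: "e \<in> F'" "ends e = {a, b}" "a \<in> W" "b \<notin> W"
    using rtree_crossing[OF assms(1) _ w(2)] by blast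
  have "e \<notin> F" using rtree_props(7)[OF assms(1), of e] e by auto
  moreover have "rtree (insert e F) (insert b W)"
    by (rule rtree_step[OF assms(1) _ e(2-4)]) (use e rtree_props(1)[OF assms(2)] in blast)
  ultimately show ?thesis using that e by blast
qed

text \<open>When \<open>F\<close> is grown up to \<open>F'\<close>, the last edge hangs a leaf
  \<open>l\<close> on a subtree \<open>H\<close> that still contains \<open>F\<close>. This is the
  leaf that may be dropped without touching what has been fixed already.\<close>

lemma rtree_last_step:
  assumes "rtree F W" "rtree F' W'" "F \<subset> F'"
  shows "\<exists>H U h a l. rtree H U \<and> F \<subseteq> H \<and> h \<notin> H \<and> F' = insert h H \<and> ends h = {a, l} \<and> a \<in> U \<and> l \<notin> U
    \<and> W' = insert l U"
  using assms
proof (induction "card (F' - F)" arbitrary: F W rule: less_induct)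
  case less
  obtain e a b where e: "e \<in> F'" "e \<notin> F" "ends e = {a, b}" "a \<in> W" "b \<notin> W"
    and rt: "rtree (insert e F) (insert b W)"
    using rtree_extension_edge[OF less.prems] .
  show ?case
  proof (cases "insert e F = F'")
    case True
    have "W' = insert b W" using rtree_unique[OF less.prems(2)] rt True by simp
    then show ?thesis using less.prems(1) e True by blast
  next
    case False
    then have ps: "insert e F \<subset> F'" using e less.prems(3) by auto
    have "finite F'" using rtree_props(3)[OF less.prems(2)] .
    then have "card (F' - insert e F) < card (F' - F)"
      using e by (intro psubset_card_mono) auto
    from less.hyps[OF this rt less.prems(2) ps] show ?thesis by blast
  qed
qed

text \<open>Applied with \<open>X = F' - {g}\<close> it collects all of the tree on the root's side
  of \<open>g\<close>, so that whatever is added afterwards lies behind \<open>g\<close>. Since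
  \<open>rtree\<close> admits edges of \<open>E\<close> only, the claim about reached vertices
  carries the condition \<open>X \<subseteq> E\<close>.\<close>

lemma rtree_maximal_within:
  assumes "rtree F W" "F \<subseteq> X" "finite X"
  shows "\<exists>G U. rtree G U \<and> F \<subseteq> G \<and> G \<subseteq> X \<and> (\<forall>w. conn X r w \<longrightarrow> X \<subseteq> E \<longrightarrow> w \<in> U)"
  using assms
proof (induction "card (X - F)" arbitrary: F W rule: less_induct)
  case less
  show ?case
  proof (cases "X \<subseteq> E \<and> (\<exists>w. conn X r w \<and> w \<notin> W)")
    case False
    then show ?thesis using less.prems by blast
  next
    case True
    then obtain w where w: "conn X r w" "w \<notin> W" by blast
    obtain e a b where e: "e \<in> X" "ends e = {a, b}" "a \<in> W" "b \<notin> W"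
      using rtree_crossing[OF less.prems(1) w] by blast
    have eF: "e \<notin> F" using rtree_props(7)[OF less.prems(1), of e] e by auto
    have rt: "rtree (insert e F) (insert b W)"
      by (rule rtree_step[OF less.prems(1) _ e(2-4)]) (use e True in blast)
    have "card (X - insert e F) < card (X - F)"
      using e eF less.prems(3) by (intro psubset_card_mono) auto
    moreover have "insert e F \<subseteq> X" using less.prems e by simp
    ultimately have "\<exists>G U. rtree G U \<and> insert e F \<subseteq> G \<and> G \<subseteq> X \<and> (\<forall>w. conn X r w \<longrightarrow> X \<subseteq> E \<longrightarrow> w \<in> U)"
      using less.hyps[OF _ rt _ less.prems(3)] by blast
    then show ?thesis by auto
  qed
qed

text \<open>Replacing a leaf \<open>l\<close> that lies beyond the edge \<open>g = xz\<close> by a new leaf \<open>y\<close> attached to \<open>x\<close>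
  keeps the tree safe: whenever \<open>l\<close> is reachable in the absence of a vertex, so is \<open>x\<close>.\<close>

lemma replace_leaf_safe:
  assumes safe: "safe_edges k (insert h H)"
    and H: "rtree H U" and h: "ends h = {a, l}" "a \<in> U" "l \<notin> U" and F': "rtree (insert h H) (insert l U)"
    and g: "g \<in> insert h H" "ends g = {x, z}" "\<not> conn (insert h H - {g}) r l"
    and x: "x \<in> U" and e: "e \<in> E" "ends e = {x, y}" "y \<notin> insert l U"
  shows "safe_edges k (insert e H)"
  unfolding safe_edges_def
proof
  fix v assume v: "v \<in> V - {r}"
  let ?A = "{w \<in> V - {r, v}. conn (avoid (insert h H) v) r w}"
  let ?B = "{w \<in> V - {r, v}. conn (avoid (insert e H) v) r w}"
  note rH = rtree_props[OF H]
  have lV: "l \<in> V" using rtree_props(2)[OF F'] by auto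
  have yV: "y \<in> V" using ends_E[OF e(1)] e(2) by (auto simp: doubleton_eq_iff)
  have yr: "y \<noteq> r" "l \<noteq> r" using e h rH(6) by auto
  have lH: "l \<notin> ends f" if "f \<in> H" for f using rH(7)[OF that] h by auto
  have keep: "conn (avoid H v) r w" if "conn (avoid (insert h H) v) r w" "w \<noteq> l" for w
  proof -
    have "conn (insert h (avoid H v)) r w"
      using that(1) by (rule conn_mono) (auto simp: avoid_def)
    moreover have "\<not> conn (avoid H v) l w"
      using conn_isolated[of "avoid H v" l w] lH that(2) by (auto simp: avoid_def)
    moreover have "\<not> conn (avoid H v) r l"
    proof
      assume "conn (avoid H v) r l"
      then have "conn H r l" by (rule conn_mono) (auto simp: avoid_def)
      then show False using rH(8) h by simp
    qed
    ultimately show ?thesis using conn_insert[OF h(1), of "avoid H v" r w] by blast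
  qed
  have up: "conn (avoid (insert e H) v) r w" if "conn (avoid H v) r w" for w
    using that by (rule conn_mono) (auto simp: avoid_def)
  have AB: "?A - {l} \<subseteq> ?B" using keep up by blast
  have finB: "finite ?B" using finV by simp
  have kA: "k \<le> Suc (card ?A)" using safe v unfolding safe_edges_def by blast
  have "k \<le> Suc (card ?B)"
  proof (cases "v = y")
    case True
    \<comment> \<open>Removing the new leaf \<open>y\<close> is compared with removing the old leaf
      \<open>l\<close>: either one leaves all of \<open>H\<close>, so the bound known for
      \<open>l\<close> carries over.\<close>
    let ?L = "{w \<in> V - {r, l}. conn (avoid (insert h H) l) r w}"
    have "?L \<subseteq> ?B"
    proof
      fix w assume w: "w \<in> ?L"
      then have "conn (avoid (insert h H) l) r w" by simp
      then have "conn H r w"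
        by (rule conn_mono) (use h in \<open>auto simp: avoid_def\<close>)
      moreover have "H \<subseteq> avoid (insert e H) v"
        using True e rH(7) by (auto simp: avoid_def)
      ultimately have "conn (avoid (insert e H) v) r w" by (rule conn_mono)
      moreover have "w \<noteq> y" using \<open>conn H r w\<close> rH(8) e by auto
      ultimately show "w \<in> ?B" using w True by simp
    qed
    then have "card ?L \<le> card ?B" by (rule card_mono[OF finB])
    moreover have "k \<le> Suc (card ?L)" using safe lV yr unfolding safe_edges_def by blast
    ultimately show ?thesis by simp
  next
    case vy: False
    show ?thesis
    proof (cases "l \<in> ?A")
      case False
      then have "?A \<subseteq> ?B" using AB by auto
      then have "card ?A \<le> card ?B" by (rule card_mono[OF finB])
      then show ?thesis using kA by simp
    next
      case True
      then have cl: "conn (avoid (insert h H) v) r l" and vl: "v \<noteq> l" by auto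
      \<comment> \<open>A vertex \<open>v\<close> at an end of \<open>g\<close> would take
        \<open>g\<close> with it, and \<open>l\<close> cannot be reached without
        \<open>g\<close>.\<close>
      have vxz: "v \<notin> {x, z}"
      proof
        assume "v \<in> {x, z}"
        then have "avoid (insert h H) v \<subseteq> insert h H - {g}" using g(2) by (auto simp: avoid_def)
        then show False using conn_mono[OF cl] g(3) by blast
      qed
      let ?X = "avoid (insert h H) v - {g}"
      have gX: "g \<in> avoid (insert h H) v" using g vxz by (auto simp: avoid_def)
      then have ins: "insert g ?X = avoid (insert h H) v" by auto
      have "\<not> conn ?X r l"
      proof
        assume "conn ?X r l"
        then have "conn (insert h H - {g}) r l" by (rule conn_mono) (auto simp: avoid_def)
        then show False using g by simp
      qed
      then have "conn ?X r x \<or> conn ?X r z"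
        using conn_insert[OF g(2), of ?X r l] cl unfolding ins by blast
      moreover have "conn (avoid (insert h H) v) r w" if "conn ?X r w" for w
        using that by (rule conn_mono) auto
      moreover have "conn (avoid (insert h H) v) z x"
        by (rule conn_sym[OF conn_edge[OF gX g(2)]])
      ultimately have "conn (avoid (insert h H) v) r x" using conn_trans by blast
      then have "conn (avoid H v) r x" using keep x h by blast
      then have rx: "conn (avoid (insert e H) v) r x" by (rule up)
      have "e \<in> avoid (insert e H) v" using e vxz vy by (auto simp: avoid_def)
      then have "conn (avoid (insert e H) v) x y" by (rule conn_edge[OF _ e(2)])
      with rx have "conn (avoid (insert e H) v) r y" by (rule conn_trans)
      then have yB: "y \<in> ?B" using yV yr vy by simp
      have "y \<notin> ?A"
      proof
        assume "y \<in> ?A"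
        then have "conn (avoid (insert h H) v) r y" by simp
        then have "conn (insert h H) r y" by (rule conn_mono) (auto simp: avoid_def)
        then show False using rtree_props(8)[OF F'] e by simp
      qed
      \<comment> \<open>The loss of \<open>l\<close> is made up for by \<open>y\<close>, which was
        not reached before.\<close>
      have "card ?A = Suc (card (?A - {l}))" using True finV by (intro card.remove) auto
      also have "\<dots> = card (insert y (?A - {l}))" 
        using \<open>y \<notin> ?A\<close> finV by (intro card_insert_disjoint[symmetric]) (simp, blast)
      also have "\<dots> \<le> card ?B" using AB yB by (intro card_mono[OF finB]) auto
      finally show ?thesis using kA by simp
    qed
  qed
  then show "k \<le> Suc (card ?B)" .
qed

text \<open>The alternative for \<open>cand x\<close> is what a truncated list provides: all usable
  edges at \<open>x\<close>, or at least \<open>M\<close> of them. In the first case the next core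
  edge at \<open>x\<close> is itself a candidate; in the second either some candidate lies in the
  core, or the star of candidates is large enough for an exchange. The core may change, but it keeps
  its size and contains \<open>F\<close>. \<open>P\<close> holds edges already taken by the other
  tree.\<close>

lemma core_growth:
  assumes F: "rtree F W" and F': "rtree F' W'" "F \<subset> F'" and safe: "safe_edges k F'"
    and ex: "extendable F' G" and N: "card F' \<le> N" "card G \<le> N" and PG: "P \<subseteq> G"
    and cand: "\<And>x. x \<in> W \<Longrightarrow> cand x \<subseteq> {e \<in> E - P. \<exists>y. ends e = {x, y} \<and> y \<notin> W}"
    and M: "4 * N + 5 \<le> M"
    and full: "\<And>x. x \<in> W \<Longrightarrow> cand x = {e \<in> E - P. \<exists>y. ends e = {x, y} \<and> y \<notin> W} \<or> M \<le> card (cand x)"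
  shows "\<exists>x\<in>W. \<exists>e\<in>cand x. \<exists>F'' W''. rtree F'' W'' \<and> insert e F \<subseteq> F'' \<and> safe_edges k F'' \<and>
    extendable F'' G \<and> card F'' = card F'"
proof -
  obtain g x z where g: "g \<in> F'" "g \<notin> F" "ends g = {x, z}" "x \<in> W" "z \<notin> W"
    using rtree_extension_edge[OF F F'] by metis
  note rF = rtree_props[OF F] and rF' = rtree_props[OF F'(1)]
  have hit: ?thesis if "e \<in> cand x" "e \<in> F'" for e
    using that g(4) F' safe ex by blast
  have FG: "F' \<inter> G = {}" using ex unfolding extendable_def by blast
  have gE: "g \<in> E - P" using g rF'(1) FG PG by blast
  show ?thesis
  proof (cases "cand x \<inter> F' = {}")
    case False
    then show ?thesis using hit by blast
  next
    case True
    then have "g \<notin> cand x" using g by blast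
    then have "cand x \<noteq> {e \<in> E - P. \<exists>y. ends e = {x, y} \<and> y \<notin> W}" using g gE by blast
    then have cM: "M \<le> card (cand x)" using full[OF g(4)] by blast
    have WW': "W \<subseteq> W'" by (rule rtree_mono[OF F F'(1)]) (use F' in auto)
    have xW': "x \<in> W'" using g WW' by blast
    have "\<exists>e\<in>cand x. extendable (insert e F') G"
    proof (rule star_extends[OF ex F'(1) xW'])
      show "cand x \<subseteq> E - F'" using cand[OF g(4)] True by blast
      show "x \<in> ends e" if "e \<in> cand x" for e using cand[OF g(4)] that by blast
      \<comment> \<open>Since \<open>card W' = card F' + 1\<close>, the left side is at most
        \<open>N + 1 + 3 * (N + 1) = 4 * N + 4\<close>; this is where \<open>4 * N + 5\<close> comes
        from.\<close>
      show "card G + 1 + 3 * card W' < card (cand x)"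
        using N M cM rF'(5) by simp
    qed
    then obtain e where e: "e \<in> cand x" "extendable (insert e F') G" by blast
    have "e \<in> {e \<in> E - P. \<exists>y. ends e = {x, y} \<and> y \<notin> W}" using cand[OF g(4)] e(1) by (rule subsetD)
    then obtain y where eE: "e \<in> E" and y: "ends e = {x, y}" "y \<notin> W" by blast
    have eF': "e \<notin> F'" using e True by blast
    have fo: "forest (insert e F')"
    proof -
      obtain T where T: "stree T" "insert e F' \<subseteq> T" using e(2) unfolding extendable_def by blast
      then have "forest T" by (simp add: stree_def)
      then show ?thesis using T(2) by (rule forest_subset)
    qed
    have yW': "y \<notin> W'"
    proof
      assume "y \<in> W'"
      then have "conn F' r x" "conn F' r y" using xW' rF'(8) by auto
      then have "conn F' x y" using conn_sym conn_trans by blast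
      moreover have "insert e F' - {e} = F'" using eF' by auto
      ultimately show False using forestD[OF fo _ y(1)] by simp
    qed
    \<comment> \<open>Everything of the core that survives without \<open>g\<close> is collected
      first, so that the leaf found next hangs behind \<open>g\<close>.\<close>
    obtain G0 U0 where G0: "rtree G0 U0" "F \<subseteq> G0" "G0 \<subseteq> F' - {g}"
      "\<And>w. conn (F' - {g}) r w \<Longrightarrow> w \<in> U0"
    proof -
      have s: "F \<subseteq> F' - {g}" "finite (F' - {g})" "F' - {g} \<subseteq> E" using F' g rF' by auto
      show ?thesis using that rtree_maximal_within[OF F s(1,2)] s(3) by blast
    qed
    have ps: "G0 \<subset> F'" using G0 g by blast
    obtain H U h a l where H: "rtree H U" "G0 \<subseteq> H" "h \<notin> H" "F' = insert h H" "ends h = {a, l}"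
      "a \<in> U" "l \<notin> U" "W' = insert l U"
      using rtree_last_step[OF G0(1) F'(1) ps] by metis
    have FH: "F \<subseteq> H" using G0 H by blast
    have xU: "x \<in> U" using rtree_mono[OF F H(1) FH] g by blast
    \<comment> \<open>A connection avoiding \<open>g\<close> would put \<open>l\<close> into
      \<open>U0\<close>, which is contained in \<open>U\<close>.\<close>
    have ngl: "\<not> conn (insert h H - {g}) r l"
      using G0(4)[of l] H rtree_mono[OF G0(1) H(1,2)] by blast
    have safe': "safe_edges k (insert e H)"
    proof (rule replace_leaf_safe[OF _ H(1,5-7) _ _ g(3) ngl xU eE y(1)])
      show "safe_edges k (insert h H)" using safe H by simp
      show "rtree (insert h H) (insert l U)" using F' H by simp
      show "g \<in> insert h H" using g H by simp
      show "y \<notin> insert l U" using yW' H by simp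
    qed
    have rt: "rtree (insert e H) (insert y U)"
      by (rule rtree_step[OF H(1) eE y(1) xU]) (use yW' H in simp)
    have "insert e F \<subseteq> insert e H" using FH by auto
    moreover have "extendable (insert e H) G"
      using e(2) H(4) unfolding extendable_def by blast
    moreover have "card (insert e H) = card F'"
      using eF' H rtree_props(3)[OF H(1)] by simp
    ultimately show ?thesis using rt safe' g(4) e(1) by blast
  qed
qed

section \<open>Existence of small safe cores\<close>

lemma rtree_of_size:
  assumes "X \<subseteq> E" "m \<le> card {w \<in> V - {r}. conn X r w}"
  shows "\<exists>F W. rtree F W \<and> F \<subseteq> X \<and> card F = m"
  using assms(2)
proof (induction m)
  case 0
  then show ?case using rtree_base by force
next
  case (Suc m)
  then obtain F W where F: "rtree F W" "F \<subseteq> X" "card F = m" by auto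
  note rF = rtree_props[OF F(1)]
  have "\<exists>w. conn X r w \<and> w \<notin> W"
  proof (rule ccontr)
    assume "\<not> ?thesis"
    then have "{w \<in> V - {r}. conn X r w} \<subseteq> W - {r}" by auto
    then have "card {w \<in> V - {r}. conn X r w} \<le> card (W - {r})" using rF(4) by (intro card_mono) auto
    also have "\<dots> = m" using rF(4-6) F(3) by simp
    finally show False using Suc.prems by simp
  qed
  then obtain w where w: "conn X r w" "w \<notin> W" by blast
  obtain e a b where e: "e \<in> X" "ends e = {a, b}" "a \<in> W" "b \<notin> W"
    using rtree_crossing[OF F(1) w] by blast
  have eF: "e \<notin> F" using rF(7)[of e] e by auto
  have rt: "rtree (insert e F) (insert b W)"
    by (rule rtree_step[OF F(1) _ e(2-4)]) (use e assms(1) in blast)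
  then show ?case using F e eF rF(3) by (intro exI[of _ "insert e F"] exI[of _ "insert b W"]) auto
qed

text \<open>Inside a forest the edges of \<open>F'\<close> can be appended to \<open>F\<close> in
  their order of growth. A new edge cannot join two vertices reached already, since it would close a
  cycle in \<open>T\<close>.\<close>

lemma rtree_union:
  assumes "rtree F' W'" "rtree F W" "F \<subseteq> T" "F' \<subseteq> T" "forest T"
  shows "\<exists>U. rtree (F \<union> F') U"
  using assms
proof (induction rule: rtree.induct)
  case rtree_base
  then show ?case by auto
next
  case (rtree_step F' W' e a b)
  then obtain U where U: "rtree (F \<union> F') U" by auto
  note rU = rtree_props[OF U]
  have W'U: "W' \<subseteq> U" by (rule rtree_mono[OF rtree_step.hyps(1) U]) auto
  then have aU: "a \<in> U" using rtree_step by blast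
  show ?case
  proof (cases "e \<in> F \<union> F'")
    case True
    then have "F \<union> insert e F' = F \<union> F'" by auto
    then show ?thesis using U by auto
  next
    case False
    have bU: "b \<notin> U"
    proof
      assume "b \<in> U"
      then have "conn (F \<union> F') r a" "conn (F \<union> F') r b" using aU rU(8) by auto
      then have "conn (F \<union> F') a b" using conn_sym conn_trans by blast
      then have "conn (T - {e}) a b"
        by (rule conn_mono) (use False rtree_step.prems in auto)
      then show False using forestD[OF rtree_step.prems(4) _ rtree_step.hyps(3)] rtree_step.prems(3) by simp
    qed
    have "rtree (insert e (F \<union> F')) (insert b U)"
      by (rule rtree.rtree_step[OF U rtree_step.hyps(2,3) aU bU])
    then show ?thesis by auto
  qed
qed

lemma safe_core:
  assumes T: "stree T" and safe: "safe_edges k T" and k: "1 \<le> k"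
  shows "\<exists>F W. rtree F W \<and> F \<subseteq> T \<and> safe_edges k F \<and> card F \<le> k * k"
proof (cases "V = {r}")
  case True
  then have "safe_edges k {}" unfolding safe_edges_def by simp
  then show ?thesis using rtree_base by (intro exI[of _ "{}"] exI[of _ "{r}"]) simp
next
  case False
  \<comment> \<open>Any non-root vertex serves to provide the \<open>k - 1\<close> reachable
    vertices for \<open>F0\<close>.\<close>
  then obtain v0 where v0: "v0 \<in> V - {r}" using rV by blast
  have TE: "T \<subseteq> E" and fo: "forest T" using T by (auto simp: stree_def)
  have reach: "\<exists>F W. rtree F W \<and> F \<subseteq> avoid T v \<and> card F = k - 1" if v: "v \<in> V - {r}" for v
  proof (rule rtree_of_size)
    show "avoid T v \<subseteq> E" using TE by (auto simp: avoid_def)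
    have "k - 1 \<le> card {w \<in> V - {r, v}. conn (avoid T v) r w}"
      using bspec[OF safe[unfolded safe_edges_def] v] by simp
    also have "\<dots> \<le> card {w \<in> V - {r}. conn (avoid T v) r w}"
      using finV by (intro card_mono) auto
    finally show "k - 1 \<le> card {w \<in> V - {r}. conn (avoid T v) r w}" .
  qed
  have sub: "avoid T v \<subseteq> T" for v by (auto simp: avoid_def)
  obtain F0 W0 where F0: "rtree F0 W0" "F0 \<subseteq> T" "card F0 = k - 1"
    using reach[OF v0] sub[of v0] by blast
  note r0 = rtree_props[OF F0(1)]
  obtain f w where fw: "\<And>v. v \<in> V - {r} \<Longrightarrow> rtree (f v) (w v) \<and> f v \<subseteq> avoid T v \<and> card (f v) = k - 1"
    using reach by metis
  have comb: "\<exists>U. rtree (F0 \<union> \<Union> (f ` A)) U" "card (F0 \<union> \<Union> (f ` A)) \<le> (k - 1) + card A * (k - 1)"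
    "F0 \<union> \<Union> (f ` A) \<subseteq> T"
    if "finite A" "A \<subseteq> V - {r}" for A
    using that
  proof (induction A rule: finite_induct)
    case empty
    {
      case 1 then show ?case using F0 by auto
    next
      case 2 then show ?case using F0 by auto
    next
      case 3 then show ?case using F0 by auto
    }
  next
    case (insert v A)
    have v: "v \<in> V - {r}" if "insert v A \<subseteq> V - {r}" using that by auto
    have eq: "F0 \<union> \<Union> (f ` insert v A) = (F0 \<union> \<Union> (f ` A)) \<union> f v" by auto
    {
      case 1
      then have "f v \<subseteq> T" "rtree (f v) (w v)" using fw[OF v] sub by auto
      moreover obtain U where "rtree (F0 \<union> \<Union> (f ` A)) U" using insert 1 by auto
      moreover have "F0 \<union> \<Union> (f ` A) \<subseteq> T" using insert 1 by auto
      ultimately show ?case unfolding eq using rtree_union fo by blast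
    next
      case 2
      have "card (F0 \<union> \<Union> (f ` insert v A)) \<le> card (F0 \<union> \<Union> (f ` A)) + card (f v)"
        unfolding eq by (rule card_Un_le)
      then show ?case using insert 2 fw[OF v] by auto
    next
      case 3
      then show ?case using insert 3 fw[OF v] sub unfolding eq by blast
    }
  qed
  let ?A = "W0 - {r}"
  have A: "finite ?A" "?A \<subseteq> V - {r}" "card ?A = k - 1" using r0 F0 by auto
  let ?F = "F0 \<union> \<Union> (f ` ?A)"
  obtain U where U: "rtree ?F U" using comb(1)[OF A(1,2)] by blast
  \<comment> \<open>\<open>F0\<close> and the \<open>k - 1\<close> trees \<open>f v\<close> have
    \<open>k - 1\<close> edges each, so together at most \<open>(k - 1) * k\<close>.\<close>
  have "card ?F \<le> (k - 1) + (k - 1) * (k - 1)" using comb(2)[OF A(1,2)] A(3) by simp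
  also have "\<dots> = (k - 1) * k" using k by (cases k) auto
  also have "\<dots> \<le> k * k" by simp
  finally have cF: "card ?F \<le> k * k" .
  have "safe_edges k ?F"
    unfolding safe_edges_def
  proof
    fix v assume v: "v \<in> V - {r}"
    let ?B = "{w \<in> V - {r, v}. conn (avoid ?F v) r w}"
    have gen: "k \<le> Suc (card ?B)" if K: "rtree K Z" "K \<subseteq> avoid ?F v" "card K = k - 1" for K Z
    proof -
      note rK = rtree_props[OF K(1)]
      have "v \<notin> Z"
      proof
        assume "v \<in> Z"
        then have "conn K v r" using rK(8) conn_sym by blast
        then have "r = v" by (rule conn_isolated) (use K in \<open>auto simp: avoid_def\<close>)
        then show False using v by simp
      qed
      have "Z - {r} \<subseteq> ?B"
      proof
        fix u assume u: "u \<in> Z - {r}"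
        then have "conn K r u" using rK(8) by simp
        then have "conn (avoid ?F v) r u" using K(2) by (rule conn_mono)
        then show "u \<in> ?B" using u rK(2) \<open>v \<notin> Z\<close> by auto
      qed
      then have "card (Z - {r}) \<le> card ?B" using finV by (intro card_mono) auto
      then show ?thesis using rK(4-6) K(3) by simp
    qed
    \<comment> \<open>Deleting a vertex of \<open>F0\<close> leaves the tree chosen to avoid it;
      deleting any other vertex leaves \<open>F0\<close> itself.\<close>
    show "k \<le> Suc (card ?B)"
    proof (cases "v \<in> W0")
      case True
      then have "f v \<subseteq> avoid ?F v" using v fw[OF v] by (auto simp: avoid_def)
      then show ?thesis using gen fw[OF v] by blast
    next
      case False
      then have "F0 \<subseteq> avoid ?F v" using r0(7) by (auto simp: avoid_def)
      then show ?thesis using gen F0 by blast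
    qed
  qed
  then show ?thesis using U comb(3)[OF A(1,2)] cF by blast
qed

end

section \<open>A language with bounded loops\<close>

text \<open>Bounded loops: \<open>LFor i b p\<close> runs \<open>p\<close> with counter bank \<open>i\<close> (address 0) from 0 up to
  the content of bank \<open>b\<close> (address 0).\<close>

datatype lp =
    LSkip
  | LStore nat expr expr
  | LSeq lp lp (infixr ";;" 60)
  | LIf expr lp lp
  | LFor nat nat lp

definition upd :: "memory \<Rightarrow> nat \<Rightarrow> nat \<Rightarrow> nat \<Rightarrow> memory" where
  "upd s b a x = s(b := (s b)(a := x))"

lemma upd_same [simp]: "upd s b a x b = (s b)(a := x)"
  by (simp add: upd_def)

lemma upd_other [simp]: "c \<noteq> b \<Longrightarrow> upd s b a x c = s c"
  by (simp add: upd_def)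

abbreviation rd :: "nat \<Rightarrow> expr" where
  "rd b \<equiv> Cell b (Const 0)"

text \<open>Total because the number of rounds is read once, on entry. The while loop of
  \<open>compile\<close> reads counter and bound again in every round; the two agree as long as the
  body writes neither, which \<open>wf_lp\<close> requires.\<close>

primrec sem :: "lp \<Rightarrow> memory \<Rightarrow> memory" where
  "sem LSkip s = s"
| "sem (LStore b a e) s = upd s b (eval_expr a s) (eval_expr e s)"
| "sem (p ;; q) s = sem q (sem p s)"
| "sem (LIf e p q) s = (if eval_expr e s \<noteq> 0 then sem p s else sem q s)"
| "sem (LFor i b p) s = rec_nat (upd s i 0 0) (\<lambda>j s'. upd (sem p s') i 0 (Suc j)) (s b 0)"

primrec compile :: "lp \<Rightarrow> prog" where
  "compile LSkip = Skip"
| "compile (LStore b a e) = Store b a e"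
| "compile (p ;; q) = Seq (compile p) (compile q)"
| "compile (LIf e p q) = Cond e (compile p) (compile q)"
| "compile (LFor i b p) = Seq (Store i (Const 0) (Const 0))
     (While (Monus (rd b) (rd i))
       (Seq (compile p) (Store i (Const 0) (Plus (rd i) (Const 1)))))"

primrec writes :: "lp \<Rightarrow> nat set" where
  "writes LSkip = {}"
| "writes (LStore b a e) = {b}"
| "writes (p ;; q) = writes p \<union> writes q"
| "writes (LIf e p q) = writes p \<union> writes q"
| "writes (LFor i b p) = insert i (writes p)"

text \<open>If the program writes none of these banks, one number \<open>Z\<close> bounds the rounds
  of all its loops, and the time is at most a constant times \<open>Z\<close> to the nesting
  depth.\<close>

primrec bnds :: "lp \<Rightarrow> nat set" where
  "bnds LSkip = {}"
| "bnds (LStore b a e) = {}"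
| "bnds (p ;; q) = bnds p \<union> bnds q"
| "bnds (LIf e p q) = bnds p \<union> bnds q"
| "bnds (LFor i b p) = insert b (bnds p)"

primrec wf_lp :: "lp \<Rightarrow> bool" where
  "wf_lp LSkip = True"
| "wf_lp (LStore b a e) = True"
| "wf_lp (p ;; q) = (wf_lp p \<and> wf_lp q)"
| "wf_lp (LIf e p q) = (wf_lp p \<and> wf_lp q)"
| "wf_lp (LFor i b p) = (i \<noteq> b \<and> i \<notin> writes p \<and> b \<notin> writes p \<and> wf_lp p)"

primrec depth :: "lp \<Rightarrow> nat" where
  "depth LSkip = 0"
| "depth (LStore b a e) = 0"
| "depth (p ;; q) = max (depth p) (depth q)"
| "depth (LIf e p q) = max (depth p) (depth q)"
| "depth (LFor i b p) = Suc (depth p)"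

text \<open>A loop pays 12 steps per round for the test and the counter, and 9 once, for resetting
  the counter and for the final test; these make up the 21.\<close>

primrec cost :: "lp \<Rightarrow> nat" where
  "cost LSkip = 1"
| "cost (LStore b a e) = 1 + cost_expr a + cost_expr e"
| "cost (p ;; q) = cost p + cost q"
| "cost (LIf e p q) = 1 + cost_expr e + cost p + cost q"
| "cost (LFor i b p) = cost p + 21"

lemma sem_frame: "b \<notin> writes p \<Longrightarrow> sem p s b = s b"
proof (induction p arbitrary: s)
  case (LFor i c p)
  have "rec_nat (upd s i 0 0) (\<lambda>j s'. upd (sem p s') i 0 (Suc j)) N b = s b" for N
    by (induction N) (use LFor in auto)
  then show ?case by simp
qed auto

text \<open>The step may assume that banks not written by the loop keep their initial contents.
  Invariants therefore mention only what the body changes; fixed data such as \<open>ctx\<close> is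
  recovered from the frame.\<close>

lemma sem_For_inv:
  assumes "P 0 (upd s i 0 0)"
    and "\<And>j s'. j < s b 0 \<Longrightarrow> P j s' \<Longrightarrow> s' i 0 = j \<Longrightarrow>
      (\<And>c. c \<notin> insert i (writes p) \<Longrightarrow> s' c = s c) \<Longrightarrow> P (Suc j) (upd (sem p s') i 0 (Suc j))"
  shows "P (s b 0) (sem (LFor i b p) s)"
proof -
  let ?f = "rec_nat (upd s i 0 0) (\<lambda>j s'. upd (sem p s') i 0 (Suc j))"
  have "N \<le> s b 0 \<longrightarrow> P N (?f N) \<and> ?f N i 0 = N \<and> (\<forall>c. c \<notin> insert i (writes p) \<longrightarrow> ?f N c = s c)" for N
    by (induction N) (use assms sem_frame in auto)
  then show ?thesis by auto
qed

lemma exec_Store: "exec (Store b a e) s (1 + cost_expr a + cost_expr e)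
    (upd s b (eval_expr a s) (eval_expr e s))"
  unfolding upd_def by (rule exec.Store)

lemma exec_compile:
  assumes "wf_lp p" "bnds p \<inter> writes p = {}" "\<And>b. b \<in> bnds p \<Longrightarrow> s b 0 \<le> Z" "1 \<le> Z"
  shows "\<exists>t. exec (compile p) s t (sem p s) \<and> t \<le> cost p * Z ^ depth p"
  using assms
proof (induction p arbitrary: s)
  case LSkip
  then show ?case using exec.Skip by auto
next
  case (LStore b a e)
  show ?case using exec_Store[of b a e s] by auto
next
  case (LSeq p q)
  have "\<exists>t. exec (compile p) s t (sem p s) \<and> t \<le> cost p * Z ^ depth p"
    using LSeq.prems by (intro LSeq.IH(1)) auto
  then obtain t where t: "exec (compile p) s t (sem p s)" "t \<le> cost p * Z ^ depth p" by blast
  have "\<exists>t. exec (compile q) (sem p s) t (sem q (sem p s)) \<and> t \<le> cost q * Z ^ depth q"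
  proof (rule LSeq.IH(2))
    fix b assume b: "b \<in> bnds q"
    then have "sem p s b = s b" using LSeq.prems(2) by (intro sem_frame) auto
    then show "sem p s b 0 \<le> Z" using LSeq.prems(3) b by auto
  qed (use LSeq.prems in auto)
  then obtain u where u: "exec (compile q) (sem p s) u (sem q (sem p s))" "u \<le> cost q * Z ^ depth q"
    by blast
  have "Z ^ depth p \<le> Z ^ max (depth p) (depth q)" "Z ^ depth q \<le> Z ^ max (depth p) (depth q)"
    using LSeq.prems(4) by (intro power_increasing; simp)+
  then have "cost p * Z ^ depth p + cost q * Z ^ depth q \<le> (cost p + cost q) * Z ^ max (depth p) (depth q)"
    unfolding distrib_right by (intro add_mono mult_le_mono2)
  then show ?case using t u exec.Seq[OF t(1) u(1)] by (auto intro!: exI[of _ "t + u"])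
next
  case (LIf e p q)
  have mono: "Z ^ depth p \<le> Z ^ max (depth p) (depth q)" "Z ^ depth q \<le> Z ^ max (depth p) (depth q)"
    and one: "1 \<le> Z ^ max (depth p) (depth q)"
    using LIf.prems(4) by (intro power_increasing one_le_power; simp)+
  let ?Z = "Z ^ max (depth p) (depth q)"
  have sum: "1 + cost_expr e + t \<le> (1 + cost_expr e + cost p + cost q) * ?Z"
    if "t \<le> cost p * ?Z \<or> t \<le> cost q * ?Z" for t
  proof -
    have "1 + cost_expr e \<le> (1 + cost_expr e) * ?Z" using mult_le_mono2[OF one, of "1 + cost_expr e"] by simp
    then show ?thesis using that by (auto simp: distrib_right)
  qed
  show ?case
  proof (cases "eval_expr e s = 0")
    case False
    have "\<exists>t. exec (compile p) s t (sem p s) \<and> t \<le> cost p * Z ^ depth p"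
      using LIf.prems by (intro LIf.IH(1)) auto
    then obtain t where t: "exec (compile p) s t (sem p s)" "t \<le> cost p * Z ^ depth p" by blast
    have "t \<le> cost p * ?Z" using t(2) mono(1) by (meson le_trans mult_le_mono2)
    then show ?thesis using exec.CondTrue[OF False t(1), of "compile q"] sum False by auto
  next
    case True
    have "\<exists>t. exec (compile q) s t (sem q s) \<and> t \<le> cost q * Z ^ depth q"
      using LIf.prems by (intro LIf.IH(2)) auto
    then obtain t where t: "exec (compile q) s t (sem q s)" "t \<le> cost q * Z ^ depth q" by blast
    have "t \<le> cost q * ?Z" using t(2) mono(2) by (meson le_trans mult_le_mono2)
    then show ?thesis using exec.CondFalse[OF True t(1), of "compile p"] sum True by auto
  qed
next
  case (LFor i b p)
  define N where "N = s b 0"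
  define f where "f = rec_nat (upd s i 0 0) (\<lambda>j s'. upd (sem p s') i 0 (Suc j))"
  define W where "W = While (Monus (rd b) (rd i))
       (Seq (compile p) (Store i (Const 0) (Plus (rd i) (Const 1))))"
  define c where "c = cost p * Z ^ depth p + 12"
  have fi: "f j i 0 = j" for j by (cases j) (auto simp: f_def)
  have ff: "f j a = s a" if "a \<notin> writes (LFor i b p)" for j a
    by (induction j) (use that sem_frame[of a p] in \<open>auto simp: f_def\<close>)
  have fb: "f j b 0 = N" for j using ff[of b j] LFor.prems by (auto simp: N_def)
  \<comment> \<open>\<open>f j\<close> is the memory after \<open>j\<close> rounds. The induction is
    on the number \<open>d\<close> of rounds still to come, since the while rule unfolds a loop from
    the front.\<close>
  have run: "\<exists>t. exec W (f (N - d)) t (f N) \<and> t \<le> 6 + d * c" if "d \<le> N" for d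
    using that
  proof (induction d)
    case 0
    have "eval_expr (Monus (rd b) (rd i)) (f N) = 0" by (simp add: fi fb)
    then show ?case
      using exec.WhileFalse[of "Monus (rd b) (rd i)" "f N"] unfolding W_def
      by (intro exI[of _ 6]) (simp add: eval_nat_numeral)
  next
    case (Suc d)
    then obtain u where u: "exec W (f (N - d)) u (f N)" "u \<le> 6 + d * c" by auto
    let ?j = "N - Suc d"
    have j: "N - d = Suc ?j" using Suc.prems by simp
    have ne: "eval_expr (Monus (rd b) (rd i)) (f ?j) \<noteq> 0" using Suc.prems by (simp add: fi fb)
    have "\<exists>t. exec (compile p) (f ?j) t (sem p (f ?j)) \<and> t \<le> cost p * Z ^ depth p"
    proof (rule LFor.IH)
      fix a assume a: "a \<in> bnds p"
      then have "f ?j a = s a" using LFor.prems(2) by (intro ff) auto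
      then show "f ?j a 0 \<le> Z" using a LFor.prems(3) by auto
    qed (use LFor.prems in auto)
    then obtain t where t: "exec (compile p) (f ?j) t (sem p (f ?j))" "t \<le> cost p * Z ^ depth p" by blast
    have pi: "sem p (f ?j) i 0 = ?j" using sem_frame[of i p "f ?j"] LFor.prems fi by auto
    have "f (N - d) = upd (sem p (f ?j)) i 0 (Suc ?j)" unfolding j by (simp add: f_def)
    then have st: "exec (Store i (Const 0) (Plus (rd i) (Const 1))) (sem p (f ?j)) 6 (f (N - d))"
      using exec_Store[of i "Const 0" "Plus (rd i) (Const 1)" "sem p (f ?j)"] pi
      by (simp add: eval_nat_numeral)
    have "exec W (f ?j) (1 + cost_expr (Monus (rd b) (rd i)) + (t + 6) + u) (f N)"
      unfolding W_def
      by (rule exec.WhileTrue[OF ne exec.Seq[OF t(1) st]]) (use u in \<open>simp add: W_def\<close>)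
    moreover have "1 + cost_expr (Monus (rd b) (rd i)) + (t + 6) + u \<le> 6 + Suc d * c"
      using t u by (simp add: c_def)
    ultimately show ?case by blast
  qed
  obtain t where t: "exec W (f 0) t (f N)" "t \<le> 6 + N * c" using run[of N] by auto
  have "exec (Store i (Const 0) (Const 0)) s 3 (f 0)"
    using exec_Store[of i "Const 0" "Const 0" s] by (simp add: f_def eval_nat_numeral)
  then have "exec (compile (LFor i b p)) s (3 + t) (f N)"
    using exec.Seq t(1) unfolding W_def by simp
  moreover have "f N = sem (LFor i b p) s" by (simp add: f_def N_def)
  moreover have "3 + t \<le> cost (LFor i b p) * Z ^ depth (LFor i b p)"
  proof -
    have NZ: "N \<le> Z" using LFor.prems(3) by (simp add: N_def)
    have one: "1 \<le> Z ^ Suc (depth p)" "Z \<le> Z ^ Suc (depth p)"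
      using LFor.prems(4) one_le_power[of Z "Suc (depth p)"] one_le_power[of Z "depth p"] by auto
    have "N * c \<le> Z * c" using NZ by simp
    also have "\<dots> = cost p * Z ^ Suc (depth p) + 12 * Z" by (simp add: c_def algebra_simps)
    also have "\<dots> \<le> cost p * Z ^ Suc (depth p) + 12 * Z ^ Suc (depth p)" using one by simp
    finally have "3 + t \<le> 9 + (cost p + 12) * Z ^ Suc (depth p)" using t(2) by (simp add: algebra_simps)
    also have "\<dots> \<le> (cost p + 21) * Z ^ Suc (depth p)" using one(1) by (simp add: algebra_simps)
    finally show ?thesis by simp
  qed
  ultimately show ?case by (intro exI[of _ "3 + t"]) simp
qed

section \<open>Reachability\<close>

text \<open>Tests evaluate to 0 or 1. With truncated subtraction the sum of the two differences is
  the distance of the arguments, and subtracting it from 1 tests whether it is 0.\<close>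

definition eqE :: "expr \<Rightarrow> expr \<Rightarrow> expr" where
  "eqE a b = Monus (Const 1) (Plus (Monus a b) (Monus b a))"

definition notE :: "expr \<Rightarrow> expr" where
  "notE a = Monus (Const 1) a"

definition andE :: "expr \<Rightarrow> expr \<Rightarrow> expr" where
  "andE a b = Monus (Const 1) (Plus (notE a) (notE b))"

definition leE :: "expr \<Rightarrow> expr \<Rightarrow> expr" where
  "leE a b = notE (Monus a b)"

lemma eval_eqE [simp]: "eval_expr (eqE a b) s = (if eval_expr a s = eval_expr b s then 1 else 0)"
  by (auto simp: eqE_def)

lemma eval_notE [simp]: "eval_expr (notE a) s = (if eval_expr a s = 0 then 1 else 0)"
  by (auto simp: notE_def)

lemma eval_andE [simp]:
  "eval_expr (andE a b) s = (if eval_expr a s \<noteq> 0 \<and> eval_expr b s \<noteq> 0 then 1 else 0)"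
  by (auto simp: andE_def)

lemma eval_leE [simp]: "eval_expr (leE a b) s = (if eval_expr a s \<le> eval_expr b s then 1 else 0)"
  by (auto simp: leE_def)

abbreviation (input) LWhen :: "expr \<Rightarrow> lp \<Rightarrow> lp" where
  "LWhen e p \<equiv> LIf e p LSkip"

abbreviation (input) assign :: "nat \<Rightarrow> expr \<Rightarrow> lp" where
  "assign b e \<equiv> LStore b (Const 0) e"

text \<open>Memory banks; scalar variables live at address 0. Banks from 40 on are loop counters.\<close>

abbreviation (input) bIn :: nat where "bIn \<equiv> 0"
abbreviation (input) bOut :: nat where "bOut \<equiv> 1"
abbreviation (input) bK :: nat where "bK \<equiv> 2"
abbreviation (input) bn :: nat where "bn \<equiv> 3"
abbreviation (input) br :: nat where "br \<equiv> 4"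
abbreviation (input) bN :: nat where "bN \<equiv> 5"
abbreviation (input) bM :: nat where "bM \<equiv> 6"
abbreviation (input) bB :: nat where "bB \<equiv> 7"
abbreviation (input) bm :: nat where "bm \<equiv> 8"
abbreviation (input) bR2 :: nat where "bR2 \<equiv> 9"
abbreviation (input) bTWO :: nat where "bTWO \<equiv> 10"
abbreviation (input) bEU :: nat where "bEU \<equiv> 11"
abbreviation (input) bEV :: nat where "bEV \<equiv> 12"
abbreviation (input) bEI :: nat where "bEI \<equiv> 13"
abbreviation (input) bX :: nat where "bX \<equiv> 14"
abbreviation (input) bL :: nat where "bL \<equiv> 15"
abbreviation (input) bY :: nat where "bY \<equiv> 16"
abbreviation (input) bST :: nat where "bST \<equiv> 17"
abbreviation (input) bFX :: nat where "bFX \<equiv> 18"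
abbreviation (input) bXS :: nat where "bXS \<equiv> 19"
abbreviation (input) bRE :: nat where "bRE \<equiv> 20"
abbreviation (input) bW :: nat where "bW \<equiv> 21"
abbreviation (input) bCNT :: nat where "bCNT \<equiv> 22"
abbreviation (input) bLB :: nat where "bLB \<equiv> 23"
abbreviation (input) bPAR :: nat where "bPAR \<equiv> 24"
abbreviation (input) bSRC :: nat where "bSRC \<equiv> 25"
abbreviation (input) bTAU :: nat where "bTAU \<equiv> 26"
abbreviation (input) bC :: nat where "bC \<equiv> 27"
abbreviation (input) bQ :: nat where "bQ \<equiv> 28"
abbreviation (input) bSE :: nat where "bSE \<equiv> 29"
abbreviation (input) bTI :: nat where "bTI \<equiv> 30"
abbreviation (input) bFOUND :: nat where "bFOUND \<equiv> 31"
abbreviation (input) bCUR :: nat where "bCUR \<equiv> 32"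
abbreviation (input) bCI :: nat where "bCI \<equiv> 33"
abbreviation (input) bOLD :: nat where "bOLD \<equiv> 34"
abbreviation (input) bOK :: nat where "bOK \<equiv> 35"
abbreviation (input) bDONE :: nat where "bDONE \<equiv> 36"
abbreviation (input) bCT :: nat where "bCT \<equiv> 37"
abbreviation (input) bQP :: nat where "bQP \<equiv> 38"
abbreviation (input) bQS :: nat where "bQS \<equiv> 39"

definition REACH_EDGE :: lp where
  "REACH_EDGE = LWhen (Cell bXS (rd 41)) (
      LWhen (Cell bRE (Cell bEU (rd 41))) (LStore bRE (Cell bEV (rd 41)) (Const 1)) ;;
      LWhen (Cell bRE (Cell bEV (rd 41))) (LStore bRE (Cell bEU (rd 41)) (Const 1)))"

definition REACH :: lp where
  "REACH = LFor 40 bn (LStore bRE (rd 40) (Const 0)) ;;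
    LStore bRE (rd bSRC) (Const 1) ;;
    LFor 40 bR2 (LFor 41 bm REACH_EDGE)"

definition SELECT :: lp where
  "SELECT = LFor 42 bm (LStore bXS (rd 42) (eqE (Cell bST (rd 42)) (rd bTI)))"

lemma writes_REACH [simp]: "writes REACH = {bRE, 40, 41}"
  unfolding REACH_def REACH_EDGE_def writes.simps by blast

lemma writes_REACH_EDGE [simp]: "writes REACH_EDGE = {bRE}"
  unfolding REACH_EDGE_def writes.simps by blast

lemma writes_SELECT [simp]: "writes SELECT = {bXS, 42}"
  unfolding SELECT_def writes.simps by blast

locale instance_params =
  fixes k n m r N M B :: nat and EU EV EI :: "nat \<Rightarrow> nat"
  assumes root: "r < n"
    and EU_less: "\<And>e. e < m \<Longrightarrow> EU e < n"
    and EV_less: "\<And>e. e < m \<Longrightarrow> EV e < n"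
    and EU_EV: "\<And>e. e < m \<Longrightarrow> EU e \<noteq> EV e"
    and parallel: "\<And>a b. card {e. e < m \<and> {EU e, EV e} = {a, b}} \<le> 2"
begin

sublocale rooted_multigraph "\<lambda>e. {EU e, EV e}" "{..<n}" r "{..<m}"
proof
  show "card {e \<in> {..<m}. {EU e, EV e} = {a, b}} \<le> 2" for a b
    using parallel[of a b] by simp
  show "\<exists>a b. a \<noteq> b \<and> a \<in> {..<n} \<and> b \<in> {..<n} \<and> {EU e, EV e} = {a, b}" if "e \<in> {..<m}" for e
    using that EU_less EV_less EU_EV by (intro exI[of _ "EU e"] exI[of _ "EV e"]) auto
qed (use root in auto)

text \<open>Banks 2 to 13 hold the instance and the parameters. The search never writes them, so
  \<open>ctx\<close> survives every procedure through \<open>ctx_cong\<close>.\<close>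

definition ctx :: "memory \<Rightarrow> bool" where
  "ctx s \<longleftrightarrow> s bK 0 = k \<and> s bn 0 = n \<and> s br 0 = r \<and> s bN 0 = N \<and> s bM 0 = M \<and> s bB 0 = B \<and>
     s bm 0 = m \<and> s bR2 0 = m + m \<and> s bTWO 0 = 2 \<and> s bEU = EU \<and> s bEV = EV \<and> s bEI = EI"

lemma ctx_cong: "ctx s \<Longrightarrow> (\<And>b. b \<in> {2..13} \<Longrightarrow> t b = s b) \<Longrightarrow> ctx t"
  by (simp add: ctx_def)

lemma ctx_sem: "ctx s \<Longrightarrow> writes p \<inter> {2..13} = {} \<Longrightarrow> ctx (sem p s)"
  by (erule ctx_cong, rule sem_frame) blast

lemma ctx_upd [simp]: "13 < b \<Longrightarrow> ctx (upd s b a x) \<longleftrightarrow> ctx s"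
  by (simp add: ctx_def)

definition selected :: "memory \<Rightarrow> nat set" where
  "selected s = {e. e < m \<and> s bXS e \<noteq> 0}"

definition tr :: "(nat \<Rightarrow> nat) \<Rightarrow> nat \<Rightarrow> nat set" where
  "tr ST i = {e. e < m \<and> ST e = i}"

lemma card_adj_selected: "finite (adj (selected s))" "card (adj (selected s)) \<le> m + m"
proof -
  let ?A = "(\<lambda>e. (EU e, EV e)) ` {..<m}" and ?B = "(\<lambda>e. (EV e, EU e)) ` {..<m}"
  have sub: "adj (selected s) \<subseteq> ?A \<union> ?B"
    by (auto simp: adj_def selected_def doubleton_eq_iff image_iff)
  then show "finite (adj (selected s))" by (rule finite_subset) simp
  have "card (adj (selected s)) \<le> card (?A \<union> ?B)" by (rule card_mono[OF _ sub]) simp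
  also have "\<dots> \<le> card ?A + card ?B" by (rule card_Un_le)
  also have "\<dots> \<le> m + m" by (intro add_mono) (use card_image_le[of "{..<m}"] in auto)
  finally show "card (adj (selected s)) \<le> m + m" .
qed

text \<open>Marks are sound throughout, and after \<open>j\<close> rounds every vertex at most
  \<open>j\<close> steps away is marked. As \<open>m\<close> edges give at most \<open>m + m\<close>
  ordered adjacent pairs, that many rounds suffice; this explains the content of
  \<open>bR2\<close>.\<close>

lemma REACH_correct:
  assumes c: "ctx s" and src: "s bSRC 0 < n" and v: "v < n"
  shows "sem REACH s bRE v \<noteq> 0 \<longleftrightarrow> conn (selected s) (s bSRC 0) v"
proof -
  let ?a = "s bSRC 0" and ?X = "selected s"
  define s1 where "s1 = sem (LFor 40 bn (LStore bRE (rd 40) (Const 0))) s"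
  define s2 where "s2 = upd s1 bRE ?a 1"
  have fr1: "s1 b = s b" if "b \<notin> {bRE, 40}" for b
    unfolding s1_def by (rule sem_frame) (use that in auto)
  have "\<forall>w < s bn 0. s1 bRE w = 0"
    unfolding s1_def
    by (rule sem_For_inv[where P = "\<lambda>j t. \<forall>w<j. t bRE w = 0"]) (auto simp: less_Suc_eq)
  then have z: "s1 bRE w = 0" if "w < n" for w using that c by (simp add: ctx_def)
  have fr2: "s2 b = s b" if "b \<notin> {bRE, 40}" for b
    using fr1[OF that] that by (simp add: s2_def)
  have c2: "ctx s2" using c by (rule ctx_cong) (auto intro!: fr2)
  have R: "sem REACH s = sem (LFor 40 bR2 (LFor 41 bm REACH_EDGE)) s2"
    using fr1[of bSRC] by (simp add: REACH_def s1_def s2_def del: sem.simps(5))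
  define Snd where "Snd t \<longleftrightarrow> (\<forall>w<n. t bRE w \<noteq> 0 \<longrightarrow> conn ?X ?a w)" for t :: memory
  define Cmp where "Cmp j t \<longleftrightarrow> (\<forall>i\<le>j. \<forall>w<n. (?a, w) \<in> adj ?X ^^ i \<longrightarrow> t bRE w \<noteq> 0)" for j and t :: memory
  have "Snd (sem (LFor 40 bR2 (LFor 41 bm REACH_EDGE)) s2) \<and>
    Cmp (s2 bR2 0) (sem (LFor 40 bR2 (LFor 41 bm REACH_EDGE)) s2)"
  proof (rule sem_For_inv[where P = "\<lambda>j t. Snd t \<and> Cmp j t"])
    show "Snd (upd s2 40 0 0) \<and> Cmp 0 (upd s2 40 0 0)"
      using z src by (auto simp: Snd_def Cmp_def s2_def)
  next
    fix j t
    assume j: "Snd t \<and> Cmp j t"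
      and fr: "\<And>b. b \<notin> insert 40 (writes (LFor 41 bm REACH_EDGE)) \<Longrightarrow> t b = s2 b"
    have ct: "ctx t" using c2 by (rule ctx_cong) (auto intro!: fr)
    have XS: "t bXS = s bXS" using fr[of bXS] fr2[of bXS] by simp
    let ?t = "sem (LFor 41 bm REACH_EDGE) t"
    let ?P = "\<lambda>e u. Snd u \<and> (\<forall>w<n. t bRE w \<noteq> 0 \<longrightarrow> u bRE w \<noteq> 0) \<and>
        (\<forall>f<e. f \<in> ?X \<longrightarrow> (t bRE (EU f) \<noteq> 0 \<longrightarrow> u bRE (EV f) \<noteq> 0) \<and> (t bRE (EV f) \<noteq> 0 \<longrightarrow> u bRE (EU f) \<noteq> 0))"
    have "?P (t bm 0) ?t"
    proof (rule sem_For_inv[where P = ?P])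
      show "?P 0 (upd t 41 0 0)" using j by (simp add: Snd_def)
    next
      fix e u
      assume e: "e < t bm 0" and u: "?P e u" "u 41 0 = e"
        and fru: "\<And>b. b \<notin> insert 41 (writes REACH_EDGE) \<Longrightarrow> u b = t b"
      have em: "e < m" using e ct by (simp add: ctx_def)
      have cu: "ctx u" using ct by (rule ctx_cong) (auto intro!: fru)
      have XSu: "u bXS = s bXS" using fru[of bXS] XS by simp
      let ?u = "sem REACH_EDGE u"
      have EX: "e \<in> ?X \<longleftrightarrow> u bXS e \<noteq> 0" using em XSu by (simp add: selected_def)
      have EUV: "u bEU = EU" "u bEV = EV" using cu by (auto simp: ctx_def)
      have RE: "?u bRE = (if e \<notin> ?X then u bRE else if u bRE (EU e) \<noteq> 0 then (u bRE)(EV e := 1, EU e := 1)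
          else if u bRE (EV e) \<noteq> 0 then (u bRE)(EU e := 1) else u bRE)"
        unfolding EX REACH_EDGE_def using u(2) EUV by simp
      have le: "u bRE w \<noteq> 0 \<Longrightarrow> ?u bRE w \<noteq> 0" for w unfolding RE by auto
      have con: "e \<in> ?X \<Longrightarrow> conn ?X (EU e) (EV e)" using conn_edge[of e ?X "EU e" "EV e"] by simp
      have lt: "EU e < n" "EV e < n" using em EU_less EV_less by auto
      have "Snd ?u"
        unfolding Snd_def
      proof (intro allI impI)
        fix w assume w: "w < n" "?u bRE w \<noteq> 0"
        have S: "\<And>w. w < n \<Longrightarrow> u bRE w \<noteq> 0 \<Longrightarrow> conn ?X ?a w" using u by (simp add: Snd_def)
        show "conn ?X ?a w"
        proof (cases "u bRE w \<noteq> 0")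
          case True
          then show ?thesis using S w by simp
        next
          case False
          then have or: "e \<in> ?X \<and> (w = EV e \<and> u bRE (EU e) \<noteq> 0 \<or> w = EU e \<and> u bRE (EV e) \<noteq> 0)"
            using w(2) unfolding RE by (auto split: if_splits)
          then have ce: "conn ?X (EU e) (EV e)" "conn ?X (EV e) (EU e)" using con conn_sym by auto
          from or consider "w = EV e" "u bRE (EU e) \<noteq> 0" | "w = EU e" "u bRE (EV e) \<noteq> 0" by auto
          then show ?thesis
            by cases (use S lt ce in \<open>auto intro: conn_trans\<close>)
        qed
      qed
      moreover have "\<forall>w<n. t bRE w \<noteq> 0 \<longrightarrow> ?u bRE w \<noteq> 0" using u le by blast
      moreover have "(t bRE (EU f) \<noteq> 0 \<longrightarrow> ?u bRE (EV f) \<noteq> 0) \<and> (t bRE (EV f) \<noteq> 0 \<longrightarrow> ?u bRE (EU f) \<noteq> 0)"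
        if f: "f < Suc e" "f \<in> ?X" for f
      proof (cases "f = e")
        case True
        have "t bRE (EU e) \<noteq> 0 \<Longrightarrow> u bRE (EU e) \<noteq> 0" "t bRE (EV e) \<noteq> 0 \<Longrightarrow> u bRE (EV e) \<noteq> 0"
          using u lt by auto
        then show ?thesis using True f unfolding RE by auto
      next
        case False
        then have "f < e" using f by simp
        then show ?thesis using u f le by blast
      qed
      ultimately show "?P (Suc e) (upd ?u 41 0 (Suc e))" by (simp add: Snd_def)
    qed
    then have P: "?P m ?t" using ct by (simp add: ctx_def)
    have "Cmp (Suc j) ?t"
      unfolding Cmp_def
    proof (intro allI impI)
      fix i w assume i: "i \<le> Suc j" "w < n" "(?a, w) \<in> adj ?X ^^ i"
      show "?t bRE w \<noteq> 0"
      proof (cases "i \<le> j")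
        case True
        then have "t bRE w \<noteq> 0" using j i by (simp add: Cmp_def)
        then show ?thesis using P i by blast
      next
        case False
        then have "i = Suc j" using i by simp
        then obtain u where u: "(?a, u) \<in> adj ?X ^^ j" "(u, w) \<in> adj ?X" using i by auto
        then obtain f where f: "f \<in> ?X" "{EU f, EV f} = {u, w}" by (auto simp: adj_def)
        then have fm: "f < m" by (simp add: selected_def)
        then have "u < n" using f EU_less EV_less by (auto simp: doubleton_eq_iff)
        then have "t bRE u \<noteq> 0" using j u(1) unfolding Cmp_def by blast
        then show ?thesis using P f fm by (auto simp: doubleton_eq_iff)
      qed
    qed
    then show "Snd (upd ?t 40 0 (Suc j)) \<and> Cmp (Suc j) (upd ?t 40 0 (Suc j))"
      using P by (simp add: Snd_def Cmp_def)
  qed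
  then have fin: "Snd (sem REACH s)" "Cmp (m + m) (sem REACH s)"
    using c2 R by (auto simp: ctx_def)
  show ?thesis
  proof
    assume "sem REACH s bRE v \<noteq> 0"
    then show "conn ?X ?a v" using fin v by (simp add: Snd_def)
  next
    assume "conn ?X ?a v"
    then obtain i where "i \<le> card (adj ?X)" "(?a, v) \<in> adj ?X ^^ i"
      unfolding conn_def using rtrancl_finite_eq_relpow[OF card_adj_selected(1), of s] by blast
    moreover from this card_adj_selected(2)[of s] have "i \<le> m + m" by simp
    ultimately show "sem REACH s bRE v \<noteq> 0" using fin(2) v unfolding Cmp_def by blast
  qed
qed

lemma SELECT_correct:
  assumes c: "ctx s"
  shows "selected (sem SELECT s) = tr (s bST) (s bTI 0)"
proof -
  have "\<forall>e<s bm 0. sem SELECT s bXS e = (if s bST e = s bTI 0 then 1 else 0)"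
    unfolding SELECT_def
  proof (rule sem_For_inv[where P = "\<lambda>j t. \<forall>e<j. t bXS e = (if s bST e = s bTI 0 then 1 else 0)"], goal_cases)
    case (2 j t)
    then show ?case using 2(4)[of bST] 2(4)[of bTI] by (auto simp: less_Suc_eq)
  qed simp
  then show ?thesis using c by (auto simp: selected_def tr_def ctx_def split: if_splits)
qed

section \<open>Matroid union: the exchange graph\<close>

text \<open>\<open>ST e\<close> is the index (1 or 2) of the forest containing \<open>e\<close>, or 0 if \<open>e\<close> is uncovered; likewise
  \<open>FX e\<close> for the edges that are forced into a forest.\<close>

definition valid :: "(nat \<Rightarrow> nat) \<Rightarrow> (nat \<Rightarrow> nat) \<Rightarrow> bool" where
  "valid ST FX \<longleftrightarrow> (\<forall>e<m. ST e \<le> 2 \<and> (FX e \<noteq> 0 \<longrightarrow> ST e = FX e)) \<and>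
     forest (tr ST 1) \<and> forest (tr ST 2)"

text \<open>An arc of the exchange graph: \<open>f\<close> lies on the cycle that \<open>e\<close>
  closes in forest \<open>i\<close> and may leave in its favour. Excluding forced edges by
  \<open>FX f = 0\<close> has the effect of contracting them.\<close>

definition cyc :: "(nat \<Rightarrow> nat) \<Rightarrow> (nat \<Rightarrow> nat) \<Rightarrow> nat \<Rightarrow> nat \<Rightarrow> nat \<Rightarrow> bool" where
  "cyc ST FX e f i \<longleftrightarrow> f < m \<and> ST f = i \<and> FX f = 0 \<and> conn (tr ST i) (EU e) (EV e) \<and>
     \<not> conn (tr ST i - {f}) (EU e) (EV e)"

text \<open>A partial breadth-first search in the exchange graph: \<open>LB e = 0\<close> means unreached, otherwise
  \<open>LB e - 1\<close> is the distance from the uncovered edges; \<open>D e (LB e) i\<close> says that \<open>e\<close> has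
  been expanded with respect to tree \<open>i\<close>.\<close>

definition bfs :: "(nat \<Rightarrow> nat) \<Rightarrow> (nat \<Rightarrow> nat) \<Rightarrow> (nat \<Rightarrow> nat) \<Rightarrow> (nat \<Rightarrow> nat) \<Rightarrow> nat \<Rightarrow>
    (nat \<Rightarrow> nat \<Rightarrow> nat \<Rightarrow> bool) \<Rightarrow> bool" where
  "bfs ST FX LB PAR l D \<longleftrightarrow>
     (\<forall>e<m. LB e = 1 \<longleftrightarrow> ST e = 0) \<and>
     (\<forall>f<m. 2 \<le> LB f \<longrightarrow> PAR f < m \<and> Suc (LB (PAR f)) = LB f \<and> ST f \<in> {1, 2} \<and>
        ST f \<noteq> ST (PAR f) \<and> cyc ST FX (PAR f) f (ST f)) \<and>
     (\<forall>e<m. LB e \<le> l) \<and>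
     (\<forall>e<m. \<forall>i\<in>{1, 2}. 1 \<le> LB e \<longrightarrow> i \<noteq> ST e \<longrightarrow> D e (LB e) i \<longrightarrow>
        conn (tr ST i) (EU e) (EV e) \<and> (\<forall>f. cyc ST FX e f i \<longrightarrow> 1 \<le> LB f \<and> LB f \<le> Suc (LB e)))"

lemma finite_tr [simp]: "finite (tr ST i)"
  by (simp add: tr_def)

lemma bfs_weaken:
  assumes "bfs ST FX LB PAR l D" "l \<le> l'"
    and "\<And>e i. e < m \<Longrightarrow> i = 1 \<or> i = 2 \<Longrightarrow> i \<noteq> ST e \<Longrightarrow> D' e (LB e) i \<Longrightarrow> D e (LB e) i"
  shows "bfs ST FX LB PAR l' D'"
  unfolding bfs_def
proof (intro conjI)
  show "\<forall>e<m. LB e = 1 \<longleftrightarrow> ST e = 0"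
    "\<forall>f<m. 2 \<le> LB f \<longrightarrow> PAR f < m \<and> Suc (LB (PAR f)) = LB f \<and> ST f \<in> {1, 2} \<and>
        ST f \<noteq> ST (PAR f) \<and> cyc ST FX (PAR f) f (ST f)"
    using assms(1) unfolding bfs_def by blast+
  show "\<forall>e<m. LB e \<le> l'" using assms(1,2) unfolding bfs_def by (meson le_trans)
  show "\<forall>e<m. \<forall>i\<in>{1, 2}. 1 \<le> LB e \<longrightarrow> i \<noteq> ST e \<longrightarrow> D' e (LB e) i \<longrightarrow>
        conn (tr ST i) (EU e) (EV e) \<and> (\<forall>f. cyc ST FX e f i \<longrightarrow> 1 \<le> LB f \<and> LB f \<le> Suc (LB e))"
    using assms(1,3) unfolding bfs_def by blast
qed

lemma bfs_label:
  assumes b: "bfs ST FX LB PAR l D" and e: "e < m" "1 \<le> LB e" "Suc (LB e) \<le> l"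
    and f: "f < m" "LB f = 0" "ST f \<in> {1, 2}" "ST f \<noteq> ST e" "cyc ST FX e f (ST f)"
    and D: "\<And>i. \<not> D f (Suc (LB e)) i"
  shows "bfs ST FX (LB(f := Suc (LB e))) (PAR(f := e)) l D"
proof -
  let ?L = "LB(f := Suc (LB e))" and ?P = "PAR(f := e)"
  have b1: "\<And>e. e < m \<Longrightarrow> LB e = 1 \<longleftrightarrow> ST e = 0"
    and b2: "\<And>f. f < m \<Longrightarrow> 2 \<le> LB f \<Longrightarrow> PAR f < m \<and> Suc (LB (PAR f)) = LB f \<and> ST f \<in> {1, 2} \<and>
        ST f \<noteq> ST (PAR f) \<and> cyc ST FX (PAR f) f (ST f)"
    and b3: "\<And>e. e < m \<Longrightarrow> LB e \<le> l"
    and b4: "\<And>e i. e < m \<Longrightarrow> i \<in> {1, 2} \<Longrightarrow> 1 \<le> LB e \<Longrightarrow> i \<noteq> ST e \<Longrightarrow> D e (LB e) i \<Longrightarrow>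
        conn (tr ST i) (EU e) (EV e) \<and> (\<forall>f. cyc ST FX e f i \<longrightarrow> 1 \<le> LB f \<and> LB f \<le> Suc (LB e))"
    using b unfolding bfs_def by blast+
  have ef: "e \<noteq> f" using e f by auto
  show ?thesis
    unfolding bfs_def
  proof (intro conjI allI impI ballI)
    fix g assume g: "g < m"
    show "?L g = 1 \<longleftrightarrow> ST g = 0" using b1[OF g] f e by auto
    show "?L g \<le> l" using b3[OF g] e by auto
  next
    fix g assume g: "g < m" "2 \<le> ?L g"
    have "?P g < m \<and> Suc (?L (?P g)) = ?L g \<and> ST g \<in> {1, 2} \<and> ST g \<noteq> ST (?P g) \<and> cyc ST FX (?P g) g (ST g)"
    proof (cases "g = f")
      case True
      then show ?thesis using e f ef by auto
    next
      case False
      then have g2: "2 \<le> LB g" using g by simp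
      note b = b2[OF g(1) g2]
      then have "PAR g \<noteq> f" using g2 f by auto
      then show ?thesis using b False by simp
    qed
    then show "?P g < m" "Suc (?L (?P g)) = ?L g" "ST g \<in> {1, 2}" "ST g \<noteq> ST (?P g)"
      "cyc ST FX (?P g) g (ST g)" by blast+
  next
    fix g i assume g: "g < m" "i \<in> {1, 2}" "1 \<le> ?L g" "i \<noteq> ST g" "D g (?L g) i"
    have gf: "g \<noteq> f" using g(5) D by auto
    then have *: "conn (tr ST i) (EU g) (EV g)" "\<And>h. cyc ST FX g h i \<Longrightarrow> 1 \<le> LB h \<and> LB h \<le> Suc (LB g)"
      using b4[OF g(1,2) _ g(4)] g by auto
    then show "conn (tr ST i) (EU g) (EV g)" by simp
    fix h assume h: "cyc ST FX g h i"
    then have "h \<noteq> f" using *(2)[OF h] f by auto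
    then show "1 \<le> ?L h" "?L h \<le> Suc (?L g)" using *(2)[OF h] gf by auto
  qed
qed

lemma bfs_levels:
  assumes "bfs ST FX LB PAR l D" "f < m" "1 \<le> j" "j \<le> LB f"
  shows "\<exists>e<m. LB e = j"
  using assms(2,4)
proof (induction "LB f" arbitrary: f)
  case 0
  then show ?case using assms(3) by simp
next
  case (Suc x)
  show ?case
  proof (cases "j = LB f")
    case True
    then show ?thesis using Suc by blast
  next
    case False
    then have "2 \<le> LB f" using Suc.prems assms(3) by simp
    then have "PAR f < m" "Suc (LB (PAR f)) = LB f" using assms(1) Suc.prems unfolding bfs_def by blast+
    then show ?thesis using Suc.hyps(1)[of "PAR f"] Suc.hyps(2) Suc.prems False by simp
  qed
qed

text \<open>Following parents, no level is skipped, so all labels from 1 to \<open>LB f\<close>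
  occur among \<open>m\<close> edges. Hence \<open>m\<close> levels exhaust the search.\<close>

lemma bfs_label_le:
  assumes "bfs ST FX LB PAR l D" "f < m"
  shows "LB f \<le> m"
proof -
  have "{1..LB f} \<subseteq> LB ` {..<m}"
    using bfs_levels[OF assms] by (fastforce simp: image_iff)
  then have "card {1..LB f} \<le> card (LB ` {..<m})" by (intro card_mono) auto
  also have "\<dots> \<le> m" using card_image_le[of "{..<m}" LB] by simp
  finally show ?thesis by simp
qed

definition maxi :: "(nat \<Rightarrow> nat) \<Rightarrow> (nat \<Rightarrow> nat) \<Rightarrow> bool" where
  "maxi ST FX \<longleftrightarrow> (\<forall>S S'. S \<subseteq> {..<m} \<longrightarrow> S' \<subseteq> {..<m} \<longrightarrow> forest S \<longrightarrow> forest S' \<longrightarrow>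
     tr FX 1 \<subseteq> S \<longrightarrow> tr FX 2 \<subseteq> S' \<longrightarrow> S \<inter> S' = {} \<longrightarrow>
     card S + card S' \<le> card (tr ST 1) + card (tr ST 2))"

text \<open>Once everything labelled has been expanded without success, the labelled edges form a
  set closed under exchanges, which certifies optimality by \<open>closed_set_maximum\<close>. The
  condition \<open>x \<le> m\<close> covers every label by \<open>bfs_label_le\<close>.\<close>

lemma bfs_complete_maxi:
  assumes v: "valid ST FX" and b: "bfs ST FX LB PAR l (\<lambda>e x i. x \<le> m)"
  shows "maxi ST FX"
  unfolding maxi_def
proof (intro allI impI)
  fix S S'
  assume S: "S \<subseteq> {..<m}" "S' \<subseteq> {..<m}" "forest S" "forest S'" "tr FX 1 \<subseteq> S" "tr FX 2 \<subseteq> S'" "S \<inter> S' = {}"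
  have v1: "\<And>e. e < m \<Longrightarrow> ST e \<le> 2" "\<And>e. e < m \<Longrightarrow> FX e \<noteq> 0 \<Longrightarrow> ST e = FX e"
    and fo: "forest (tr ST 1)" "forest (tr ST 2)"
    using v unfolding valid_def by blast+
  have b1: "\<And>e. e < m \<Longrightarrow> LB e = 1 \<longleftrightarrow> ST e = 0"
    and b2: "\<And>f. f < m \<Longrightarrow> 2 \<le> LB f \<Longrightarrow> FX f = 0"
    using b unfolding bfs_def cyc_def by blast+
  have b4: "conn (tr ST i) (EU e) (EV e) \<and> (\<forall>f. cyc ST FX e f i \<longrightarrow> 1 \<le> LB f)"
    if "e < m" "i \<in> {1, 2}" "1 \<le> LB e" "i \<noteq> ST e" for e i
    using b that bfs_label_le[OF b that(1)] unfolding bfs_def by blast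
  let ?R = "{e. e < m \<and> 1 \<le> LB e}"
  have nFX: "FX e = 0" if "e \<in> ?R" for e
  proof (cases "LB e = 1")
    case True
    then have "ST e = 0" using b1 that by auto
    then show ?thesis using v1(2)[of e] that by fastforce
  next
    case False
    then show ?thesis using b2[of e] that by simp
  qed
  have cl: "conn (tr ST i) a c \<and> (\<forall>f\<in>tr ST i - tr FX i. \<not> conn (tr ST i - {f}) a c \<longrightarrow> f \<in> ?R)"
    if i: "i = 1 \<or> i = 2" and e: "e \<in> ?R" "e \<notin> tr ST i" "{EU e, EV e} = {a, c}" for i e a c
  proof -
    have e': "e < m" "i \<in> {1, 2}" "1 \<le> LB e" "i \<noteq> ST e" using i e by (auto simp: tr_def)
    note 1 = b4[OF e']
    have 2: "f \<in> ?R" if f: "f \<in> tr ST i - tr FX i" "\<not> conn (tr ST i - {f}) (EU e) (EV e)" for f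
    proof -
      have fm: "f < m" "ST f = i" "FX f \<noteq> i" using f(1) by (auto simp: tr_def)
      then have "FX f = 0" using v1(2)[of f] by auto
      then have "cyc ST FX e f i" using fm f 1 by (simp add: cyc_def)
      then show ?thesis using 1 fm by simp
    qed
    have "a = EU e \<and> c = EV e \<or> a = EV e \<and> c = EU e" using e(3) by (auto simp: doubleton_eq_iff)
    then show ?thesis
    proof
      assume "a = EU e \<and> c = EV e"
      then show ?thesis using 1 2 by simp
    next
      assume ac: "a = EV e \<and> c = EU e"
      have "conn (tr ST i - {f}) (EU e) (EV e) \<Longrightarrow> conn (tr ST i - {f}) a c" for f
        using ac conn_sym by simp
      moreover have "conn (tr ST i) a c" using 1 ac conn_sym by simp
      ultimately show ?thesis using 2 by blast
    qed
  qed
  have FXST: "tr FX i \<subseteq> tr ST i" if "i = 1 \<or> i = 2" for i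
    using v1(2) that by (fastforce simp: tr_def)
  show "card S + card S' \<le> card (tr ST 1) + card (tr ST 2)"
  proof (rule closed_set_maximum[where R = ?R, OF _ fo(1) _ _ fo(2) _ _ S(1) S(3) S(5) S(2) S(4) S(6) S(7)])
    show "tr ST 1 \<subseteq> {..<m}" "tr ST 2 \<subseteq> {..<m}" "tr ST 1 \<inter> tr ST 2 = {}" "?R \<subseteq> {..<m}"
      by (auto simp: tr_def)
    show "tr FX 1 \<subseteq> tr ST 1" "tr FX 2 \<subseteq> tr ST 2" using FXST by auto
    show "?R \<inter> tr FX 1 = {}" "?R \<inter> tr FX 2 = {}" using nFX by (auto simp: tr_def)
    show "{..<m} - (tr ST 1 \<union> tr ST 2) \<subseteq> ?R"
    proof
      fix e assume "e \<in> {..<m} - (tr ST 1 \<union> tr ST 2)"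
      then have "e < m" "ST e \<noteq> 1" "ST e \<noteq> 2" by (auto simp: tr_def)
      then have "ST e = 0" using v1(1)[of e] by linarith
      then have "LB e = 1" using b1 \<open>e < m\<close> by simp
      then show "e \<in> ?R" using \<open>e < m\<close> by simp
    qed
    show "conn (tr ST 1) a c \<and> (\<forall>f\<in>tr ST 1 - tr FX 1. \<not> conn (tr ST 1 - {f}) a c \<longrightarrow> f \<in> ?R)"
      if "e \<in> ?R" "e \<notin> tr ST 1" "{EU e, EV e} = {a, c}" for e a c
      using cl[of 1, OF _ that] by blast
    show "conn (tr ST 2) a c \<and> (\<forall>f\<in>tr ST 2 - tr FX 2. \<not> conn (tr ST 2 - {f}) a c \<longrightarrow> f \<in> ?R)"
      if "e \<in> ?R" "e \<notin> tr ST 2" "{EU e, EV e} = {a, c}" for e a c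
      using cl[of 2, OF _ that] by blast
  qed
qed

text \<open>State while an augmenting path is traversed backwards: \<open>c\<close> is about to move into forest \<open>i\<close>.
  Only edges farther than \<open>c\<close> have been moved, so the shortest paths up to \<open>c\<close> are still intact.\<close>

definition walk :: "(nat \<Rightarrow> nat) \<Rightarrow> (nat \<Rightarrow> nat) \<Rightarrow> (nat \<Rightarrow> nat) \<Rightarrow> (nat \<Rightarrow> nat) \<Rightarrow>
    (nat \<Rightarrow> nat) \<Rightarrow> nat \<Rightarrow> nat \<Rightarrow> bool" where
  "walk ST0 FX LB PAR ST c i \<longleftrightarrow> valid ST0 FX \<and> valid ST FX \<and> c < m \<and> (i = 1 \<or> i = 2) \<and> i \<noteq> ST c \<and>
     \<not> conn (tr ST i) (EU c) (EV c) \<and> 1 \<le> LB c \<and> bfs ST0 FX LB PAR (Suc m) (\<lambda>e x i. x < LB c) \<and>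
     (\<forall>e<m. LB e \<le> LB c \<longrightarrow> ST e = ST0 e) \<and>
     card (tr ST 1) + card (tr ST 2) = card (tr ST0 1) + card (tr ST0 2)"

lemma tr_upd:
  assumes "c < m" "ST c \<noteq> i"
  shows "tr (ST(c := i)) i = insert c (tr ST i)" "tr (ST(c := i)) (ST c) = tr ST (ST c) - {c}"
    "j \<noteq> i \<Longrightarrow> j \<noteq> ST c \<Longrightarrow> tr (ST(c := i)) j = tr ST j"
  using assms by (auto simp: tr_def)

text \<open>When \<open>c\<close> leaves the forest \<open>ST c\<close>, its parent has to enter it,
  so the ends of the parent must be separated there without \<open>c\<close>. They are, because the
  path between them in the initial forest is still intact: its forced edges never move, and its
  other edges were labelled at most one level above the parent, hence at most \<open>LB c\<close>.
  And \<open>c\<close> lies on this path.\<close>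

lemma walk_step:
  assumes w: "walk ST0 FX LB PAR ST c i"
  shows "ST c = 0 \<Longrightarrow> valid (ST(c := i)) FX \<and>
      card (tr (ST(c := i)) 1) + card (tr (ST(c := i)) 2) = Suc (card (tr ST0 1) + card (tr ST0 2))"
    and "ST c \<noteq> 0 \<Longrightarrow> walk ST0 FX LB PAR (ST(c := i)) (PAR c) (ST c) \<and> Suc (LB (PAR c)) = LB c"
proof -
  have v0: "valid ST0 FX" and v: "valid ST FX" and c: "c < m" and i: "i = 1 \<or> i = 2" "i \<noteq> ST c"
    and nc: "\<not> conn (tr ST i) (EU c) (EV c)" and L: "1 \<le> LB c"
    and b: "bfs ST0 FX LB PAR (Suc m) (\<lambda>e x i. x < LB c)"
    and same: "\<And>e. e < m \<Longrightarrow> LB e \<le> LB c \<Longrightarrow> ST e = ST0 e"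
    and cnt: "card (tr ST 1) + card (tr ST 2) = card (tr ST0 1) + card (tr ST0 2)"
    using w unfolding walk_def by blast+
  have v1: "\<And>e. e < m \<Longrightarrow> ST e \<le> 2" "\<And>e. e < m \<Longrightarrow> FX e \<noteq> 0 \<Longrightarrow> ST e = FX e"
    and fo: "forest (tr ST j)" if "j = 1 \<or> j = 2" for j
    using v that unfolding valid_def by blast+
  have v01: "\<And>e. e < m \<Longrightarrow> FX e \<noteq> 0 \<Longrightarrow> ST0 e = FX e" and fo0: "forest (tr ST0 j)" if "j = 1 \<or> j = 2" for j
    using v0 that unfolding valid_def by blast+
  let ?S = "ST(c := i)"
  have tri: "tr ?S i = insert c (tr ST i)" using tr_upd(1)[of c ST i] c i by auto
  have fi: "forest (tr ?S i)"
    unfolding tri by (rule forest_insert[OF fo[OF i(1)] _ nc]) simp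
  have cardi: "card (tr ?S i) = Suc (card (tr ST i))" unfolding tri using i by (simp add: tr_def)
  show "valid ?S FX \<and> card (tr ?S 1) + card (tr ?S 2) = Suc (card (tr ST0 1) + card (tr ST0 2))"
    if z: "ST c = 0"
  proof -
    have "FX c = 0" using v1(2)[OF _ c] z by fastforce
    have other: "tr ?S (3 - i) = tr ST (3 - i)" using i z by (auto simp: tr_def)
    have "forest (tr ?S (3 - i))" unfolding other using fo[of "3 - i"] i by auto
    then have "valid ?S FX"
      using fi i v1 \<open>FX c = 0\<close> unfolding valid_def by (auto simp: numeral_2_eq_2 numeral_3_eq_3)
    moreover have "card (tr ?S (3 - i)) = card (tr ST (3 - i))" unfolding other ..
    ultimately show ?thesis using cardi cnt i by (auto simp: numeral_2_eq_2 numeral_3_eq_3)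
  qed
  show "walk ST0 FX LB PAR ?S (PAR c) (ST c) \<and> Suc (LB (PAR c)) = LB c" if nz: "ST c \<noteq> 0"
  proof -
    let ?o = "ST c" and ?p = "PAR c"
    have o0: "ST0 c = ?o" using same[OF c] by simp
    have o12: "?o = 1 \<or> ?o = 2" using v1(1)[of 1, OF _ c] nz by auto
    have "LB c \<noteq> 1" using b c o0 nz unfolding bfs_def by auto
    then have "2 \<le> LB c" using L by simp
    then have p: "?p < m" "Suc (LB ?p) = LB c" "?o \<noteq> ST0 ?p" "cyc ST0 FX ?p c ?o"
      using b c o0 unfolding bfs_def by auto
    have Lp: "1 \<le> LB ?p" using p \<open>2 \<le> LB c\<close> by simp
    have pc: "?p \<noteq> c" using p(2) by auto
    have FXc: "FX c = 0" using p(4) by (simp add: cyc_def)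
    have tro: "tr ?S ?o = tr ST ?o - {c}" using tr_upd(2)[of c ST i] c i by auto
    have co: "c \<in> tr ST ?o" using c by (simp add: tr_def)
    have io: "{i, ?o} = {1, 2}" using i o12 by auto
    have fo': "forest (tr ?S ?o)" unfolding tro by (rule forest_subset[OF fo[OF o12]]) auto
    have valid': "valid ?S FX"
    proof -
      have "forest (tr ?S 1)" "forest (tr ?S 2)" using fi fo' io by (metis insertE singletonD insertI1 insertI2)+
      then show ?thesis using i v1 FXc unfolding valid_def by auto
    qed
    have cnt': "card (tr ?S 1) + card (tr ?S 2) = card (tr ST0 1) + card (tr ST0 2)"
    proof -
      have "card (tr ST ?o) = Suc (card (tr ?S ?o))" unfolding tro using co by (metis card_Suc_Diff1 finite_tr)
      then show ?thesis using cardi cnt i o12 by auto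
    qed
    let ?A = "tr ST0 ?o" and ?T = "tr ST ?o"
    let ?P = "{f \<in> ?A. \<not> conn (?A - {f}) (EU ?p) (EV ?p)}"
    have cP: "conn ?P (EU ?p) (EV ?p)"
      by (rule path_edges[OF fo0[OF o12] finite_tr]) (use p(4) in \<open>simp add: cyc_def\<close>)
    have PT: "?P \<subseteq> ?T"
    proof
      fix f assume f: "f \<in> ?P"
      then have fm: "f < m" "ST0 f = ?o" by (auto simp: tr_def)
      show "f \<in> ?T"
      proof (cases "FX f = 0")
        case True
        have "cyc ST0 FX ?p f ?o" using f fm True p(4) by (auto simp: cyc_def)
        moreover have "LB ?p < LB c" "?o \<in> {1, 2}" using p(2) o12 by auto
        ultimately have "LB f \<le> Suc (LB ?p)"
          using conjunct2[OF conjunct2[OF conjunct2[OF b[unfolded bfs_def]]], rule_format, of ?p ?o]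
            p(1,3) Lp by blast
        then have "ST f = ST0 f" using p(2) same[OF fm(1)] by simp
        then show ?thesis using fm by (simp add: tr_def)
      next
        case False
        then show ?thesis using v1(2)[OF _ fm(1) False] v01[OF _ fm(1) False] fm by (fastforce simp: tr_def)
      qed
    qed
    have nP: "\<not> conn (?P - {c}) (EU ?p) (EV ?p)"
    proof
      assume "conn (?P - {c}) (EU ?p) (EV ?p)"
      then have "conn (?A - {c}) (EU ?p) (EV ?p)" by (rule conn_mono) auto
      then show False using p(4) by (simp add: cyc_def)
    qed
    have cP': "c \<in> ?P" using p(4) by (auto simp: cyc_def tr_def)
    then have ins: "insert c (?P - {c}) = ?P" by auto
    have nconn: "\<not> conn (tr ?S ?o) (EU ?p) (EV ?p)"
    proof
      assume a: "conn (tr ?S ?o) (EU ?p) (EV ?p)"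
      have m: "conn (?T - {c}) x y" if "conn (?P - {c}) x y" for x y
        using that by (rule conn_mono) (use PT in auto)
      have "conn (?P - {c}) (EU ?p) (EU c) \<and> conn (?P - {c}) (EV c) (EV ?p) \<or>
          conn (?P - {c}) (EU ?p) (EV c) \<and> conn (?P - {c}) (EU c) (EV ?p)"
        using conn_insert[of c "EU c" "EV c" "?P - {c}" "EU ?p" "EV ?p"] cP nP unfolding ins by blast
      then have or: "conn (?T - {c}) (EU ?p) (EU c) \<and> conn (?T - {c}) (EV c) (EV ?p) \<or>
          conn (?T - {c}) (EU ?p) (EV c) \<and> conn (?T - {c}) (EU c) (EV ?p)" using m by blast
      have "conn (?T - {c}) (EU ?p) (EV ?p)" using a unfolding tro .
      note a = this conn_sym[OF this]
      \<comment> \<open>\<open>c\<close> splits the path of the parent into two pieces, so a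
        connection of the parent's ends avoiding \<open>c\<close> would also connect the ends of
        \<open>c\<close>, which a forest excludes.\<close>
      from or have "conn (?T - {c}) (EU c) (EV c)"
      proof (elim disjE conjE)
        assume h: "conn (?T - {c}) (EU ?p) (EU c)" "conn (?T - {c}) (EV c) (EV ?p)"
        show ?thesis by (rule conn_trans[OF conn_sym[OF h(1)] conn_trans[OF a(1) conn_sym[OF h(2)]]])
      next
        assume h: "conn (?T - {c}) (EU ?p) (EV c)" "conn (?T - {c}) (EU c) (EV ?p)"
        show ?thesis by (rule conn_trans[OF h(2) conn_trans[OF a(2) h(1)]])
      qed
      then show False using forestD[OF fo[OF o12] co, of "EU c" "EV c"] by simp
    qed
    have "?o \<noteq> ?S ?p" using p(3) same[OF p(1)] p(2) pc by simp
    moreover have "\<forall>e<m. LB e \<le> LB ?p \<longrightarrow> ?S e = ST0 e" using same p(2) by auto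
    moreover have "bfs ST0 FX LB PAR (Suc m) (\<lambda>e x i. x < LB ?p)"
      by (rule bfs_weaken[OF b]) (use p(2) in auto)
    ultimately show ?thesis
      unfolding walk_def using v0 valid' p(1,2) o12 nconn Lp cnt' by (intro conjI) assumption+
  qed
qed

end

section \<open>Matroid union: the augmenting path program\<close>

text \<open>Whether an edge lies on the cycle closed in the forest is tested by deleting it from the
  selected edges and searching again. The stored label \<open>rd 44 + 2\<close> is one more than
  that of the edge being expanded.\<close>

definition EXPAND_EDGE :: lp where
  "EXPAND_EDGE = LWhen (andE (eqE (Cell bST (rd 47)) (rd bTI))
        (andE (notE (Cell bFX (rd 47))) (notE (Cell bLB (rd 47)))))
      (LStore bXS (rd 47) (Const 0) ;; REACH ;; LStore bXS (rd 47) (Const 1) ;;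
       LWhen (notE (Cell bRE (Cell bEV (rd 45))))
         (LStore bLB (rd 47) (Plus (rd 44) (Const 2)) ;; LStore bPAR (rd 47) (rd 45)))"

definition EXPAND :: lp where
  "EXPAND = SELECT ;; assign bSRC (Cell bEU (rd 45)) ;; REACH ;;
     LIf (Cell bRE (Cell bEV (rd 45))) (LFor 47 bm EXPAND_EDGE)
       (assign bFOUND (Const 1) ;; assign bCUR (rd 45) ;; assign bCI (rd bTI))"

definition EXPAND_TREE :: lp where
  "EXPAND_TREE = assign bTI (Plus (rd 46) (Const 1)) ;;
     LWhen (andE (notE (rd bFOUND)) (notE (eqE (Cell bST (rd 45)) (rd bTI)))) EXPAND"

definition LEVEL_EDGE :: lp where
  "LEVEL_EDGE = LWhen (eqE (Cell bLB (rd 45)) (Plus (rd 44) (Const 1))) (LFor 46 bTWO EXPAND_TREE)"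

definition LEVELS :: lp where
  "LEVELS = LFor 44 bm (LFor 45 bm LEVEL_EDGE)"

definition BFS_INIT :: lp where
  "BFS_INIT = LFor 43 bm (LStore bLB (rd 43) (eqE (Cell bST (rd 43)) (Const 0)))"

definition WALK_STEP :: lp where
  "WALK_STEP = LWhen (rd bFOUND) (assign bOLD (Cell bST (rd bCUR)) ;; LStore bST (rd bCUR) (rd bCI) ;;
     LIf (rd bOLD) (assign bCI (rd bOLD) ;; assign bCUR (Cell bPAR (rd bCUR))) (assign bFOUND (Const 0)))"

definition AUG :: lp where
  "AUG = BFS_INIT ;; assign bFOUND (Const 0) ;; LEVELS ;; LFor 48 bm WALK_STEP"

definition UNION :: lp where
  "UNION = LFor 49 bm (LStore bST (rd 49) (Cell bFX (rd 49))) ;; LFor 49 bm AUG"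

lemma writes_EXPAND_EDGE [simp]: "writes EXPAND_EDGE = {bXS, bRE, 40, 41, bLB, bPAR}"
  unfolding EXPAND_EDGE_def writes.simps writes_REACH by blast

lemma writes_EXPAND [simp]:
  "writes EXPAND = {bXS, bRE, 40, 41, 42, bLB, bPAR, bSRC, 47, bFOUND, bCUR, bCI}"
  unfolding EXPAND_def writes.simps writes_REACH writes_SELECT writes_EXPAND_EDGE by blast

lemma writes_EXPAND_TREE [simp]:
  "writes EXPAND_TREE = {bXS, bRE, 40, 41, 42, bLB, bPAR, bSRC, 47, bFOUND, bCUR, bCI, bTI}"
  unfolding EXPAND_TREE_def writes.simps writes_EXPAND by blast

lemma writes_LEVEL_EDGE [simp]:
  "writes LEVEL_EDGE = {bXS, bRE, 40, 41, 42, bLB, bPAR, bSRC, 47, bFOUND, bCUR, bCI, bTI, 46}"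
  unfolding LEVEL_EDGE_def writes.simps writes_EXPAND_TREE by blast

lemma writes_LEVELS [simp]:
  "writes LEVELS = {bXS, bRE, 40, 41, 42, bLB, bPAR, bSRC, 47, bFOUND, bCUR, bCI, bTI, 46, 45, 44}"
  unfolding LEVELS_def writes.simps writes_LEVEL_EDGE by blast

lemma writes_BFS_INIT [simp]: "writes BFS_INIT = {bLB, 43}"
  unfolding BFS_INIT_def writes.simps by blast

lemma writes_WALK_STEP [simp]: "writes WALK_STEP = {bOLD, bST, bCI, bCUR, bFOUND}"
  unfolding WALK_STEP_def writes.simps by blast

lemma writes_AUG [simp]:
  "writes AUG = {bXS, bRE, 40, 41, 42, bLB, bPAR, bSRC, 47, bFOUND, bCUR, bCI, bTI, 46, 45, 44, 43, bOLD, bST, 48}"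
  unfolding AUG_def writes.simps writes_LEVELS writes_BFS_INIT writes_WALK_STEP by blast

lemma writes_UNION [simp]:
  "writes UNION = {bXS, bRE, 40, 41, 42, bLB, bPAR, bSRC, 47, bFOUND, bCUR, bCI, bTI, 46, 45, 44, 43, bOLD, bST, 48, 49}"
  unfolding UNION_def writes.simps writes_AUG by blast

context instance_params
begin

lemma bfs_extend:
  assumes b: "bfs ST FX LB PAR l D" and l: "l \<le> Suc (LB e)"
    and c: "conn (tr ST i) (EU e) (EV e)" "\<And>f. cyc ST FX e f i \<Longrightarrow> 1 \<le> LB f"
    and D: "\<And>e' i'. e' < m \<Longrightarrow> i' = 1 \<or> i' = 2 \<Longrightarrow> D' e' (LB e') i' \<Longrightarrow> D e' (LB e') i' \<or> e' = e \<and> i' = i"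
  shows "bfs ST FX LB PAR l D'"
  unfolding bfs_def
proof (intro conjI)
  show "\<forall>e<m. LB e = 1 \<longleftrightarrow> ST e = 0"
    "\<forall>f<m. 2 \<le> LB f \<longrightarrow> PAR f < m \<and> Suc (LB (PAR f)) = LB f \<and> ST f \<in> {1, 2} \<and>
        ST f \<noteq> ST (PAR f) \<and> cyc ST FX (PAR f) f (ST f)" "\<forall>e<m. LB e \<le> l"
    using b unfolding bfs_def by blast+
  have b4: "\<And>e i. e < m \<Longrightarrow> i \<in> {1, 2} \<Longrightarrow> 1 \<le> LB e \<Longrightarrow> i \<noteq> ST e \<Longrightarrow> D e (LB e) i \<Longrightarrow>
        conn (tr ST i) (EU e) (EV e) \<and> (\<forall>f. cyc ST FX e f i \<longrightarrow> 1 \<le> LB f \<and> LB f \<le> Suc (LB e))"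
    and b3: "\<And>f. f < m \<Longrightarrow> LB f \<le> l"
    using b unfolding bfs_def by blast+
  show "\<forall>e<m. \<forall>i\<in>{1, 2}. 1 \<le> LB e \<longrightarrow> i \<noteq> ST e \<longrightarrow> D' e (LB e) i \<longrightarrow>
        conn (tr ST i) (EU e) (EV e) \<and> (\<forall>f. cyc ST FX e f i \<longrightarrow> 1 \<le> LB f \<and> LB f \<le> Suc (LB e))"
  proof (intro allI ballI impI)
    fix g j assume g: "g < m" "j \<in> {1, 2}" "1 \<le> LB g" "j \<noteq> ST g" "D' g (LB g) j"
    have "D g (LB g) j \<or> g = e \<and> j = i" using D[of g j] g by simp
    then show "conn (tr ST j) (EU g) (EV g) \<and> (\<forall>f. cyc ST FX g f j \<longrightarrow> 1 \<le> LB f \<and> LB f \<le> Suc (LB g))"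
    proof
      assume "D g (LB g) j"
      then show ?thesis using b4 g by blast
    next
      assume "g = e \<and> j = i"
      moreover have "LB f \<le> Suc (LB e)" if "cyc ST FX e f i" for f
        using b3[of f] that l unfolding cyc_def by auto
      ultimately show ?thesis using c by blast
    qed
  qed
qed

text \<open>Loops cannot be left early. Once an edge is found that enters a forest without closing a
  cycle, \<open>bFOUND\<close> is set and later iterations idle; the invariant then switches from
  the search to the data needed for walking back.\<close>

definition searching :: "(nat \<Rightarrow> nat) \<Rightarrow> (nat \<Rightarrow> nat) \<Rightarrow> nat \<Rightarrow> (nat \<Rightarrow> nat \<Rightarrow> nat \<Rightarrow> bool) \<Rightarrow> memory \<Rightarrow> bool" where
  "searching ST FX l D t \<longleftrightarrow>
     t bFOUND 0 = 0 \<and> bfs ST FX (t bLB) (t bPAR) l D \<or>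
     t bFOUND 0 \<noteq> 0 \<and> walk ST FX (t bLB) (t bPAR) ST (t bCUR 0) (t bCI 0) \<and> t bLB (t bCUR 0) \<le> m"

lemma searching_upd [simp]:
  "b \<notin> {bFOUND, bLB, bPAR, bCUR, bCI} \<Longrightarrow> searching ST FX l D (upd t b a x) \<longleftrightarrow> searching ST FX l D t"
  by (simp add: searching_def)

lemma searching_weaken:
  assumes "searching ST FX l D t" "l \<le> l'"
    and "\<And>e i. e < m \<Longrightarrow> i = 1 \<or> i = 2 \<Longrightarrow> i \<noteq> ST e \<Longrightarrow> D' e (t bLB e) i \<Longrightarrow> D e (t bLB e) i"
  shows "searching ST FX l' D' t"
  using assms bfs_weaken[of ST FX "t bLB" "t bPAR" l D l' D'] unfolding searching_def by blast

lemma EXPAND_EDGE_correct: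
  assumes c: "ctx s" and bf: "bfs ST FX (s bLB) (s bPAR) (d + 2) D" and e: "e < m" "s bLB e = Suc d"
    and D: "\<And>f i. \<not> D f (d + 2) i"
    and i: "i = 1 \<or> i = 2" "i \<noteq> ST e" and cn: "conn (tr ST i) (EU e) (EV e)"
    and f: "f < m" and sel: "selected s = tr ST i"
    and st: "s bST = ST" "s bFX = FX" "s bTI 0 = i" "s bSRC 0 = EU e" "s 45 0 = e" "s 44 0 = d" "s 47 0 = f"
  shows "bfs ST FX (sem EXPAND_EDGE s bLB) (sem EXPAND_EDGE s bPAR) (d + 2) D"
    and "cyc ST FX e f i \<Longrightarrow> 1 \<le> sem EXPAND_EDGE s bLB f"
    and "g \<noteq> f \<or> s bLB g \<noteq> 0 \<Longrightarrow> sem EXPAND_EDGE s bLB g = s bLB g"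
    and "selected (sem EXPAND_EDGE s) = tr ST i"
proof -
  let ?c = "ST f = i \<and> FX f = 0 \<and> s bLB f = 0"
  define s1 where "s1 = sem REACH (upd s bXS f 0)"
  have sel1: "selected (upd s bXS f 0) = tr ST i - {f}"
    using sel by (auto simp: selected_def split: if_splits)
  have r: "s1 bRE (EV e) \<noteq> 0 \<longleftrightarrow> conn (tr ST i - {f}) (EU e) (EV e)"
    using REACH_correct[of "upd s bXS f 0" "EV e"] c e EU_less EV_less sel1 st by (simp add: s1_def)
  have fr: "s1 b = s b" if "b \<notin> {bXS, bRE, 40, 41}" for b
    using sem_frame[of b REACH "upd s bXS f 0"] that by (simp add: s1_def)
  have frX: "s1 bXS = (s bXS)(f := 0)"
    using sem_frame[of bXS REACH "upd s bXS f 0"] by (simp add: s1_def)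
  have EUV: "s bEV = EV" using c by (simp add: ctx_def)
  have vals: "s1 bEV = EV" "s1 45 0 = e" "s1 44 0 = d" "s1 47 0 = f" "s1 bLB = s bLB" "s1 bPAR = s bPAR"
    using fr st EUV by simp_all
  have T: "sem EXPAND_EDGE s = (if ?c then if s1 bRE (EV e) = 0
       then upd (upd (upd s1 bXS f 1) bLB f (d + 2)) bPAR f e else upd s1 bXS f 1 else s)"
    using st vals unfolding EXPAND_EDGE_def by (simp add: s1_def)
  show "bfs ST FX (sem EXPAND_EDGE s bLB) (sem EXPAND_EDGE s bPAR) (d + 2) D"
  proof (cases "?c \<and> s1 bRE (EV e) = 0")
    case True
    then have "cyc ST FX e f (ST f)" using f cn r by (auto simp: cyc_def)
    then have "bfs ST FX ((s bLB)(f := Suc (s bLB e))) ((s bPAR)(f := e)) (d + 2) D"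
      using e True i D by (intro bfs_label[OF bf e(1) _ _ f]) auto
    then show ?thesis using True e vals unfolding T by (simp add: fun_upd_def)
  next
    case False
    then show ?thesis using bf vals unfolding T by auto
  qed
  show "1 \<le> sem EXPAND_EDGE s bLB f" if cy: "cyc ST FX e f i"
  proof (cases "s bLB f = 0")
    case True
    then have "?c" "s1 bRE (EV e) = 0" using cy r by (auto simp: cyc_def)
    then show ?thesis unfolding T by simp
  next
    case False
    then show ?thesis unfolding T by simp
  qed
  show "sem EXPAND_EDGE s bLB g = s bLB g" if "g \<noteq> f \<or> s bLB g \<noteq> 0"
    using that vals unfolding T by auto
  show "selected (sem EXPAND_EDGE s) = tr ST i"
    using sel f frX unfolding T by (auto simp: selected_def tr_def)
qed

lemma EXPAND_correct:
  assumes c: "ctx s" and v: "valid ST FX" and bf: "bfs ST FX (s bLB) (s bPAR) (d + 2) D"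
    and e: "e < m" "s bLB e = Suc d" and dm: "d < m"
    and D: "\<And>f i. \<not> D f (d + 2) i" "\<And>f x i. x \<le> d \<Longrightarrow> D f x i"
      "\<And>e' i'. e' < m \<Longrightarrow> D' e' (Suc d) i' \<Longrightarrow> i' = 1 \<or> i' = 2 \<Longrightarrow> D e' (Suc d) i' \<or> e' = e \<and> i' = i"
      "\<And>f x i. D' f x i \<Longrightarrow> x \<le> Suc d"
    and i: "i = 1 \<or> i = 2" "i \<noteq> ST e" and nf: "s bFOUND 0 = 0"
    and st: "s bST = ST" "s bFX = FX" "s bTI 0 = i" "s 45 0 = e" "s 44 0 = d"
  shows "searching ST FX (d + 2) D' (sem EXPAND s)" "sem EXPAND s bLB e = Suc d"
proof -
  define s1 where "s1 = upd (sem SELECT s) bSRC 0 (EU e)"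
  define s2 where "s2 = sem REACH s1"
  have fr1: "s1 b = s b" if "b \<notin> {bXS, 42, bSRC}" for b
    using sem_frame[of b SELECT s] that by (simp add: s1_def)
  have fr2: "s2 b = s b" if "b \<notin> {bXS, 42, bSRC, bRE, 40, 41}" for b
    using sem_frame[of b REACH s1] fr1[of b] that by (simp add: s2_def)
  have c1: "ctx s1" using c by (rule ctx_cong) (auto intro!: fr1)
  have c2: "ctx s2" using c by (rule ctx_cong) (auto intro!: fr2)
  have sel1: "selected s1 = tr ST i"
    using SELECT_correct[OF c] st by (simp add: s1_def selected_def)
  have sel2: "selected s2 = tr ST i"
    using sem_frame[of bXS REACH s1] sel1 by (simp add: s2_def selected_def)
  have r: "s2 bRE (EV e) \<noteq> 0 \<longleftrightarrow> conn (tr ST i) (EU e) (EV e)"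
    using REACH_correct[OF c1, of "EV e"] e EU_less EV_less sel1 by (simp add: s1_def s2_def)
  have src2: "s2 bSRC 0 = EU e" using sem_frame[of bSRC REACH s1] by (simp add: s2_def s1_def)
  have EUV: "s2 bEV = EV" "s bEU = EU" using c2 c by (simp_all add: ctx_def)
  have sel_vals: "sem SELECT s bEU = EU" "sem SELECT s 45 0 = e"
    using sem_frame[of bEU SELECT s] sem_frame[of 45 SELECT s] EUV st by auto
  have vals: "s2 45 0 = e" "s2 bTI 0 = i" "s2 bST = ST" "s2 bFX = FX" "s2 44 0 = d" "s2 bLB = s bLB"
    "s2 bPAR = s bPAR" "s2 bFOUND 0 = 0"
    using fr2 st nf by simp_all
  have T: "sem EXPAND s = (if s2 bRE (EV e) \<noteq> 0 then sem (LFor 47 bm EXPAND_EDGE) s2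
      else upd (upd (upd s2 bFOUND 0 1) bCUR 0 e) bCI 0 i)"
    using vals EUV sel_vals unfolding EXPAND_def by (simp add: s1_def s2_def del: sem.simps(5))
  have "searching ST FX (d + 2) D' (sem EXPAND s) \<and> sem EXPAND s bLB e = Suc d"
  proof (cases "conn (tr ST i) (EU e) (EV e)")
    case False
    then have T': "sem EXPAND s = upd (upd (upd s2 bFOUND 0 1) bCUR 0 e) bCI 0 i" using T r by simp
    have "bfs ST FX (s bLB) (s bPAR) (Suc m) (\<lambda>f x i. x < s bLB e)"
      by (rule bfs_weaken[OF bf]) (use dm e D(2) in auto)
    then have "walk ST FX (s bLB) (s bPAR) ST e i"
      unfolding walk_def using v e i False by auto
    then show ?thesis unfolding T' searching_def using e dm vals by simp
  next
    case True
    then have T': "sem EXPAND s = sem (LFor 47 bm EXPAND_EDGE) s2" using T r by simp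
    let ?P = "\<lambda>f t. bfs ST FX (t bLB) (t bPAR) (d + 2) D \<and> (\<forall>g<f. cyc ST FX e g i \<longrightarrow> 1 \<le> t bLB g) \<and>
        t bLB e = Suc d \<and> selected t = tr ST i"
    have P: "?P (s2 bm 0) (sem (LFor 47 bm EXPAND_EDGE) s2)"
    proof (rule sem_For_inv[where P = ?P])
      show "?P 0 (upd s2 47 0 0)" using bf vals e sel2 by (simp add: selected_def)
    next
      fix f t assume f: "f < s2 bm 0" and P: "?P f t" and tf: "t 47 0 = f"
        and fr: "\<And>b. b \<notin> insert 47 (writes EXPAND_EDGE) \<Longrightarrow> t b = s2 b"
      have fm: "f < m" using f c2 by (simp add: ctx_def)
      have ct: "ctx t" using c2 by (rule ctx_cong) (auto intro!: fr)
      have tv: "t bST = ST" "t bFX = FX" "t bTI 0 = i" "t bSRC 0 = EU e" "t 45 0 = e" "t 44 0 = d"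
        using fr vals src2 by simp_all
      have P1: "bfs ST FX (t bLB) (t bPAR) (d + 2) D" and P2: "t bLB e = Suc d" "selected t = tr ST i"
        and P3: "\<And>g. g < f \<Longrightarrow> cyc ST FX e g i \<Longrightarrow> 1 \<le> t bLB g" using P by blast+
      note E = EXPAND_EDGE_correct[OF ct P1 e(1) P2(1) D(1) i True fm P2(2) tv tf]
      have "1 \<le> sem EXPAND_EDGE t bLB g" if g: "g < Suc f" "cyc ST FX e g i" for g
      proof (cases "g = f")
        case True
        then show ?thesis using E(2) g by simp
      next
        case False
        then have "1 \<le> t bLB g" using P3[of g] g by simp
        then show ?thesis using E(3)[of g] by simp
      qed
      then show "?P (Suc f) (upd (sem EXPAND_EDGE t) 47 0 (Suc f))"
        using E(1) E(3)[of e] E(4) P2 by (simp add: selected_def)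
    qed
    let ?t = "sem (LFor 47 bm EXPAND_EDGE) s2"
    have P: "?P m ?t" using P c2 by (simp add: ctx_def)
    have "?t bFOUND = s2 bFOUND" by (rule sem_frame) simp
    moreover have "bfs ST FX (?t bLB) (?t bPAR) (d + 2) D'"
    proof (rule bfs_extend[where e = e and i = i and D = D])
      show "1 \<le> ?t bLB f" if "cyc ST FX e f i" for f
        using P that by (auto simp: cyc_def)
      show "D e' (?t bLB e') i' \<or> e' = e \<and> i' = i" if "e' < m" "i' = 1 \<or> i' = 2" "D' e' (?t bLB e') i'" for e' i'
      proof -
        have "?t bLB e' \<le> Suc d" using D(4) that by blast
        then show ?thesis using D(2,3) that by (cases "?t bLB e' = Suc d") auto
      qed
    qed (use P True in auto)
    ultimately show ?thesis unfolding T' searching_def using P vals by simp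
  qed
  then show "searching ST FX (d + 2) D' (sem EXPAND s)" "sem EXPAND s bLB e = Suc d" by blast+
qed

text \<open>Position of the scan in level \<open>d\<close>, whose edges carry label
  \<open>Suc d\<close>: smaller labels are finished, and within the level the pairs of edge and
  forest are processed in lexicographic order.\<close>

definition expanded :: "nat \<Rightarrow> nat \<Rightarrow> nat \<Rightarrow> nat \<Rightarrow> nat \<Rightarrow> nat \<Rightarrow> bool" where
  "expanded d e j f x i \<longleftrightarrow> x \<le> d \<or> x = Suc d \<and> (f < e \<or> f = e \<and> i \<le> j)"

lemma EXPAND_TREE_correct:
  assumes c: "ctx s" and v: "valid ST FX" and se: "searching ST FX (d + 2) (expanded d e j) s"
    and e: "e < m" "s bLB e = Suc d" and dm: "d < m" and j: "j < 2"
    and st: "s bST = ST" "s bFX = FX" "s 45 0 = e" "s 44 0 = d" "s 46 0 = j"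
  shows "searching ST FX (d + 2) (expanded d e (Suc j)) (sem EXPAND_TREE s)"
    and "sem EXPAND_TREE s bLB e = Suc d"
proof -
  let ?s = "upd s bTI 0 (Suc j)"
  have T: "sem EXPAND_TREE s = (if s bFOUND 0 = 0 \<and> ST e \<noteq> Suc j then sem EXPAND ?s else ?s)"
    using st unfolding EXPAND_TREE_def by simp
  have "searching ST FX (d + 2) (expanded d e (Suc j)) (sem EXPAND_TREE s) \<and>
      sem EXPAND_TREE s bLB e = Suc d"
  proof (cases "s bFOUND 0 = 0 \<and> ST e \<noteq> Suc j")
    case True
    have "bfs ST FX (?s bLB) (?s bPAR) (d + 2) (expanded d e j)"
      using se True by (simp add: searching_def)
    note b = this
    have c': "ctx ?s" using c by simp
    have side: "?s bLB e = Suc d" "Suc j = 1 \<or> Suc j = 2" "Suc j \<noteq> ST e" "?s bFOUND 0 = 0" "?s bST = ST" "?s bFX = FX"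
      "?s bTI 0 = Suc j" "?s 45 0 = e" "?s 44 0 = d"
      using True e st j by auto
    have D: "\<And>f i. \<not> expanded d e j f (d + 2) i" "\<And>f x i. x \<le> d \<Longrightarrow> expanded d e j f x i"
      "\<And>e' i'. e' < m \<Longrightarrow> expanded d e (Suc j) e' (Suc d) i' \<Longrightarrow> i' = 1 \<or> i' = 2 \<Longrightarrow>
        expanded d e j e' (Suc d) i' \<or> e' = e \<and> i' = Suc j"
      "\<And>f x i. expanded d e (Suc j) f x i \<Longrightarrow> x \<le> Suc d"
      by (auto simp: expanded_def le_Suc_eq)
    note E = EXPAND_correct[OF c' v b e(1) side(1) dm D side(2-9)]
    show ?thesis unfolding T using True E by simp
  next
    case False
    have "searching ST FX (d + 2) (expanded d e (Suc j)) s"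
    proof (cases "s bFOUND 0 = 0")
      case True
      then have "ST e = Suc j" using False by simp
      then show ?thesis
        by (intro searching_weaken[OF se]) (auto simp: expanded_def le_Suc_eq)
    next
      case False
      then show ?thesis using se by (simp add: searching_def)
    qed
    then show ?thesis unfolding T using False e by auto
  qed
  then show "searching ST FX (d + 2) (expanded d e (Suc j)) (sem EXPAND_TREE s)"
    "sem EXPAND_TREE s bLB e = Suc d" by blast+
qed

lemma LEVEL_EDGE_correct:
  assumes c: "ctx s" and v: "valid ST FX" and se: "searching ST FX (d + 2) (expanded d e 0) s"
    and e: "e < m" and dm: "d < m"
    and st: "s bST = ST" "s bFX = FX" "s 45 0 = e" "s 44 0 = d"
  shows "searching ST FX (d + 2) (expanded d (Suc e) 0) (sem LEVEL_EDGE s)"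
proof (cases "s bLB e = Suc d")
  case True
  then have T: "sem LEVEL_EDGE s = sem (LFor 46 bTWO EXPAND_TREE) s"
    using st unfolding LEVEL_EDGE_def by simp
  let ?P = "\<lambda>j t. searching ST FX (d + 2) (expanded d e j) t \<and> t bLB e = Suc d"
  have "?P (s bTWO 0) (sem (LFor 46 bTWO EXPAND_TREE) s)"
  proof (rule sem_For_inv[where P = ?P])
    show "?P 0 (upd s 46 0 0)" using se True by simp
  next
    fix j t assume j: "j < s bTWO 0" and P: "?P j t" and tj: "t 46 0 = j"
      and fr: "\<And>b. b \<notin> insert 46 (writes EXPAND_TREE) \<Longrightarrow> t b = s b"
    have ct: "ctx t" using c by (rule ctx_cong) (auto intro!: fr)
    have j2: "j < 2" using j c by (simp add: ctx_def)
    have "t bST = ST" "t bFX = FX" "t 45 0 = e" "t 44 0 = d" using fr st by simp_all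
    then show "?P (Suc j) (upd (sem EXPAND_TREE t) 46 0 (Suc j))"
      using EXPAND_TREE_correct[OF ct v _ e _ dm j2] P tj v by simp
  qed
  then have "searching ST FX (d + 2) (expanded d e 2) (sem LEVEL_EDGE s)"
    using c unfolding T by (simp add: ctx_def del: sem.simps(5))
  then show ?thesis by (rule searching_weaken) (auto simp: expanded_def)
next
  case False
  then have "sem LEVEL_EDGE s = s" using st unfolding LEVEL_EDGE_def by simp
  then show ?thesis
    using False by (auto intro!: searching_weaken[OF se] simp: expanded_def less_Suc_eq)
qed

lemma LEVELS_correct:
  assumes c: "ctx s" and v: "valid ST FX" and se: "searching ST FX 1 (\<lambda>e x i. x \<le> 0) s"
    and st: "s bST = ST" "s bFX = FX"
  shows "searching ST FX (Suc m) (\<lambda>e x i. x \<le> m) (sem LEVELS s)"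
proof -
  let ?P = "\<lambda>d t. searching ST FX (Suc d) (\<lambda>e x i. x \<le> d) t"
  have "?P (s bm 0) (sem LEVELS s)"
    unfolding LEVELS_def
  proof (rule sem_For_inv[where P = ?P])
    show "?P 0 (upd s 44 0 0)" using se by simp
  next
    fix d t assume d: "d < s bm 0" and P: "?P d t" and td: "t 44 0 = d"
      and fr: "\<And>b. b \<notin> insert 44 (writes (LFor 45 bm LEVEL_EDGE)) \<Longrightarrow> t b = s b"
    have ct: "ctx t" using c by (rule ctx_cong) (auto intro!: fr)
    have dm: "d < m" using d c by (simp add: ctx_def)
    let ?Q = "\<lambda>e u. searching ST FX (d + 2) (expanded d e 0) u"
    have "?Q (t bm 0) (sem (LFor 45 bm LEVEL_EDGE) t)"
    proof (rule sem_For_inv[where P = ?Q])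
      have "searching ST FX (d + 2) (expanded d 0 0) t"
        by (rule searching_weaken[OF P]) (auto simp: expanded_def)
      then show "?Q 0 (upd t 45 0 0)" by simp
    next
      fix e u assume e: "e < t bm 0" and Q: "?Q e u" and ue: "u 45 0 = e"
        and fru: "\<And>b. b \<notin> insert 45 (writes LEVEL_EDGE) \<Longrightarrow> u b = t b"
      have cu: "ctx u" using ct by (rule ctx_cong) (auto intro!: fru)
      have em: "e < m" using e ct by (simp add: ctx_def)
      have "u bST = ST" "u bFX = FX" "u 44 0 = d" using fru fr st td by simp_all
      then show "?Q (Suc e) (upd (sem LEVEL_EDGE u) 45 0 (Suc e))"
        using LEVEL_EDGE_correct[OF cu v Q em dm] ue by simp
    qed
    then have "?Q m (sem (LFor 45 bm LEVEL_EDGE) t)" using ct by (simp add: ctx_def del: sem.simps)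
    then have "?P (Suc d) (sem (LFor 45 bm LEVEL_EDGE) t)"
      by (rule searching_weaken) (auto simp: expanded_def)
    then show "?P (Suc d) (upd (sem (LFor 45 bm LEVEL_EDGE) t) 44 0 (Suc d))" by simp
  qed
  then show ?thesis using c by (simp add: ctx_def)
qed

definition size_cover :: "(nat \<Rightarrow> nat) \<Rightarrow> nat" where
  "size_cover ST = card (tr ST 1) + card (tr ST 2)"

text \<open>Each step back lowers the label by one, so label plus number of rounds never exceeds
  \<open>m\<close>. As labels on the walk are at least 1, it has ended after \<open>m\<close>
  rounds.\<close>

lemma WALK_hit:
  assumes c: "ctx s" and w: "walk ST FX (s bLB) (s bPAR) ST (s bCUR 0) (s bCI 0)"
    and L: "s bLB (s bCUR 0) \<le> m" and nf: "s bFOUND 0 \<noteq> 0" and st: "s bST = ST"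
  shows "valid (sem (LFor 48 bm WALK_STEP) s bST) FX"
    and "size_cover (sem (LFor 48 bm WALK_STEP) s bST) = Suc (size_cover ST)"
proof -
  let ?LB = "s bLB" and ?PAR = "s bPAR"
  let ?P = "\<lambda>j t. t bFOUND 0 \<noteq> 0 \<and> walk ST FX ?LB ?PAR (t bST) (t bCUR 0) (t bCI 0) \<and> ?LB (t bCUR 0) + j \<le> m
      \<or> t bFOUND 0 = 0 \<and> valid (t bST) FX \<and> size_cover (t bST) = Suc (size_cover ST)"
  have "?P (s bm 0) (sem (LFor 48 bm WALK_STEP) s)"
  proof (rule sem_For_inv[where P = ?P])
    show "?P 0 (upd s 48 0 0)" using w L nf st by simp
  next
    fix j t assume P: "?P j t" and fr: "\<And>b. b \<notin> insert 48 (writes WALK_STEP) \<Longrightarrow> t b = s b"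
    have PAR: "t bPAR = ?PAR" using fr by simp
    let ?c = "t bCUR 0" and ?i = "t bCI 0"
    show "?P (Suc j) (upd (sem WALK_STEP t) 48 0 (Suc j))"
    proof (cases "t bFOUND 0 = 0")
      case True
      then have "sem WALK_STEP t = t" unfolding WALK_STEP_def by simp
      then show ?thesis using P True by simp
    next
      case False
      then have wk: "walk ST FX ?LB ?PAR (t bST) ?c ?i" and Lj: "?LB ?c + j \<le> m" using P by auto
      let ?S = "(t bST)(?c := ?i)"
      show ?thesis
      proof (cases "t bST ?c = 0")
        case True
        then have T: "sem WALK_STEP t = upd (upd (upd t bOLD 0 0) bST ?c ?i) bFOUND 0 0"
          using False unfolding WALK_STEP_def by simp
        show ?thesis
          using walk_step(1)[OF wk True] unfolding T by (simp add: size_cover_def fun_upd_def)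
      next
        case nz: False
        then have T: "sem WALK_STEP t = upd (upd (upd (upd t bOLD 0 (t bST ?c)) bST ?c ?i) bCI 0 (t bST ?c))
            bCUR 0 (?PAR ?c)"
          using False PAR unfolding WALK_STEP_def by simp
        show ?thesis
          using walk_step(2)[OF wk nz] Lj False unfolding T by (simp add: fun_upd_def)
      qed
    qed
  qed
  then have "?P m (sem (LFor 48 bm WALK_STEP) s)" using c by (simp add: ctx_def del: sem.simps)
  then have "valid (sem (LFor 48 bm WALK_STEP) s bST) FX \<and>
      size_cover (sem (LFor 48 bm WALK_STEP) s bST) = Suc (size_cover ST)"
    unfolding walk_def by auto
  then show "valid (sem (LFor 48 bm WALK_STEP) s bST) FX"
    "size_cover (sem (LFor 48 bm WALK_STEP) s bST) = Suc (size_cover ST)" by blast+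
qed

lemma WALK_none:
  assumes nf: "s bFOUND 0 = 0"
  shows "sem (LFor 48 bm WALK_STEP) s bST = s bST"
proof -
  let ?P = "\<lambda>j t. t bFOUND 0 = 0 \<and> t bST = s bST"
  have "?P (s bm 0) (sem (LFor 48 bm WALK_STEP) s)"
  proof (rule sem_For_inv[where P = ?P])
    show "?P 0 (upd s 48 0 0)" using nf by simp
  next
    fix j t assume P: "?P j t"
    then have "sem WALK_STEP t = t" unfolding WALK_STEP_def by simp
    then show "?P (Suc j) (upd (sem WALK_STEP t) 48 0 (Suc j))" using P by simp
  qed
  then show ?thesis by blast
qed

lemma AUG_correct:
  assumes c: "ctx s" and v: "valid (s bST) (s bFX)"
  shows "valid (sem AUG s bST) (s bFX) \<and> (size_cover (sem AUG s bST) = Suc (size_cover (s bST)) \<or>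
    sem AUG s bST = s bST \<and> maxi (s bST) (s bFX))"
proof -
  define s1 where "s1 = upd (sem BFS_INIT s) bFOUND 0 0"
  have fr1: "s1 b = s b" if "b \<notin> {bLB, 43, bFOUND}" for b
    using sem_frame[of b BFS_INIT s] that by (simp add: s1_def)
  have "\<forall>e < s bm 0. sem BFS_INIT s bLB e = (if s bST e = 0 then 1 else 0)"
    unfolding BFS_INIT_def
  proof (rule sem_For_inv[where P = "\<lambda>j t. \<forall>e<j. t bLB e = (if s bST e = 0 then 1 else 0)"], goal_cases)
    case (2 j t)
    then show ?case using 2(4)[of bST] by (auto simp: less_Suc_eq)
  qed simp
  then have LB: "s1 bLB e = (if s bST e = 0 then 1 else 0)" if "e < m" for e
    using c that by (simp add: s1_def ctx_def)
  have "bfs (s bST) (s bFX) (s1 bLB) (s1 bPAR) 1 (\<lambda>e x i. x \<le> 0)"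
    unfolding bfs_def by (auto simp: LB)
  then have se: "searching (s bST) (s bFX) 1 (\<lambda>e x i. x \<le> 0) s1"
    unfolding searching_def by (simp add: s1_def)
  have c1: "ctx s1" using c by (rule ctx_cong) (auto intro!: fr1)
  define s2 where "s2 = sem LEVELS s1"
  have fr2: "s2 b = s1 b" if "b \<notin> writes LEVELS" for b
    unfolding s2_def by (rule sem_frame[OF that])
  have se2: "searching (s bST) (s bFX) (Suc m) (\<lambda>e x i. x \<le> m) s2"
    unfolding s2_def by (rule LEVELS_correct[OF c1 v se]) (use fr1 in auto)
  have c2: "ctx s2" using c1 by (rule ctx_cong) (auto intro!: fr2)
  have ST2: "s2 bST = s bST" using fr2 fr1 by simp
  have T: "sem AUG s = sem (LFor 48 bm WALK_STEP) s2"
    unfolding AUG_def by (simp add: s2_def s1_def del: sem.simps(5))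
  show ?thesis
  proof (cases "s2 bFOUND 0 = 0")
    case True
    then have "maxi (s bST) (s bFX)"
      using se2 bfs_complete_maxi[OF v] unfolding searching_def by blast
    then show ?thesis unfolding T using WALK_none[of s2, OF True] ST2 v by simp
  next
    case False
    then have "walk (s bST) (s bFX) (s2 bLB) (s2 bPAR) (s bST) (s2 bCUR 0) (s2 bCI 0)" "s2 bLB (s2 bCUR 0) \<le> m"
      using se2 unfolding searching_def by simp_all
    from WALK_hit[OF c2 this False ST2] show ?thesis unfolding T by blast
  qed
qed

lemma maxi_if_full:
  assumes "m \<le> size_cover ST"
  shows "maxi ST FX"
  unfolding maxi_def
proof (intro allI impI)
  fix S S' assume S: "S \<subseteq> {..<m}" "S' \<subseteq> {..<m}" "S \<inter> S' = {}"
  then have "card S + card S' = card (S \<union> S')"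
    by (intro card_Un_disjoint[symmetric]) (auto intro: finite_subset)
  also have "\<dots> \<le> card {..<m}" using S by (intro card_mono) auto
  finally show "card S + card S' \<le> card (tr ST 1) + card (tr ST 2)"
    using assms by (simp add: size_cover_def)
qed

lemma maxi_mono: "maxi ST FX \<Longrightarrow> size_cover ST \<le> size_cover ST' \<Longrightarrow> maxi ST' FX"
  unfolding maxi_def size_cover_def by (meson le_trans)

text \<open>After \<open>j\<close> rounds either at least \<open>j\<close> edges are covered or the
  cover is maximum, and the latter persists since covers never shrink. A cover of all
  \<open>m\<close> edges is maximum, so \<open>m\<close> rounds suffice.\<close>

lemma UNION_correct:
  assumes c: "ctx s" and FX: "\<And>e. e < m \<Longrightarrow> s bFX e \<le> 2" "forest (tr (s bFX) 1)" "forest (tr (s bFX) 2)"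
  shows "valid (sem UNION s bST) (s bFX) \<and> maxi (sem UNION s bST) (s bFX)"
proof -
  define s1 where "s1 = sem (LFor 49 bm (LStore bST (rd 49) (Cell bFX (rd 49)))) s"
  have fr1: "s1 b = s b" if "b \<notin> {bST, 49}" for b
    unfolding s1_def by (rule sem_frame) (use that in simp)
  have "\<forall>e < s bm 0. s1 bST e = s bFX e"
    unfolding s1_def
  proof (rule sem_For_inv[where P = "\<lambda>j t. \<forall>e<j. t bST e = s bFX e"], goal_cases)
    case (2 j t)
    then show ?case using 2(4)[of bFX] by (auto simp: less_Suc_eq)
  qed simp
  then have ST1: "s1 bST e = s bFX e" if "e < m" for e using c that by (simp add: ctx_def)
  then have "tr (s1 bST) i = tr (s bFX) i" for i by (auto simp: tr_def)
  then have v1: "valid (s1 bST) (s bFX)" using FX ST1 unfolding valid_def by simp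
  have c1: "ctx s1" using c by (rule ctx_cong) (auto intro!: fr1)
  have T: "sem UNION s = sem (LFor 49 bm AUG) s1" by (simp add: UNION_def s1_def del: sem.simps(5))
  let ?P = "\<lambda>j t. valid (t bST) (s bFX) \<and> (j \<le> size_cover (t bST) \<or> maxi (t bST) (s bFX))"
  have "?P (s1 bm 0) (sem (LFor 49 bm AUG) s1)"
  proof (rule sem_For_inv[where P = ?P])
    show "?P 0 (upd s1 49 0 0)" using v1 by simp
  next
    fix j t assume P: "?P j t" and fr: "\<And>b. b \<notin> insert 49 (writes AUG) \<Longrightarrow> t b = s1 b"
    have ct: "ctx t" using c1 by (rule ctx_cong) (auto intro!: fr)
    have FXt: "t bFX = s bFX" using fr fr1 by simp
    have A: "valid (sem AUG t bST) (s bFX)"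
      "size_cover (sem AUG t bST) = Suc (size_cover (t bST)) \<or> sem AUG t bST = t bST \<and> maxi (t bST) (s bFX)"
      using AUG_correct[OF ct] P FXt by auto
    have "Suc j \<le> size_cover (sem AUG t bST) \<or> maxi (sem AUG t bST) (s bFX)"
    proof (cases "maxi (t bST) (s bFX)")
      case True
      have "size_cover (t bST) \<le> size_cover (sem AUG t bST)" using A(2) by auto
      then show ?thesis using maxi_mono[OF True] by simp
    next
      case False
      then show ?thesis using A(2) P by auto
    qed
    then show "?P (Suc j) (upd (sem AUG t) 49 0 (Suc j))" using A(1) by simp
  qed
  then have "?P m (sem UNION s)" unfolding T using c1 by (simp add: ctx_def del: sem.simps)
  then show ?thesis using maxi_if_full by blast
qed

section \<open>Branching choices and their completeness\<close>

text \<open>\<open>W\<close> is the vertex set of the current subtree.\<close>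

definition cross :: "(nat \<Rightarrow> nat) \<Rightarrow> nat set \<Rightarrow> nat \<Rightarrow> bool" where
  "cross FX W e \<longleftrightarrow> e < m \<and> FX e = 0 \<and> (EU e \<in> W) \<noteq> (EV e \<in> W)"

definition inn :: "nat set \<Rightarrow> nat \<Rightarrow> nat" where
  "inn W e = (if EU e \<in> W then EU e else EV e)"

definition crossing_before :: "(nat \<Rightarrow> nat) \<Rightarrow> nat set \<Rightarrow> nat \<Rightarrow> nat \<Rightarrow> nat set" where
  "crossing_before FX W x e = {f. f < e \<and> cross FX W f \<and> inn W f = x}"

text \<open>Only the first \<open>M\<close> crossing edges at every inner vertex are branched on.\<close>

definition elig :: "(nat \<Rightarrow> nat) \<Rightarrow> nat set \<Rightarrow> nat \<Rightarrow> bool" where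
  "elig FX W e \<longleftrightarrow> cross FX W e \<and> card (crossing_before FX W (inn W e) e) < M"

definition rank :: "(nat \<Rightarrow> nat) \<Rightarrow> nat set \<Rightarrow> nat \<Rightarrow> nat" where
  "rank FX W e = card {f. f < e \<and> elig FX W f}"

text \<open>A choice \<open>c\<close> that is not the rank of an eligible edge leaves the state
  unchanged. This lets a run of exactly \<open>N\<close> steps produce cores with fewer
  edges.\<close>

definition nxt :: "nat \<Rightarrow> nat \<Rightarrow> (nat \<Rightarrow> nat) \<times> nat set \<Rightarrow> (nat \<Rightarrow> nat) \<times> nat set" where
  "nxt i c = (\<lambda>(FX, W). if \<exists>e. elig FX W e \<and> rank FX W e = c
     then let e = (THE e. elig FX W e \<and> rank FX W e = c) in (FX(e := i), W \<union> {EU e, EV e})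
     else (FX, W))"

text \<open>The branching choices are the digits of \<open>\<tau>\<close> in base \<open>B\<close>.\<close>

fun run :: "nat \<Rightarrow> nat \<Rightarrow> nat \<Rightarrow> (nat \<Rightarrow> nat) \<times> nat set \<Rightarrow> ((nat \<Rightarrow> nat) \<times> nat set) \<times> nat" where
  "run i 0 \<tau> \<sigma> = (\<sigma>, \<tau>)"
| "run i (Suc j) \<tau> \<sigma> = run i j (\<tau> div B) (nxt i (\<tau> mod B) \<sigma>)"

lemma rank_Suc: "rank FX W (Suc e) = (if elig FX W e then Suc (rank FX W e) else rank FX W e)"
proof -
  have "{f. f < Suc e \<and> elig FX W f} =
      (if elig FX W e then insert e {f. f < e \<and> elig FX W f} else {f. f < e \<and> elig FX W f})"
    by (auto simp: less_Suc_eq)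
  then show ?thesis by (simp add: rank_def)
qed

lemma rank_mono: "e \<le> e' \<Longrightarrow> rank FX W e \<le> rank FX W e'"
  unfolding rank_def by (rule card_mono) auto

lemma rank_less: "elig FX W e \<Longrightarrow> e < e' \<Longrightarrow> rank FX W e < rank FX W e'"
  using rank_Suc[of FX W e] rank_mono[of "Suc e" e' FX W] by simp

lemma rank_inj: "elig FX W e \<Longrightarrow> elig FX W e' \<Longrightarrow> rank FX W e = rank FX W e' \<Longrightarrow> e = e'"
  using rank_less by (metis linorder_neqE_nat less_irrefl)

lemma nxt_elig:
  assumes "elig FX W e" "rank FX W e = c"
  shows "nxt i c (FX, W) = (FX(e := i), W \<union> {EU e, EV e})"
proof -
  have "(THE e. elig FX W e \<and> rank FX W e = c) = e"
    using assms rank_inj by (intro the_equality) auto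
  then show ?thesis using assms by (auto simp: nxt_def)
qed

lemma nxt_none: "rank FX W m \<le> c \<Longrightarrow> nxt i c (FX, W) = (FX, W)"
proof -
  assume c: "rank FX W m \<le> c"
  have "rank FX W e \<noteq> c" if "elig FX W e" for e
    using rank_less[OF that, of m] that c by (auto simp: elig_def cross_def)
  then show ?thesis by (auto simp: nxt_def)
qed

lemma nxt_cases:
  obtains "nxt i c (FX, W) = (FX, W)"
  | e where "elig FX W e" "nxt i c (FX, W) = (FX(e := i), W \<union> {EU e, EV e})"
proof (cases "\<exists>e. elig FX W e \<and> rank FX W e = c")
  case True
  then show ?thesis using nxt_elig that(2) by blast
next
  case False
  show ?thesis by (rule that(1)) (simp only: nxt_def prod.case if_not_P[OF False])
qed

lemma cross_outer:
  assumes "cross FX W e"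
  obtains y where "{EU e, EV e} = {inn W e, y}" "inn W e \<in> W" "y \<notin> W" "W \<union> {EU e, EV e} = insert y W"
    "e < m" "FX e = 0"
proof (cases "EU e \<in> W")
  case True
  then show ?thesis using assms by (intro that[of "EV e"]) (auto simp: cross_def inn_def)
next
  case False
  then show ?thesis using assms by (intro that[of "EU e"]) (auto simp: cross_def inn_def)
qed

lemma finite_crossing_before [simp]: "finite (crossing_before FX W x e)"
  by (simp add: crossing_before_def)

lemma crossing_before_Suc:
  "crossing_before FX W x (Suc e) = (if cross FX W e \<and> inn W e = x
     then insert e (crossing_before FX W x e) else crossing_before FX W x e)"
  by (auto simp: crossing_before_def less_Suc_eq)

lemma card_crossing_before_Suc:
  "card (crossing_before FX W x (Suc e)) = (if cross FX W e \<and> inn W e = x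
     then Suc (card (crossing_before FX W x e)) else card (crossing_before FX W x e))"
proof -
  have "e \<notin> crossing_before FX W x e" by (simp add: crossing_before_def)
  then show ?thesis by (simp add: crossing_before_Suc)
qed

text \<open>The cut-off leaves all crossing edges at \<open>x\<close> or exactly \<open>M\<close> of
  them, the alternative that \<open>core_growth\<close> asks for.\<close>

lemma card_elig_at:
  "card {f. f < e \<and> elig FX W f \<and> inn W f = x} = min M (card (crossing_before FX W x e))"
proof (induction e)
  case 0
  then show ?case by (simp add: crossing_before_def)
next
  case (Suc e)
  have "{f. f < Suc e \<and> elig FX W f \<and> inn W f = x} = (if elig FX W e \<and> inn W e = x
      then insert e {f. f < e \<and> elig FX W f \<and> inn W f = x} else {f. f < e \<and> elig FX W f \<and> inn W f = x})"
    by (auto simp: less_Suc_eq)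
  then have "card {f. f < Suc e \<and> elig FX W f \<and> inn W f = x} = (if elig FX W e \<and> inn W e = x
      then Suc (card {f. f < e \<and> elig FX W f \<and> inn W f = x}) else card {f. f < e \<and> elig FX W f \<and> inn W f = x})"
    by simp
  then show ?case using Suc by (auto simp: card_crossing_before_Suc elig_def)
qed

text \<open>With \<open>card W \<le> Suc N\<close> all ranks are below \<open>Suc N * M\<close>, so
  a base \<open>B\<close> above this number has a digit for every choice and one left over for
  idling.\<close>

lemma rank_bound:
  assumes "finite W"
  shows "rank FX W m \<le> card W * M"
proof -
  have "{f. f < m \<and> elig FX W f} \<subseteq> (\<Union>x\<in>W. {f. f < m \<and> elig FX W f \<and> inn W f = x})"
    unfolding elig_def by (auto elim: cross_outer)
  then have "rank FX W m \<le> card (\<Union>x\<in>W. {f. f < m \<and> elig FX W f \<and> inn W f = x})"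
    unfolding rank_def using assms by (intro card_mono) auto
  also have "\<dots> \<le> (\<Sum>x\<in>W. card {f. f < m \<and> elig FX W f \<and> inn W f = x})"
    by (rule card_UN_le[OF assms])
  also have "\<dots> \<le> (\<Sum>x\<in>W. M)" by (rule sum_mono) (simp add: card_elig_at)
  finally show ?thesis by simp
qed

text \<open>\<open>P\<close> is the set of edges fixed for the other tree. The mark of an edge is
  nonzero exactly if it belongs to the growing core or to \<open>P\<close>, so edges marked 0 are
  free for both trees.\<close>

definition grown :: "nat \<Rightarrow> nat set \<Rightarrow> (nat \<Rightarrow> nat) \<Rightarrow> nat set \<Rightarrow> bool" where
  "grown i P FX W \<longleftrightarrow> rtree (tr FX i) W \<and> i \<noteq> 0 \<and> (\<forall>e<m. FX e \<noteq> 0 \<longleftrightarrow> FX e = i \<or> e \<in> P) \<and>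
     P \<subseteq> {..<m} \<and> (\<forall>e\<in>P. FX e \<noteq> i)"

lemma grown_step:
  assumes g: "grown i P FX W" and e: "cross FX W e"
  shows "grown i P (FX(e := i)) (W \<union> {EU e, EV e})" "tr (FX(e := i)) i = insert e (tr FX i)"
    "j \<noteq> i \<Longrightarrow> j \<noteq> 0 \<Longrightarrow> tr (FX(e := i)) j = tr FX j"
proof -
  obtain y where y: "{EU e, EV e} = {inn W e, y}" "inn W e \<in> W" "y \<notin> W" "W \<union> {EU e, EV e} = insert y W"
    "e < m" "FX e = 0"
    using cross_outer[OF e] .
  show t: "tr (FX(e := i)) i = insert e (tr FX i)" using y by (auto simp: tr_def)
  show "tr (FX(e := i)) j = tr FX j" if "j \<noteq> i" "j \<noteq> 0" using y that by (auto simp: tr_def)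
  have "rtree (tr (FX(e := i)) i) (W \<union> {EU e, EV e})"
    unfolding t y(4) by (rule rtree_step[OF _ _ y(1,2,3)]) (use g y in \<open>auto simp: grown_def\<close>)
  moreover have "e \<notin> P" using g y unfolding grown_def by auto
  ultimately show "grown i P (FX(e := i)) (W \<union> {EU e, EV e})" using g y unfolding grown_def by auto
qed

lemma nxt_grown:
  assumes g: "grown i P FX W" and n: "nxt i c (FX, W) = (FX', W')"
  shows "grown i P FX' W' \<and> (\<forall>j. j \<noteq> i \<longrightarrow> j \<noteq> 0 \<longrightarrow> tr FX' j = tr FX j)"
proof (rule nxt_cases[of i c FX W])
  assume "nxt i c (FX, W) = (FX, W)"
  then show ?thesis using g n by simp
next
  fix e assume e: "elig FX W e" "nxt i c (FX, W) = (FX(e := i), W \<union> {EU e, EV e})"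
  then show ?thesis using grown_step[OF g, of e] n by (auto simp: elig_def)
qed

lemma run_grown:
  assumes "grown i P FX W" "run i j \<tau> (FX, W) = ((FX', W'), \<tau>')"
  shows "grown i P FX' W' \<and> (\<forall>j. j \<noteq> i \<longrightarrow> j \<noteq> 0 \<longrightarrow> tr FX' j = tr FX j)"
  using assms
proof (induction j arbitrary: \<tau> FX W)
  case (Suc j)
  obtain FX1 W1 where n: "nxt i (\<tau> mod B) (FX, W) = (FX1, W1)" by fastforce
  show ?case using Suc.IH[of FX1 W1 "\<tau> div B"] nxt_grown[OF Suc.prems(1) n] Suc.prems(2) n by auto
qed simp

lemma run_outside: "run i j \<tau> (FX, W) = ((FX', W'), \<tau>') \<Longrightarrow> m \<le> e \<Longrightarrow> FX' e = FX e"
proof (induction j arbitrary: \<tau> FX W)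
  case (Suc j)
  obtain FX1 W1 where n: "nxt i (\<tau> mod B) (FX, W) = (FX1, W1)" by fastforce
  have "FX1 e = FX e"
    by (rule nxt_cases[of i "\<tau> mod B" FX W]) (use n Suc.prems in \<open>auto simp: elig_def cross_def\<close>)
  then show ?case using Suc.IH[of "\<tau> div B" FX1 W1] Suc.prems n by auto
qed simp

text \<open>The target \<open>F'\<close> is not kept: each digit follows an edge supplied by
  \<open>core_growth\<close>, which may replace the target by another one of the same size. The
  induction is on a bound \<open>j\<close> for the number of missing edges. The upper digits
  \<open>\<rho>\<close> are left free because they encode the choices for the other tree.\<close>

lemma run_complete:
  assumes "grown i P FX W" "rtree F' W'" "tr FX i \<subseteq> F'" "safe_edges k F'" "extendable F' G" "P \<subseteq> G"
    "card F' \<le> N" "card G \<le> N" "card F' \<le> card (tr FX i) + j"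
    and M: "4 * N + 5 \<le> M" and Bb: "Suc N * M < B"
  shows "\<exists>\<tau><B ^ j. \<exists>FX' W''. (\<forall>\<rho>. run i j (\<tau> + B ^ j * \<rho>) (FX, W) = ((FX', W''), \<rho>)) \<and>
    safe_edges k (tr FX' i) \<and> extendable (tr FX' i) G \<and> card (tr FX' i) \<le> N"
  using assms(1-9)
proof (induction j arbitrary: FX W F' W')
  case 0
  have "finite F'" using rtree_props(3)[OF 0(2)] .
  then have "tr FX i = F'" using 0(3,9) card_seteq[of F' "tr FX i"] by simp
  then show ?case using 0 by auto
next
  case (Suc j)
  let ?F = "tr FX i"
  have rt: "rtree ?F W" using Suc.prems(1) by (simp add: grown_def)
  have finF': "finite F'" using rtree_props(3)[OF Suc.prems(2)] .
  have lift: "\<exists>\<tau><B ^ Suc j. \<exists>FX' W''. (\<forall>\<rho>. run i (Suc j) (\<tau> + B ^ Suc j * \<rho>) (FX, W) = ((FX', W''), \<rho>)) \<and>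
    safe_edges k (tr FX' i) \<and> extendable (tr FX' i) G \<and> card (tr FX' i) \<le> N"
    if c: "c < B" "nxt i c (FX, W) = (FX1, W1)"
      and ih: "\<exists>\<tau><B ^ j. \<exists>FX' W''. (\<forall>\<rho>. run i j (\<tau> + B ^ j * \<rho>) (FX1, W1) = ((FX', W''), \<rho>)) \<and>
        safe_edges k (tr FX' i) \<and> extendable (tr FX' i) G \<and> card (tr FX' i) \<le> N" for c FX1 W1
  proof -
    obtain \<tau> FX' W'' where t: "\<tau> < B ^ j" "\<And>\<rho>. run i j (\<tau> + B ^ j * \<rho>) (FX1, W1) = ((FX', W''), \<rho>)"
        "safe_edges k (tr FX' i)" "extendable (tr FX' i) G" "card (tr FX' i) \<le> N" using ih by blast
    have "c + B * \<tau> < B ^ Suc j"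
    proof -
      have "c + B * \<tau> < B + B * \<tau>" using c by simp
      also have "\<dots> = B * Suc \<tau>" by simp
      also have "\<dots> \<le> B * B ^ j" using t(1) by (intro mult_le_mono) auto
      finally show ?thesis by simp
    qed
    moreover have "run i (Suc j) (c + B * \<tau> + B ^ Suc j * \<rho>) (FX, W) = ((FX', W''), \<rho>)" for \<rho>
    proof -
      have eq: "c + B * \<tau> + B ^ Suc j * \<rho> = c + B * (\<tau> + B ^ j * \<rho>)" by (simp add: algebra_simps)
      have "(c + B * (\<tau> + B ^ j * \<rho>)) mod B = c" "(c + B * (\<tau> + B ^ j * \<rho>)) div B = \<tau> + B ^ j * \<rho>"
        using c by auto
      then have "run i (Suc j) (c + B * \<tau> + B ^ Suc j * \<rho>) (FX, W) = run i j (\<tau> + B ^ j * \<rho>) (FX1, W1)"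
        unfolding eq using c by simp
      then show ?thesis using t(2) by simp
    qed
    ultimately show ?thesis using t(3-5) by blast
  qed
  show ?case
  proof (cases "?F = F'")
    case True
    \<comment> \<open>The core is complete, so this step uses a digit beyond all ranks and
      idles.\<close>
    have "rank FX W m \<le> card W * M" using rank_bound[OF rtree_props(4)[OF rt]] .
    also have "\<dots> \<le> Suc N * M" using rtree_props(5)[OF rt] True Suc.prems(7) by (intro mult_le_mono) auto
    finally have n: "nxt i (Suc N * M) (FX, W) = (FX, W)" by (rule nxt_none)
    show ?thesis
      by (rule lift[OF Bb n], rule Suc.IH[OF Suc.prems(1-8)]) (use True in simp)
  next
    case False
    then have ps: "?F \<subset> F'" using Suc.prems(3) by auto
    let ?cand = "\<lambda>x. {e. e < m \<and> elig FX W e \<and> inn W e = x}"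
    have cr: "{e \<in> {..<m} - P. \<exists>y. {EU e, EV e} = {x, y} \<and> y \<notin> W} = crossing_before FX W x m"
      if x: "x \<in> W" for x
    proof (rule set_eqI, rule iffI)
      fix e assume "e \<in> {e \<in> {..<m} - P. \<exists>y. {EU e, EV e} = {x, y} \<and> y \<notin> W}"
      then obtain y where e: "e < m" "e \<notin> P" "{EU e, EV e} = {x, y}" "y \<notin> W" by auto
      have "e \<notin> tr FX i" using rtree_props(7)[OF rt, of e] e by auto
      then have "FX e = 0" using Suc.prems(1) e unfolding grown_def by (auto simp: tr_def)
      then show "e \<in> crossing_before FX W x m"
        using e x by (auto simp: crossing_before_def cross_def inn_def doubleton_eq_iff)
    next
      fix e assume "e \<in> crossing_before FX W x m"
      then have e: "e < m" "cross FX W e" "inn W e = x" by (auto simp: crossing_before_def)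
      then obtain y where y: "{EU e, EV e} = {x, y}" "y \<notin> W" "FX e = 0" by (auto elim: cross_outer)
      have "e \<notin> P" using Suc.prems(1) y e unfolding grown_def by auto
      then show "e \<in> {e \<in> {..<m} - P. \<exists>y. {EU e, EV e} = {x, y} \<and> y \<notin> W}" using e y by auto
    qed
    have sub: "?cand x \<subseteq> crossing_before FX W x m" for x
      by (auto simp: crossing_before_def elig_def)
    have cc: "card (?cand x) = min M (card (crossing_before FX W x m))" for x
      by (rule card_elig_at)
    have "\<exists>x\<in>W. \<exists>e\<in>?cand x. \<exists>F'' W''. rtree F'' W'' \<and> insert e ?F \<subseteq> F'' \<and> safe_edges k F'' \<and>
        extendable F'' G \<and> card F'' = card F'"
    proof (rule core_growth[OF rt Suc.prems(2) ps Suc.prems(4,5,7,8,6) _ M])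
      show "?cand x \<subseteq> {e \<in> {..<m} - P. \<exists>y. {EU e, EV e} = {x, y} \<and> y \<notin> W}" if "x \<in> W" for x
        using sub cr[OF that] by simp
      show "?cand x = {e \<in> {..<m} - P. \<exists>y. {EU e, EV e} = {x, y} \<and> y \<notin> W} \<or> M \<le> card (?cand x)"
        if "x \<in> W" for x
      proof (cases "M \<le> card (crossing_before FX W x m)")
        case True
        then show ?thesis using cc by simp
      next
        case False
        then have "?cand x = crossing_before FX W x m"
          using sub cc by (intro card_subset_eq) auto
        then show ?thesis using cr[OF that] by simp
      qed
    qed
    then obtain e F'' W'' where e: "elig FX W e" and F'': "rtree F'' W''" "insert e ?F \<subseteq> F''"
      "safe_edges k F''" "extendable F'' G" "card F'' = card F'" by blast
    have ce: "cross FX W e" using e by (simp add: elig_def)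
    have "rank FX W e < rank FX W m" using rank_less[OF e] ce by (simp add: cross_def)
    also have "\<dots> \<le> card W * M" using rank_bound[OF rtree_props(4)[OF rt]] .
    also have "\<dots> \<le> Suc N * M"
      using rtree_props(5)[OF rt] card_mono[OF finF' Suc.prems(3)] Suc.prems(7) by (intro mult_le_mono) auto
    finally have cB: "rank FX W e < B" using Bb by simp
    note gs = grown_step[OF Suc.prems(1) ce]
    have eF: "e \<notin> ?F" using ce Suc.prems(1) by (auto simp: cross_def tr_def grown_def)
    have cF: "card F'' \<le> card (tr (FX(e := i)) i) + j"
      unfolding gs(2) using eF Suc.prems(9) F''(5) by simp
    have sF: "tr (FX(e := i)) i \<subseteq> F''" unfolding gs(2) by (rule F''(2))
    have cN: "card F'' \<le> N" using F''(5) Suc.prems(7) by simp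
    show ?thesis
      by (rule lift[OF cB nxt_elig[OF e refl]],
          rule Suc.IH[OF gs(1) F''(1) sF F''(3,4) Suc.prems(6) cN Suc.prems(8) cF])
  qed
qed

end

section \<open>Growing the cores\<close>

text \<open>The machine has no division, so \<open>B\<close> is subtracted as long as possible.
  \<open>bX\<close> can bound the rounds because the counter \<open>bTAU\<close> never exceeds
  it.\<close>

definition DIVMOD :: lp where
  "DIVMOD = assign bQ (Const 0) ;; assign bC (rd bTAU) ;;
     LFor 52 bX (LWhen (leE (rd bB) (rd bC)) (assign bC (Monus (rd bC) (rd bB)) ;; assign bQ (Plus (rd bQ) (Const 1)))) ;;
     assign bTAU (rd bQ)"

text \<open>\<open>bC\<close> starts at the wanted rank plus one and drops at each eligible edge, so
  among eligible edges it is 1 exactly at the one sought; truncation keeps it at 0 afterwards.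
  \<open>bSE\<close> stores the edge number plus one, with 0 for none. An edge crosses if the
  membership marks of its ends add up to 1.\<close>

definition SCAN :: lp where
  "SCAN = LWhen (andE (notE (Cell bFX (rd 53)))
        (eqE (Plus (Cell bW (Cell bEU (rd 53))) (Cell bW (Cell bEV (rd 53)))) (Const 1)))
      (LIf (Cell bW (Cell bEU (rd 53))) (assign bCT (Cell bEU (rd 53))) (assign bCT (Cell bEV (rd 53))) ;;
       LWhen (leE (Plus (Cell bCNT (rd bCT)) (Const 1)) (rd bM))
         (LStore bCNT (rd bCT) (Plus (Cell bCNT (rd bCT)) (Const 1)) ;;
          LWhen (eqE (rd bC) (Const 1)) (assign bSE (Plus (rd 53) (Const 1))) ;;
          assign bC (Monus (rd bC) (Const 1))))"

definition GROW_STEP :: lp where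
  "GROW_STEP = DIVMOD ;; LFor 50 bn (LStore bCNT (rd 50) (Const 0)) ;;
     assign bC (Plus (rd bC) (Const 1)) ;; assign bSE (Const 0) ;; LFor 53 bm SCAN ;;
     LWhen (rd bSE) (LStore bFX (Monus (rd bSE) (Const 1)) (rd bTI) ;;
       LStore bW (Cell bEU (Monus (rd bSE) (Const 1))) (Const 1) ;;
       LStore bW (Cell bEV (Monus (rd bSE) (Const 1))) (Const 1))"

definition GROW :: lp where
  "GROW = LFor 50 bn (LStore bW (rd 50) (Const 0)) ;; LStore bW (rd br) (Const 1) ;;
     LFor 51 bN GROW_STEP"

lemma writes_DIVMOD [simp]: "writes DIVMOD = {bQ, bC, bTAU, 52}"
  unfolding DIVMOD_def writes.simps by blast

lemma writes_SCAN [simp]: "writes SCAN = {bCT, bCNT, bSE, bC}"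
  unfolding SCAN_def writes.simps by blast

lemma writes_GROW_STEP [simp]:
  "writes GROW_STEP = {bQ, bC, bTAU, 52, bCT, bCNT, bSE, 50, 53, bFX, bW}"
  unfolding GROW_STEP_def writes.simps writes_DIVMOD writes_SCAN by blast

lemma writes_GROW [simp]:
  "writes GROW = {bQ, bC, bTAU, 52, bCT, bCNT, bSE, 50, 53, bFX, bW, 51}"
  unfolding GROW_def writes.simps writes_GROW_STEP by blast

lemma DIVMOD_correct:
  assumes X: "s bTAU 0 \<le> s bX 0" and B: "1 \<le> s bB 0"
  shows "sem DIVMOD s bTAU 0 = s bTAU 0 div s bB 0" "sem DIVMOD s bC 0 = s bTAU 0 mod s bB 0"
proof -
  let ?t = "s bTAU 0" and ?B = "s bB 0"
  let ?body = "LWhen (leE (rd bB) (rd bC)) (assign bC (Monus (rd bC) (rd bB)) ;; assign bQ (Plus (rd bQ) (Const 1)))"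
  define s1 where "s1 = upd (upd s bQ 0 0) bC 0 ?t"
  define s2 where "s2 = sem (LFor 52 bX ?body) s1"
  let ?P = "\<lambda>j t. ?t = ?B * t bQ 0 + t bC 0 \<and> (t bC 0 < ?B \<or> j \<le> t bQ 0)"
  have "?P (s1 bX 0) s2"
    unfolding s2_def
  proof (rule sem_For_inv[where P = ?P])
    show "?P 0 (upd s1 52 0 0)" by (simp add: s1_def)
  next
    fix j t assume P: "?P j t" and fr: "\<And>b. b \<notin> insert 52 (writes ?body) \<Longrightarrow> t b = s1 b"
    have "t bB = s bB" using fr[of bB] by (simp add: s1_def)
    then show "?P (Suc j) (upd (sem ?body t) 52 0 (Suc j))" using P by (auto simp: not_le)
  qed
  then have P: "?t = ?B * s2 bQ 0 + s2 bC 0" "s2 bC 0 < ?B \<or> s bX 0 \<le> s2 bQ 0"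
    by (auto simp: s1_def)
  have lt: "s2 bC 0 < ?B"
  proof (rule ccontr)
    assume n: "\<not> ?thesis"
    then have "?t \<le> s2 bQ 0" using P X by auto
    also have "\<dots> \<le> ?B * s2 bQ 0" using B by (cases ?B) auto
    finally show False using P(1) n B by linarith
  qed
  have Tq: "sem DIVMOD s bTAU 0 = s2 bQ 0" "sem DIVMOD s bC 0 = s2 bC 0"
    unfolding DIVMOD_def by (simp_all add: s2_def s1_def del: sem.simps(4,5))
  have "?t div ?B = s2 bQ 0" "?t mod ?B = s2 bC 0"
    using lt unfolding P(1) by auto
  then show "sem DIVMOD s bTAU 0 = ?t div ?B" "sem DIVMOD s bC 0 = ?t mod ?B"
    unfolding Tq by simp_all
qed

context instance_params
begin

definition wset :: "memory \<Rightarrow> nat set" where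
  "wset s = {x. x < n \<and> s bW x \<noteq> 0}"

lemma SCAN_loop:
  assumes c: "ctx s" and W: "\<And>x. x < n \<Longrightarrow> s bW x \<le> 1"
    and z: "\<And>x. x < n \<Longrightarrow> s bCNT x = 0" "s bSE 0 = 0" and C: "s bC 0 = Suc c"
  shows "if \<exists>e. elig (s bFX) (wset s) e \<and> rank (s bFX) (wset s) e = c
    then \<exists>e. elig (s bFX) (wset s) e \<and> rank (s bFX) (wset s) e = c \<and> sem (LFor 53 bm SCAN) s bSE 0 = Suc e
    else sem (LFor 53 bm SCAN) s bSE 0 = 0"
proof -
  let ?F = "s bFX" and ?W = "wset s"
  let ?P = "\<lambda>e t. (\<forall>x<n. t bCNT x = min M (card (crossing_before ?F ?W x e))) \<and>
      t bC 0 = Suc c - rank ?F ?W e \<and>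
      (if c < rank ?F ?W e then \<exists>f<e. elig ?F ?W f \<and> rank ?F ?W f = c \<and> t bSE 0 = Suc f else t bSE 0 = 0)"
  have bm: "s bm 0 = m" using c by (simp add: ctx_def)
  have P0: "?P (s bm 0) (sem (LFor 53 bm SCAN) s)"
  proof (rule sem_For_inv[where P = ?P])
    show "?P 0 (upd s 53 0 0)" using z C by (simp add: crossing_before_def rank_def)
  next
    fix e t assume e: "e < s bm 0" and P: "?P e t" and te: "t 53 0 = e"
      and fr: "\<And>b. b \<notin> insert 53 (writes SCAN) \<Longrightarrow> t b = s b"
    have em: "e < m" using e c by (simp add: ctx_def)
    have lt: "EU e < n" "EV e < n" using em EU_less EV_less by auto
    have tv: "t bEU = EU" "t bEV = EV" "t bFX = ?F" "t bW = s bW" "t bM 0 = M"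
      using fr c by (simp_all add: ctx_def)
    have W2: "s bW (EU e) \<le> 1" "s bW (EV e) \<le> 1" using W lt by auto
    have cr: "cross ?F ?W e \<longleftrightarrow> ?F e = 0 \<and> s bW (EU e) + s bW (EV e) = 1"
      using em lt W2 by (auto simp: cross_def wset_def)
    have innW: "(if s bW (EU e) \<noteq> 0 then EU e else EV e) = inn ?W e"
      using lt by (simp add: inn_def wset_def)
    let ?x = "inn ?W e"
    have xn: "?x < n" using lt by (simp add: inn_def)
    let ?k = "card (crossing_before ?F ?W ?x e)"
    have el: "elig ?F ?W e \<longleftrightarrow> cross ?F ?W e \<and> ?k < M" by (simp add: elig_def)
    have cnt: "t bCNT ?x = min M ?k" using P xn by simp
    show "?P (Suc e) (upd (sem SCAN t) 53 0 (Suc e))"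
    proof (cases "cross ?F ?W e")
      case False
      then have "sem SCAN t = t" using tv te cr unfolding SCAN_def by auto
      moreover have "\<not> elig ?F ?W e" using False el by simp
      ultimately show ?thesis using P False
        by (simp add: rank_Suc card_crossing_before_Suc) (auto simp: less_Suc_eq)
    next
      case cross: True
      let ?t1 = "upd t bCT 0 ?x"
      have S1: "sem SCAN t = (if Suc (t bCNT ?x) \<le> M
          then let u = upd ?t1 bCNT ?x (Suc (t bCNT ?x)); w = (if t bC 0 = 1 then upd u bSE 0 (Suc e) else u)
            in upd w bC 0 (w bC 0 - 1) else ?t1)"
        using cross tv te innW unfolding SCAN_def cr by (auto simp: Let_def split: if_splits)
      show ?thesis
      proof (cases "?k < M")
        case False
        then have "sem SCAN t = ?t1" using S1 cnt by simp
        moreover have "\<not> elig ?F ?W e" using False el by simp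
        ultimately show ?thesis using P False cross
          by (simp add: rank_Suc card_crossing_before_Suc) (auto simp: less_Suc_eq min_def)
      next
        case True
        then have ee: "elig ?F ?W e" using cross el by simp
        define w where "w = (if t bC 0 = 1 then upd (upd ?t1 bCNT ?x (Suc ?k)) bSE 0 (Suc e) else upd ?t1 bCNT ?x (Suc ?k))"
        have S2: "sem SCAN t = upd w bC 0 (w bC 0 - 1)"
          using S1 cnt True by (simp add: w_def Let_def)
        have wC: "w bC 0 = t bC 0" by (simp add: w_def)
        have wCNT: "w bCNT = (t bCNT)(?x := Suc ?k)" by (simp add: w_def fun_upd_def)
        have wSE: "w bSE 0 = (if t bC 0 = 1 then Suc e else t bSE 0)" by (simp add: w_def)
        have c1: "t bC 0 = Suc c - rank ?F ?W e" using P by simp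
        have SE: "if c < rank ?F ?W (Suc e) then \<exists>f<Suc e. elig ?F ?W f \<and> rank ?F ?W f = c \<and> w bSE 0 = Suc f
            else w bSE 0 = 0"
        proof (cases "rank ?F ?W e = c")
          case True
          then show ?thesis using ee c1 wSE by (auto simp: rank_Suc)
        next
          case False
          then have "w bSE 0 = t bSE 0" using wSE c1 by auto
          moreover have "c < rank ?F ?W (Suc e) \<longleftrightarrow> c < rank ?F ?W e" using False ee by (auto simp: rank_Suc)
          ultimately show ?thesis using P by (auto simp: less_Suc_eq)
        qed
        have CNT: "\<forall>x<n. w bCNT x = min M (card (crossing_before ?F ?W x (Suc e)))"
          using P True cross unfolding wCNT by (auto simp: card_crossing_before_Suc)
        show ?thesis unfolding S2 using SE CNT wC c1 ee by (simp add: rank_Suc)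
      qed
    qed
  qed
  have P1: "?P m (sem (LFor 53 bm SCAN) s)" using P0 unfolding bm .
  have P: "if c < rank ?F ?W m then \<exists>f<m. elig ?F ?W f \<and> rank ?F ?W f = c \<and> sem (LFor 53 bm SCAN) s bSE 0 = Suc f
      else sem (LFor 53 bm SCAN) s bSE 0 = 0" by (rule conjunct2[OF conjunct2[OF P1]])
  have "c < rank ?F ?W m" if "elig ?F ?W e" "rank ?F ?W e = c" for e
    using rank_less[OF that(1), of m] that by (simp add: elig_def cross_def)
  then show ?thesis using P by (auto split: if_splits)
qed

lemma GROW_STEP_correct:
  assumes c: "ctx s" and W: "\<And>x. x < n \<Longrightarrow> s bW x \<le> 1" and X: "s bTAU 0 \<le> s bX 0" and B: "1 \<le> B"
  shows "(sem GROW_STEP s bFX, wset (sem GROW_STEP s)) = nxt (s bTI 0) (s bTAU 0 mod B) (s bFX, wset s)"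
    "sem GROW_STEP s bTAU 0 = s bTAU 0 div B" "\<And>x. x < n \<Longrightarrow> sem GROW_STEP s bW x \<le> 1"
proof -
  have Bs: "s bB 0 = B" using c by (simp add: ctx_def)
  define s1 where "s1 = sem DIVMOD s"
  have fr1: "s1 b = s b" if "b \<notin> {bQ, bC, bTAU, 52}" for b
    unfolding s1_def by (rule sem_frame) (use that in simp)
  have t1: "s1 bTAU 0 = s bTAU 0 div B" "s1 bC 0 = s bTAU 0 mod B"
    using DIVMOD_correct[of s, OF X] B Bs by (simp_all add: s1_def)
  define s2 where "s2 = sem (LFor 50 bn (LStore bCNT (rd 50) (Const 0))) s1"
  have fr2: "s2 b = s1 b" if "b \<notin> {bCNT, 50}" for b
    unfolding s2_def by (rule sem_frame) (use that in simp)
  have "\<forall>x<s1 bn 0. s2 bCNT x = 0"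
    unfolding s2_def
    by (rule sem_For_inv[where P = "\<lambda>j t. \<forall>x<j. t bCNT x = 0"]) (auto simp: less_Suc_eq)
  then have z2: "\<And>x. x < n \<Longrightarrow> s2 bCNT x = 0" using fr1[of bn] c by (simp add: ctx_def)
  define s3 where "s3 = upd (upd s2 bC 0 (Suc (s2 bC 0))) bSE 0 0"
  have fr3: "s3 b = s b" if "b \<notin> {bQ, bC, bTAU, 52, bCNT, 50, bSE}" for b
    using that fr1 fr2 by (simp add: s3_def)
  have c3: "ctx s3" using c by (rule ctx_cong) (auto intro!: fr3)
  have W3: "wset s3 = wset s" "s3 bW = s bW" "s3 bFX = s bFX" using fr3 by (simp_all add: wset_def)
  define s4 where "s4 = sem (LFor 53 bm SCAN) s3"
  have fr4: "s4 b = s3 b" if "b \<notin> {53, bCT, bCNT, bSE, bC}" for b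
    unfolding s4_def by (rule sem_frame) (use that in simp)
  let ?c = "s bTAU 0 mod B"
  have C3: "s3 bC 0 = Suc ?c" using fr2 t1 by (simp add: s3_def)
  have z3: "\<And>x. x < n \<Longrightarrow> s3 bCNT x = 0" "s3 bSE 0 = 0" using z2 by (simp_all add: s3_def)
  have sc: "if \<exists>e. elig (s bFX) (wset s) e \<and> rank (s bFX) (wset s) e = ?c
    then \<exists>e. elig (s bFX) (wset s) e \<and> rank (s bFX) (wset s) e = ?c \<and> s4 bSE 0 = Suc e
    else s4 bSE 0 = 0"
    using SCAN_loop[OF c3 _ _ _ C3, unfolded W3, OF W z3] unfolding s4_def by simp
  have T: "sem GROW_STEP s = (if s4 bSE 0 \<noteq> 0 then let e = s4 bSE 0 - 1;
      u = upd (upd s4 bFX e (s4 bTI 0)) bW (s4 bEU e) 1 in upd u bW (u bEV e) 1 else s4)"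
    unfolding GROW_STEP_def
    by (simp add: s4_def s3_def s2_def s1_def Let_def del: sem.simps(5))
  have v4: "s4 bTI 0 = s bTI 0" "s4 bEU = EU" "s4 bEV = EV" "s4 bFX = s bFX" "s4 bW = s bW" "wset s4 = wset s"
    "s4 bTAU 0 = s bTAU 0 div B"
    using fr4 fr3 c t1 fr2 by (simp_all add: ctx_def wset_def s3_def)
  show "sem GROW_STEP s bTAU 0 = s bTAU 0 div B" unfolding T using v4 by (simp add: Let_def)
  show "sem GROW_STEP s bW x \<le> 1" if "x < n" for x unfolding T using v4 W that by (simp add: Let_def)
  show "(sem GROW_STEP s bFX, wset (sem GROW_STEP s)) = nxt (s bTI 0) ?c (s bFX, wset s)"
  proof (cases "\<exists>e. elig (s bFX) (wset s) e \<and> rank (s bFX) (wset s) e = ?c")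
    case True
    then obtain e where e: "elig (s bFX) (wset s) e" "rank (s bFX) (wset s) e = ?c" "s4 bSE 0 = Suc e"
      using sc by auto
    have "e < m" using e by (simp add: elig_def cross_def)
    then have "wset (sem GROW_STEP s) = wset s \<union> {EU e, EV e}"
      unfolding T using e v4 EU_less EV_less by (auto simp: Let_def wset_def)
    moreover have "sem GROW_STEP s bFX = (s bFX)(e := s bTI 0)"
      unfolding T using e v4 by (simp add: Let_def fun_upd_def)
    ultimately show ?thesis using nxt_elig[OF e(1,2)] by simp
  next
    case False
    then have "s4 bSE 0 = 0" using sc by auto
    then have "sem GROW_STEP s = s4" unfolding T by simp
    then show ?thesis using False v4 by (auto simp: nxt_def)
  qed
qed

lemma GROW_correct:
  assumes c: "ctx s" and X: "s bTAU 0 \<le> s bX 0" and B: "1 \<le> B"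
  shows "run (s bTI 0) N (s bTAU 0) (s bFX, {r}) =
    ((sem GROW s bFX, wset (sem GROW s)), sem GROW s bTAU 0)"
proof -
  define s1 where "s1 = sem (LFor 50 bn (LStore bW (rd 50) (Const 0))) s"
  have fr1: "s1 b = s b" if "b \<notin> {bW, 50}" for b
    unfolding s1_def by (rule sem_frame) (use that in simp)
  have "\<forall>x<s bn 0. s1 bW x = 0"
    unfolding s1_def
    by (rule sem_For_inv[where P = "\<lambda>j t. \<forall>x<j. t bW x = 0"]) (auto simp: less_Suc_eq)
  then have z1: "\<And>x. x < n \<Longrightarrow> s1 bW x = 0" using c by (simp add: ctx_def)
  define s2 where "s2 = upd s1 bW r 1"
  have fr2: "s2 b = s b" if "b \<notin> {bW, 50}" for b using fr1[OF that] that by (simp add: s2_def)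
  have c2: "ctx s2" using c by (rule ctx_cong) (auto intro!: fr2)
  have w2: "wset s2 = {r}" using z1 root by (auto simp: wset_def s2_def)
  have T: "sem GROW s = sem (LFor 51 bN GROW_STEP) s2"
    using c fr1[of br] unfolding GROW_def by (simp add: s2_def s1_def ctx_def del: sem.simps(5))
  \<comment> \<open>The invariant refers to the end result: the remaining \<open>N - j\<close> steps
    of \<open>run\<close> from the current state lead to the same outcome as all \<open>N\<close>
    steps from the start.\<close>
  let ?P = "\<lambda>j t. (\<forall>x<n. t bW x \<le> 1) \<and> t bTAU 0 \<le> s bX 0 \<and>
    run (s bTI 0) (N - j) (t bTAU 0) (t bFX, wset t) = run (s bTI 0) N (s bTAU 0) (s bFX, {r})"
  have "?P (s2 bN 0) (sem (LFor 51 bN GROW_STEP) s2)"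
  proof (rule sem_For_inv[where P = ?P])
    have "\<forall>x<n. s2 bW x \<le> 1" using z1 by (simp add: s2_def)
    then show "?P 0 (upd s2 51 0 0)" using w2 fr2 X by (simp add: wset_def)
  next
    fix j t assume j: "j < s2 bN 0" and P: "?P j t"
      and fr: "\<And>b. b \<notin> insert 51 (writes GROW_STEP) \<Longrightarrow> t b = s2 b"
    have ct: "ctx t" using c2 by (rule ctx_cong) (auto intro!: fr)
    have tv: "t bTI 0 = s bTI 0" "t bX 0 = s bX 0" using fr fr2 by simp_all
    have jN: "N - j = Suc (N - Suc j)" using j c2 by (simp add: ctx_def)
    have X': "t bTAU 0 \<le> t bX 0" using P tv by simp
    note G = GROW_STEP_correct[OF ct _ X' B]
    have G1: "(sem GROW_STEP t bFX, wset (sem GROW_STEP t)) = nxt (s bTI 0) (t bTAU 0 mod B) (t bFX, wset t)"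
      and G2: "sem GROW_STEP t bTAU 0 = t bTAU 0 div B" and G3: "\<forall>x<n. sem GROW_STEP t bW x \<le> 1"
      using G P tv by simp_all
    have "run (s bTI 0) (N - Suc j) (sem GROW_STEP t bTAU 0) (sem GROW_STEP t bFX, wset (sem GROW_STEP t)) =
        run (s bTI 0) N (s bTAU 0) (s bFX, {r})"
      unfolding G1 G2 using P unfolding jN by simp
    moreover have "sem GROW_STEP t bTAU 0 \<le> s bX 0"
      unfolding G2 by (rule le_trans[OF div_le_dividend]) (use P in blast)
    ultimately show "?P (Suc j) (upd (sem GROW_STEP t) 51 0 (Suc j))" using G3 by (simp add: wset_def)
  qed
  then have "?P N (sem GROW s)" unfolding T using c2 by (simp add: ctx_def del: sem.simps)
  then show ?thesis by simp
qed

end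

section \<open>Checking and printing the trees\<close>

definition AVOID :: lp where
  "AVOID = LFor 42 bm (LStore bXS (rd 42) (andE (eqE (Cell bST (rd 42)) (rd bTI))
     (andE (notE (eqE (Cell bEU (rd 42)) (rd 55))) (notE (eqE (Cell bEV (rd 42)) (rd 55))))))"

definition COUNT :: lp where
  "COUNT = assign bCT (Const 0) ;; LFor 56 bn
     (LWhen (andE (Cell bRE (rd 56)) (andE (notE (eqE (rd 56) (rd br))) (notE (eqE (rd 56) (rd 55)))))
       (assign bCT (Plus (rd bCT) (Const 1))))"

text \<open>The removed vertex counts towards safety, so the check fails if the count plus one is
  below \<open>k\<close>, written as count plus two at most \<open>k\<close>.\<close>

definition CHECK_VERTEX :: lp where
  "CHECK_VERTEX = LWhen (notE (eqE (rd 55) (rd br))) (AVOID ;; REACH ;; COUNT ;;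
     LWhen (leE (Plus (rd bCT) (Const 2)) (rd bK)) (assign bOK (Const 0)))"

definition CHECK_TREE :: lp where
  "CHECK_TREE = assign bSRC (rd br) ;; SELECT ;; REACH ;;
     LFor 54 bn (LWhen (notE (Cell bRE (rd 54))) (assign bOK (Const 0))) ;;
     LFor 55 bn CHECK_VERTEX"

definition OUT_EDGE :: lp where
  "OUT_EDGE = LWhen (eqE (Cell bST (rd 57)) (rd bTI))
     (LStore bOut (rd bQP) (Cell bEU (rd 57)) ;;
      LStore bOut (Plus (rd bQP) (Const 1)) (Cell bEV (rd 57)) ;;
      LStore bOut (Plus (rd bQP) (Const 2)) (Cell bEI (rd 57)) ;;
      assign bQP (Plus (rd bQP) (Const 3)) ;; assign bCT (Plus (rd bCT) (Const 1)))"

text \<open>The number of edges precedes them in the output but is known only afterwards;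
  \<open>bQS\<close> remembers the cell reserved for it.\<close>

definition OUT_TREE :: lp where
  "OUT_TREE = assign bQS (rd bQP) ;; assign bCT (Const 0) ;; assign bQP (Plus (rd bQP) (Const 1)) ;;
     LFor 57 bm OUT_EDGE ;; LStore bOut (rd bQS) (rd bCT)"

definition OUTPUT :: lp where
  "OUTPUT = LStore bOut (Const 1) (Const 1) ;; assign bQP (Const 2) ;;
     assign bTI (Const 1) ;; OUT_TREE ;; assign bTI (Const 2) ;; OUT_TREE ;;
     LStore bOut (Const 0) (Monus (rd bQP) (Const 1))"

lemma writes_AVOID [simp]: "writes AVOID = {bXS, 42}"
  unfolding AVOID_def writes.simps by blast

lemma writes_COUNT [simp]: "writes COUNT = {bCT, 56}"
  unfolding COUNT_def writes.simps by blast

lemma writes_CHECK_VERTEX [simp]: "writes CHECK_VERTEX = {bXS, 42, bRE, 40, 41, bCT, 56, bOK}"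
  unfolding CHECK_VERTEX_def writes.simps writes_AVOID writes_REACH writes_COUNT by blast

lemma writes_CHECK_TREE [simp]:
  "writes CHECK_TREE = {bXS, 42, bRE, 40, 41, bCT, 56, bOK, bSRC, 54, 55}"
  unfolding CHECK_TREE_def writes.simps writes_SELECT writes_REACH writes_CHECK_VERTEX by blast

lemma writes_OUT_EDGE [simp]: "writes OUT_EDGE = {bOut, bQP, bCT}"
  unfolding OUT_EDGE_def writes.simps by blast

lemma writes_OUT_TREE [simp]: "writes OUT_TREE = {bOut, bQP, bCT, bQS, 57}"
  unfolding OUT_TREE_def writes.simps writes_OUT_EDGE by blast

lemma writes_OUTPUT [simp]: "writes OUTPUT = {bOut, bQP, bCT, bQS, 57, bTI}"
  unfolding OUTPUT_def writes.simps writes_OUT_TREE by blast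

context instance_params
begin

lemma AVOID_correct:
  assumes c: "ctx s"
  shows "selected (sem AVOID s) = avoid (tr (s bST) (s bTI 0)) (s 55 0)"
proof -
  have "\<forall>e<s bm 0. sem AVOID s bXS e = (if s bST e = s bTI 0 \<and> s bEU e \<noteq> s 55 0 \<and> s bEV e \<noteq> s 55 0 then 1 else 0)"
    unfolding AVOID_def
  proof (rule sem_For_inv[where P = "\<lambda>j t. \<forall>e<j. t bXS e =
      (if s bST e = s bTI 0 \<and> s bEU e \<noteq> s 55 0 \<and> s bEV e \<noteq> s 55 0 then 1 else 0)"], goal_cases)
    case (2 j t)
    then show ?case using 2(4)[of bST] 2(4)[of bTI] 2(4)[of bEU] 2(4)[of bEV] 2(4)[of 55]
      by (auto simp: less_Suc_eq)
  qed simp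
  then show ?thesis
    using c by (auto simp: selected_def tr_def avoid_def ctx_def split: if_splits)
qed

lemma COUNT_correct:
  assumes c: "ctx s"
  shows "sem COUNT s bCT 0 = card {w. w < n \<and> s bRE w \<noteq> 0 \<and> w \<noteq> r \<and> w \<noteq> s 55 0}"
proof -
  let ?body = "LWhen (andE (Cell bRE (rd 56)) (andE (notE (eqE (rd 56) (rd br))) (notE (eqE (rd 56) (rd 55)))))
       (assign bCT (Plus (rd bCT) (Const 1)))"
  let ?A = "\<lambda>j. {w. w < j \<and> s bRE w \<noteq> 0 \<and> w \<noteq> r \<and> w \<noteq> s 55 0}"
  have bn: "s bn 0 = n" "s br 0 = r" using c by (simp_all add: ctx_def)
  have "(\<lambda>j t. t bCT 0 = card (?A j)) ((upd s bCT 0 0) bn 0) (sem (LFor 56 bn ?body) (upd s bCT 0 0))"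
  proof (rule sem_For_inv[where P = "\<lambda>j t. t bCT 0 = card (?A j)"], goal_cases)
    case 1
    then show ?case by simp
  next
    case (2 j t)
    have "?A (Suc j) = (if s bRE j \<noteq> 0 \<and> j \<noteq> r \<and> j \<noteq> s 55 0 then insert j (?A j) else ?A j)"
      by (auto simp: less_Suc_eq)
    then have "card (?A (Suc j)) = (if s bRE j \<noteq> 0 \<and> j \<noteq> r \<and> j \<noteq> s 55 0 then Suc (card (?A j)) else card (?A j))"
      by simp
    moreover have "t bRE = s bRE" "t br 0 = r" "t 55 0 = s 55 0" using 2(4) bn by simp_all
    ultimately show ?case using 2(2,3) by simp
  qed
  then have "sem (LFor 56 bn ?body) (upd s bCT 0 0) bCT 0 = card (?A n)" using bn by (simp del: sem.simps)
  moreover have "sem COUNT s = sem (LFor 56 bn ?body) (upd s bCT 0 0)"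
    unfolding COUNT_def by (simp del: sem.simps(4,5))
  ultimately show ?thesis by simp
qed

lemma CHECK_VERTEX_correct:
  assumes c: "ctx s" and v: "s 55 0 = v" and src: "s bSRC 0 = r"
  shows "sem CHECK_VERTEX s bOK 0 = (if v \<noteq> r \<longrightarrow>
    k \<le> Suc (card {w \<in> {..<n} - {r, v}. conn (avoid (tr (s bST) (s bTI 0)) v) r w}) then s bOK 0 else 0)"
proof (cases "v = r")
  case True
  then show ?thesis using c v unfolding CHECK_VERTEX_def by (simp add: ctx_def)
next
  case False
  define s1 where "s1 = sem AVOID s"
  have fr1: "s1 b = s b" if "b \<notin> {bXS, 42}" for b
    unfolding s1_def by (rule sem_frame) (use that in simp)
  have c1: "ctx s1" using c by (rule ctx_cong) (auto intro!: fr1)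
  define s2 where "s2 = sem REACH s1"
  have fr2: "s2 b = s1 b" if "b \<notin> {bRE, 40, 41}" for b
    unfolding s2_def by (rule sem_frame) (use that in simp)
  have c2: "ctx s2" using c1 by (rule ctx_cong) (auto intro!: fr2)
  let ?T = "avoid (tr (s bST) (s bTI 0)) v"
  have RE: "s2 bRE w \<noteq> 0 \<longleftrightarrow> conn ?T r w" if "w < n" for w
    using REACH_correct[OF c1 _ that] fr1 src root AVOID_correct[OF c] v by (simp add: s1_def s2_def)
  have "s2 55 0 = v" using fr1 fr2 v by simp
  then have "sem COUNT s2 bCT 0 = card {w. w < n \<and> s2 bRE w \<noteq> 0 \<and> w \<noteq> r \<and> w \<noteq> v}"
    using COUNT_correct[OF c2] by simp
  also have "{w. w < n \<and> s2 bRE w \<noteq> 0 \<and> w \<noteq> r \<and> w \<noteq> v} = {w \<in> {..<n} - {r, v}. conn ?T r w}"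
    using RE by auto
  finally have ct: "sem COUNT s2 bCT 0 = card {w \<in> {..<n} - {r, v}. conn ?T r w}" .
  have fr3: "sem COUNT s2 b = s b" if "b \<notin> {bXS, 42, bRE, 40, 41, bCT, 56}" for b
    using sem_frame[of b COUNT s2] fr1 fr2 that by simp
  have "sem CHECK_VERTEX s = (if sem COUNT s2 bCT 0 + 2 \<le> k then upd (sem COUNT s2) bOK 0 0 else sem COUNT s2)"
    using False c v fr3[of bK] unfolding CHECK_VERTEX_def by (simp add: s2_def s1_def ctx_def)
  then show ?thesis using False fr3[of bOK] unfolding ct by auto
qed

lemma CHECK_TREE_correct:
  assumes c: "ctx s" and T: "T = tr (s bST) (s bTI 0)" and nz: "s bOK 0 \<noteq> 0"
  shows "sem CHECK_TREE s bOK 0 \<noteq> 0 \<longleftrightarrow> (\<forall>v<n. conn T r v) \<and> safe_edges k T"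
proof -
  define s1 where "s1 = upd s bSRC 0 r"
  define s2 where "s2 = sem REACH (sem SELECT s1)"
  have fr2: "s2 b = s1 b" if "b \<notin> {bXS, 42, bRE, 40, 41}" for b
    using sem_frame[of b REACH "sem SELECT s1"] sem_frame[of b SELECT s1] that by (simp add: s2_def)
  have c1: "ctx s1" using c by (simp add: s1_def)
  have c1': "ctx (sem SELECT s1)" using c1 by (rule ctx_sem) simp
  have src: "sem SELECT s1 bSRC 0 = r" using sem_frame[of bSRC SELECT s1] by (simp add: s1_def)
  have RE: "s2 bRE w \<noteq> 0 \<longleftrightarrow> conn T r w" if "w < n" for w
    using REACH_correct[OF c1' _ that] src root SELECT_correct[OF c1] T by (simp add: s1_def s2_def)
  have c2: "ctx s2" using c1 by (rule ctx_cong) (auto intro!: fr2)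
  let ?b1 = "LWhen (notE (Cell bRE (rd 54))) (assign bOK (Const 0))"
  define s3 where "s3 = sem (LFor 54 bn ?b1) s2"
  have fr3: "s3 b = s2 b" if "b \<notin> {bOK, 54}" for b
    unfolding s3_def by (rule sem_frame) (use that in simp)
  have c3: "ctx s3" using c2 by (rule ctx_cong) (auto intro!: fr3)
  have n2: "s2 bn 0 = n" "s3 bn 0 = n" using c2 c3 by (simp_all add: ctx_def)
  have "(\<lambda>j t. t bOK 0 \<noteq> 0 \<longleftrightarrow> (\<forall>w<j. s2 bRE w \<noteq> 0)) (s2 bn 0) s3"
    unfolding s3_def
  proof (rule sem_For_inv[where P = "\<lambda>j t. t bOK 0 \<noteq> 0 \<longleftrightarrow> (\<forall>w<j. s2 bRE w \<noteq> 0)"], goal_cases)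
    case 1
    show ?case using nz fr2[of bOK] by (simp add: s1_def)
  next
    case (2 j t)
    then show ?case using 2(4)[of bRE] by (auto simp: less_Suc_eq)
  qed
  then have ok3: "s3 bOK 0 \<noteq> 0 \<longleftrightarrow> (\<forall>v<n. conn T r v)" using n2 RE by auto
  define s4 where "s4 = sem (LFor 55 bn CHECK_VERTEX) s3"
  let ?S = "\<lambda>v. v \<noteq> r \<longrightarrow> k \<le> Suc (card {w \<in> {..<n} - {r, v}. conn (avoid T v) r w})"
  have "(\<lambda>j t. t bOK 0 \<noteq> 0 \<longleftrightarrow> s3 bOK 0 \<noteq> 0 \<and> (\<forall>v<j. ?S v)) (s3 bn 0) s4"
    unfolding s4_def
  proof (rule sem_For_inv[where P = "\<lambda>j t. t bOK 0 \<noteq> 0 \<longleftrightarrow> s3 bOK 0 \<noteq> 0 \<and> (\<forall>v<j. ?S v)"], goal_cases)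
    case 1
    show ?case by simp
  next
    case (2 j t)
    have ct: "ctx t" using c3 by (rule ctx_cong) (auto intro!: 2(4))
    have "t bST = s bST" "t bTI 0 = s bTI 0" "t bSRC 0 = r" using 2(4) fr3 fr2 by (simp_all add: s1_def)
    then have "sem CHECK_VERTEX t bOK 0 = (if ?S j then t bOK 0 else 0)"
      using CHECK_VERTEX_correct[OF ct 2(3)] T by simp
    then show ?case using 2(2) by (auto simp: less_Suc_eq)
  qed
  then have "s4 bOK 0 \<noteq> 0 \<longleftrightarrow> (\<forall>v<n. conn T r v) \<and> (\<forall>v<n. ?S v)" using n2 ok3 by simp
  moreover have "(\<forall>v<n. ?S v) \<longleftrightarrow> safe_edges k T" by (auto simp: safe_edges_def)
  moreover have "sem CHECK_TREE s = s4"
    using c unfolding CHECK_TREE_def by (simp add: s4_def s3_def s2_def s1_def ctx_def del: sem.simps(4,5))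
  ultimately show ?thesis by simp
qed

section \<open>Output of the edge lists\<close>

definition triple :: "nat \<Rightarrow> nat \<times> nat \<times> nat" where
  "triple e = (EU e, EV e, EI e)"

definition edge_list :: "(nat \<Rightarrow> nat) \<Rightarrow> nat \<Rightarrow> nat \<Rightarrow> (nat \<times> nat \<times> nat) list" where
  "edge_list ST i j = map triple (filter (\<lambda>e. ST e = i) [0..<j])"

lemma edge_list_Suc: "edge_list ST i (Suc j) = edge_list ST i j @ (if ST j = i then [triple j] else [])"
  by (simp add: edge_list_def)

lemma OUT_TREE_correct:
  assumes c: "ctx s"
  defines "L \<equiv> edge_list (s bST) (s bTI 0) m" and "q \<equiv> s bQP 0"
  shows "sem OUT_TREE s bQP 0 = q + length (encode_edges L)"
    "map (sem OUT_TREE s bOut) [q..<q + length (encode_edges L)] = encode_edges L"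
    "a < q \<Longrightarrow> sem OUT_TREE s bOut a = s bOut a"
proof -
  let ?enc = "\<lambda>L. concat (map (\<lambda>(u, v, i). [u, v, i]) L)"
  define s1 where "s1 = upd (upd (upd s bQS 0 q) bCT 0 0) bQP 0 (Suc q)"
  define s2 where "s2 = sem (LFor 57 bm OUT_EDGE) s1"
  let ?P = "\<lambda>j t. let L = edge_list (s bST) (s bTI 0) j in t bCT 0 = length L \<and>
      t bQP 0 = Suc q + length (?enc L) \<and> map (t bOut) [Suc q..<Suc q + length (?enc L)] = ?enc L \<and>
      (\<forall>a\<le>q. t bOut a = s bOut a)"
  have m1: "s1 bm 0 = m" using c by (simp add: s1_def ctx_def)
  have "?P (s1 bm 0) s2"
    unfolding s2_def
  proof (rule sem_For_inv[where P = ?P])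
    show "?P 0 (upd s1 57 0 0)" by (simp add: s1_def edge_list_def Let_def)
  next
    fix j t assume P: "?P j t" and tj: "t 57 0 = j"
      and fr: "\<And>b. b \<notin> insert 57 (writes OUT_EDGE) \<Longrightarrow> t b = s1 b"
    have tv: "t bST = s bST" "t bTI 0 = s bTI 0" "t bEU = EU" "t bEV = EV" "t bEI = EI"
      using fr c by (simp_all add: s1_def ctx_def)
    show "?P (Suc j) (upd (sem OUT_EDGE t) 57 0 (Suc j))"
    proof (cases "s bST j = s bTI 0")
      case False
      then have "sem OUT_EDGE t = t" using tv tj unfolding OUT_EDGE_def by simp
      then show ?thesis using P False by (simp add: edge_list_Suc Let_def)
    next
      case True
      let ?L = "edge_list (s bST) (s bTI 0) j"
      define p where "p = Suc q + length (?enc ?L)"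
      have tp: "t bQP 0 = p" using P by (simp add: p_def Let_def)
      have S: "sem OUT_EDGE t bQP 0 = p + 3" "sem OUT_EDGE t bCT 0 = Suc (t bCT 0)"
        "sem OUT_EDGE t bOut a = (if a = p then EU j else if a = p + 1 then EV j else if a = p + 2 then EI j else t bOut a)" for a
        using True tv tj tp unfolding OUT_EDGE_def by auto
      have "map (sem OUT_EDGE t bOut) [Suc q..<p + 3] =
          map (sem OUT_EDGE t bOut) [Suc q..<p] @ map (sem OUT_EDGE t bOut) [p..<p + 3]"
        by (metis map_append upt_add_eq_append p_def le_add1)
      also have "map (sem OUT_EDGE t bOut) [Suc q..<p] = map (t bOut) [Suc q..<p]"
        by (rule map_cong) (auto simp: S simp del: One_nat_def)
      also have "\<dots> = ?enc ?L" using P by (simp add: p_def Let_def)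
      also have "map (sem OUT_EDGE t bOut) [p..<p + 3] = [EU j, EV j, EI j]"
        by (simp add: S upt_rec numeral_3_eq_3 del: One_nat_def)
      finally have 1: "map (sem OUT_EDGE t bOut) [Suc q..<p + 3] = ?enc ?L @ [EU j, EV j, EI j]" .
      have 2: "edge_list (s bST) (s bTI 0) (Suc j) = ?L @ [triple j]" using True by (simp add: edge_list_Suc)
      have 3: "?enc (?L @ [triple j]) = ?enc ?L @ [EU j, EV j, EI j]" by (simp add: triple_def)
      have 4: "Suc q + length (?enc (?L @ [triple j])) = p + 3" unfolding 3 by (simp add: p_def)
      have 5: "\<forall>a\<le>q. sem OUT_EDGE t bOut a = s bOut a" using P by (auto simp: S p_def Let_def simp del: One_nat_def)
      show ?thesis unfolding 2 Let_def 4 unfolding 3 using 1 5 S(1,2) P by (simp add: Let_def del: One_nat_def)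
    qed
  qed
  then have P: "?P m s2" using m1 by simp
  let ?l = "length (?enc L)"
  have PL: "s2 bCT 0 = length L" "s2 bQP 0 = Suc q + ?l" "map (s2 bOut) [Suc q..<Suc q + ?l] = ?enc L"
    "\<And>a. a \<le> q \<Longrightarrow> s2 bOut a = s bOut a"
    using P unfolding L_def Let_def by blast+
  have qs: "s2 bQS 0 = q"
    using sem_frame[of bQS "LFor 57 bm OUT_EDGE" s1] by (simp add: s2_def s1_def del: sem.simps)
  have T: "sem OUT_TREE s = upd s2 bOut q (length L)"
    using PL(1) qs unfolding OUT_TREE_def by (simp add: s2_def s1_def q_def del: sem.simps(4,5))
  have len: "length (encode_edges L) = Suc ?l" by (simp add: encode_edges_def)
  show "sem OUT_TREE s bQP 0 = q + length (encode_edges L)" unfolding T len using PL(2) by simp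
  have "map (sem OUT_TREE s bOut) [q..<q + Suc ?l] = sem OUT_TREE s bOut q # map (sem OUT_TREE s bOut) [Suc q..<q + Suc ?l]"
  proof -
    have "q < q + Suc ?l" by simp
    from upt_conv_Cons[OF this] show ?thesis by (simp only: list.map)
  qed
  also have "map (sem OUT_TREE s bOut) [Suc q..<q + Suc ?l] = map (s2 bOut) [Suc q..<q + Suc ?l]"
    unfolding T by (rule map_cong) auto
  also have "\<dots> = ?enc L" using PL(3) by simp
  finally have "map (sem OUT_TREE s bOut) [q..<q + Suc ?l] = sem OUT_TREE s bOut q # ?enc L" .
  moreover have "sem OUT_TREE s bOut q = length L" unfolding T by simp
  ultimately show "map (sem OUT_TREE s bOut) [q..<q + length (encode_edges L)] = encode_edges L"
    unfolding len unfolding encode_edges_def by (simp only:)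
  show "sem OUT_TREE s bOut a = s bOut a" if "a < q" unfolding T using PL(4) that by simp
qed

lemma OUTPUT_correct:
  assumes c: "ctx s"
  shows "output_of (sem OUTPUT s) =
    1 # encode_edges (edge_list (s bST) 1 m) @ encode_edges (edge_list (s bST) 2 m)"
proof -
  let ?E1 = "encode_edges (edge_list (s bST) 1 m)" and ?E2 = "encode_edges (edge_list (s bST) 2 m)"
  define s1 where "s1 = upd (upd (upd s bOut 1 1) bQP 0 2) bTI 0 1"
  have c1: "ctx s1" using c by (simp add: s1_def ctx_def)
  define s2 where "s2 = sem OUT_TREE s1"
  have fr2: "s2 b = s1 b" if "b \<notin> {bOut, bQP, bCT, bQS, 57}" for b
    unfolding s2_def by (rule sem_frame) (use that in simp)
  have c2: "ctx s2" using c1 by (rule ctx_cong) (auto intro!: fr2)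
  define s3 where "s3 = upd s2 bTI 0 2"
  have c3: "ctx s3" using c2 by (simp add: s3_def)
  define s4 where "s4 = sem OUT_TREE s3"
  have ST: "s3 bST = s bST" "s1 bST = s bST" using fr2 by (simp_all add: s3_def s1_def)
  note O1 = OUT_TREE_correct[OF c1] and O2 = OUT_TREE_correct[OF c3]
  let ?q = "2 + length ?E1"
  have q1: "s1 bQP 0 = 2" "s1 bTI 0 = 1" "s1 bOut 1 = 1" by (simp_all add: s1_def)
  note O1 = O1[folded s2_def, unfolded q1 ST]
  have q2: "s2 bQP 0 = ?q" by (rule O1(1))
  have E1: "map (s2 bOut) [2..<?q] = ?E1" by (rule O1(2))
  have o1: "s2 bOut 1 = 1" using O1(3)[of 1] q1(3) by simp
  have s3q: "s3 bQP 0 = ?q" "s3 bOut = s2 bOut" "s3 bTI 0 = 2" using q2 by (simp_all add: s3_def)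
  have q4: "s4 bQP 0 = ?q + length ?E2" and E2: "map (s4 bOut) [?q..<?q + length ?E2] = ?E2"
    and low: "\<And>a. a < ?q \<Longrightarrow> s4 bOut a = s2 bOut a"
    using O2[folded s4_def, unfolded s3q ST] by blast+
  have T: "sem OUTPUT s = upd s4 bOut 0 (s4 bQP 0 - 1)"
    unfolding OUTPUT_def by (simp add: s4_def s3_def s2_def s1_def)
  have "output_of (sem OUTPUT s) = map (upd s4 bOut 0 (s4 bQP 0 - 1) bOut) [1..<?q + length ?E2]"
    unfolding output_of_def T using q4 by simp
  also have "\<dots> = map (s4 bOut) [1..<?q + length ?E2]" by (rule map_cong) auto
  also have "[1..<?q + length ?E2] = 1 # [2..<?q] @ [?q..<?q + length ?E2]"
  proof -
    have "1 < ?q + length ?E2" by simp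
    note upt_conv_Cons[OF this, unfolded Suc_1]
    also have "[2..<?q + length ?E2] = [2..<?q] @ [?q..<?q + length ?E2]"
      by (rule upt_add_eq_append) simp
    finally show ?thesis .
  qed
  also have "map (s4 bOut) (1 # [2..<?q] @ [?q..<?q + length ?E2]) = 1 # ?E1 @ ?E2"
  proof -
    have "map (s4 bOut) [2..<?q] = map (s2 bOut) [2..<?q]" by (rule map_cong) (auto simp: low simp del: One_nat_def)
    moreover have "s4 bOut 1 = 1" using o1 low[of 1] by simp
    ultimately show ?thesis by (simp only: list.map map_append E1 E2)
  qed
  finally show ?thesis .
qed

end

section \<open>The search\<close>

text \<open>The second call of \<open>GROW\<close> continues with the digits that the first one left
  in \<open>bTAU\<close>, and the edges marked by the first call are no longer free for it.\<close>

definition TREES :: lp where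
  "TREES = LFor 59 bm (LStore bFX (rd 59) (Const 0)) ;; assign bTAU (rd 58) ;;
     assign bTI (Const 1) ;; GROW ;; assign bTI (Const 2) ;; GROW ;; UNION"

definition CHECK :: lp where
  "CHECK = assign bOK (Const 1) ;; assign bTI (Const 1) ;; CHECK_TREE ;;
     LWhen (rd bOK) (assign bTI (Const 2) ;; CHECK_TREE)"

definition TRY :: lp where
  "TRY = LWhen (notE (rd bDONE)) (TREES ;; CHECK ;; LWhen (rd bOK) (assign bDONE (Const 1) ;; OUTPUT))"

definition SEARCH :: lp where
  "SEARCH = LFor 58 bX TRY ;;
     LWhen (notE (rd bDONE)) (LStore bOut (Const 0) (Const 1) ;; LStore bOut (Const 1) (Const 0))"

lemma writes_TREES [simp]: "writes TREES = {59, bFX, bTAU, bTI, bQ, bC, 52, bCT, bCNT, bSE, 50, 53, bW, 51} \<union> writes UNION"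
  unfolding TREES_def writes.simps writes_GROW by blast

lemma writes_CHECK [simp]: "writes CHECK = insert bTI (writes CHECK_TREE)"
  unfolding CHECK_def writes.simps writes_CHECK_TREE by blast

lemma writes_TRY [simp]: "writes TRY = writes TREES \<union> writes CHECK \<union> insert bDONE (writes OUTPUT)"
  unfolding TRY_def writes.simps by blast

context instance_params
begin

text \<open>A condition on a guess that guarantees acceptance, so rejected guesses violate it. The
  converse may fail: unsafe cores can still be completed to trees that pass the check.\<close>

definition success :: "nat \<Rightarrow> bool" where
  "success \<tau> \<longleftrightarrow> (let ((FX1, W1), \<rho>) = run 1 N \<tau> (\<lambda>_. 0, {r}); ((FX2, W2), \<rho>2) = run 2 N \<rho> (FX1, {r})
     in extendable (tr FX2 1) (tr FX2 2) \<and> safe_edges k (tr FX2 1) \<and> safe_edges k (tr FX2 2))"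

definition good :: "(nat \<Rightarrow> nat) \<Rightarrow> bool" where
  "good ST \<longleftrightarrow> (\<forall>e<m. ST e \<le> 2) \<and> stree (tr ST 1) \<and> safe_edges k (tr ST 1) \<and> stree (tr ST 2) \<and> safe_edges k (tr ST 2)"

text \<open>No forest is larger than a spanning tree. If two forests together reach the size of two
  spanning trees, each has the full size and therefore spans.\<close>

lemma maxi_extendable_stree:
  assumes v: "valid ST FX" and mx: "maxi ST FX" and ex: "extendable (tr FX 1) (tr FX 2)"
  shows "stree (tr ST 1)" "stree (tr ST 2)"
proof -
  obtain S S' where S: "stree S" "stree S'" "S \<inter> S' = {}" "tr FX 1 \<subseteq> S" "tr FX 2 \<subseteq> S'"
    using ex unfolding extendable_def by blast
  have fo: "forest (tr ST 1)" "forest (tr ST 2)" using v by (auto simp: valid_def)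
  have sub: "tr ST i \<subseteq> {..<m}" for i by (auto simp: tr_def)
  have "card S + card S' \<le> card (tr ST 1) + card (tr ST 2)"
    using mx S unfolding maxi_def stree_def by blast
  moreover have "card (tr ST 1) \<le> card S" "card (tr ST 2) \<le> card S'"
    by (rule stree_card[OF S(1) fo(1) sub], rule stree_card[OF S(2) fo(2) sub])
  ultimately have "card S \<le> card (tr ST 1)" "card S' \<le> card (tr ST 2)" by auto
  then show "stree (tr ST 1)" "stree (tr ST 2)"
    using stree_if_card[OF S(1) fo(1) sub] stree_if_card[OF S(2) fo(2) sub] by blast+
qed

lemma grown_init:
  "grown 1 {} (\<lambda>_. 0) {r}"
  using rtree_base by (simp add: grown_def tr_def)

lemma grown_second:
  assumes "grown 1 {} FX1 W1" "tr FX1 2 = {}"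
  shows "grown 2 (tr FX1 1) FX1 {r}"
proof -
  have "rtree (tr FX1 2) {r}" using assms(2) rtree_base by simp
  moreover have "FX1 e \<noteq> 0 \<longleftrightarrow> FX1 e = 2 \<or> e \<in> tr FX1 1" "FX1 e \<noteq> 2" if "e < m" for e
    using assms that unfolding grown_def by (auto simp: tr_def)
  ultimately show ?thesis unfolding grown_def by (auto simp: tr_def)
qed

lemma TREES_correct:
  assumes c: "ctx s" and B: "1 \<le> B" and X: "s 58 0 \<le> s bX 0" and z: "\<And>e. m \<le> e \<Longrightarrow> s bFX e = 0"
  shows "m \<le> e \<Longrightarrow> sem TREES s bFX e = 0"
    and "valid (sem TREES s bST) (sem TREES s bFX)"
    and "success (s 58 0) \<Longrightarrow> good (sem TREES s bST)"
proof -
  define s1 where "s1 = sem (LFor 59 bm (LStore bFX (rd 59) (Const 0))) s"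
  have fr1: "s1 b = s b" if "b \<notin> {bFX, 59}" for b
    unfolding s1_def by (rule sem_frame) (use that in simp)
  have bm: "s bm 0 = m" using c by (simp add: ctx_def)
  have "(\<lambda>j t. \<forall>e. e < j \<or> m \<le> e \<longrightarrow> t bFX e = 0) (s bm 0) s1"
    unfolding s1_def
    by (rule sem_For_inv[where P = "\<lambda>j t. \<forall>e. e < j \<or> m \<le> e \<longrightarrow> t bFX e = 0"])
      (auto simp: z less_Suc_eq)
  \<comment> \<open>\<open>run\<close> acts on functions defined on all natural numbers, so the bank
    has to be 0 beyond \<open>m\<close> as well. The reset covers indices below \<open>m\<close>,
    the hypothesis the others.\<close>
  then have F1: "s1 bFX = (\<lambda>_. 0)" using bm by (auto simp: fun_eq_iff not_less[symmetric])
  define s2 where "s2 = upd (upd s1 bTAU 0 (s 58 0)) bTI 0 1"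
  have fr2: "s2 b = s b" if "b \<notin> {bFX, 59, bTAU, bTI}" for b using that fr1 by (simp add: s2_def)
  have c2: "ctx s2" using c by (rule ctx_cong) (auto intro!: fr2)
  have v2: "s2 bTAU 0 = s 58 0" "s2 bTI 0 = 1" "s2 bFX = (\<lambda>_. 0)" "s2 bX 0 = s bX 0"
    using F1 fr2 by (simp_all add: s2_def)
  have X2: "s2 bTAU 0 \<le> s2 bX 0" using X v2 by simp
  define s3 where "s3 = sem GROW s2"
  have fr3: "s3 b = s2 b" if "b \<notin> writes GROW" for b
    unfolding s3_def by (rule sem_frame[OF that])
  have run1: "run 1 N (s 58 0) (\<lambda>_. 0, {r}) = ((s3 bFX, wset s3), s3 bTAU 0)"
    using GROW_correct[OF c2 X2 B] unfolding s3_def v2 .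
  have c3: "ctx s3" using c2 by (rule ctx_cong) (auto intro!: fr3)
  \<comment> \<open>Division only shrinks the counter, so \<open>bX\<close> bounds the division
    loops of the second call too.\<close>
  have tau_le: "\<tau>' \<le> \<tau>" if "run i j \<tau> \<sigma> = (\<sigma>', \<tau>')" for i j \<tau> \<sigma> \<sigma>' \<tau>'
    using that
  proof (induction j arbitrary: \<tau> \<sigma>)
    case (Suc j)
    have "\<tau>' \<le> \<tau> div B" using Suc.IH Suc.prems by simp
    then show ?case using div_le_dividend[of \<tau> B] by linarith
  qed simp
  define s4 where "s4 = upd s3 bTI 0 2"
  have c4: "ctx s4" using c3 by (simp add: s4_def)
  have v4: "s4 bTI 0 = 2" "s4 bFX = s3 bFX" "s4 bTAU = s3 bTAU" by (simp_all add: s4_def)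
  have "s4 bX 0 = s bX 0" using fr3 v2 by (simp add: s4_def)
  then have X4: "s4 bTAU 0 \<le> s4 bX 0" using tau_le[OF run1] X v4 by simp
  define s5 where "s5 = sem GROW s4"
  have fr5: "s5 b = s4 b" if "b \<notin> writes GROW" for b
    unfolding s5_def by (rule sem_frame[OF that])
  have run2: "run 2 N (s3 bTAU 0) (s3 bFX, {r}) = ((s5 bFX, wset s5), s5 bTAU 0)"
    using GROW_correct[OF c4 X4 B] unfolding s5_def v4 .
  have c5: "ctx s5" using c4 by (rule ctx_cong) (auto intro!: fr5)
  have T: "sem TREES s = sem UNION s5"
    using fr1[of 58] unfolding TREES_def by (simp add: s5_def s4_def s3_def s2_def s1_def del: sem.simps(5))
  have g1: "grown 1 {} (s3 bFX) (wset s3)" "tr (s3 bFX) 2 = {}"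
    using run_grown[OF grown_init run1] by (auto simp: tr_def)
  have g2: "grown 2 (tr (s3 bFX) 1) (s5 bFX) (wset s5)" "tr (s5 bFX) 1 = tr (s3 bFX) 1"
    using run_grown[OF grown_second[OF g1] run2] by auto
  have fo: "forest (tr (s5 bFX) 1)" "forest (tr (s5 bFX) 2)"
    using rtree_props(9) g1 g2 unfolding grown_def by metis+
  have le2: "s5 bFX e \<le> 2" if e: "e < m" for e
  proof (cases "s5 bFX e = 0 \<or> s5 bFX e = 2")
    case False
    then have "e \<in> tr (s3 bFX) 1" using g2(1) e unfolding grown_def by blast
    then have "e \<in> tr (s5 bFX) 1" using g2(2) by simp
    then show ?thesis by (simp add: tr_def)
  qed auto
  have FXU: "sem UNION s5 bFX = s5 bFX" by (rule sem_frame) simp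
  note U = UNION_correct[OF c5 le2 fo]
  show "sem TREES s bFX e = 0" if "m \<le> e"
    unfolding T FXU using run_outside[OF run2 that] run_outside[OF run1 that] by simp
  show valid: "valid (sem TREES s bST) (sem TREES s bFX)" unfolding T FXU using U by simp
  show "good (sem TREES s bST)" if su: "success (s 58 0)"
  proof -
    have ex: "extendable (tr (s5 bFX) 1) (tr (s5 bFX) 2)" "safe_edges k (tr (s5 bFX) 1)" "safe_edges k (tr (s5 bFX) 2)"
      using su run1 run2 unfolding success_def by simp_all
    have v: "valid (sem UNION s5 bST) (s5 bFX)" and mx: "maxi (sem UNION s5 bST) (s5 bFX)" using U by blast+
    have sub: "tr (s5 bFX) i \<subseteq> tr (sem UNION s5 bST) i" if "i \<noteq> 0" for i
      using v that unfolding valid_def tr_def by auto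
    have "\<forall>e<m. sem UNION s5 bST e \<le> 2" using v unfolding valid_def by blast
    then show ?thesis
      unfolding T good_def
      using maxi_extendable_stree[OF v mx ex(1)] safe_edges_mono[OF ex(2) sub] safe_edges_mono[OF ex(3) sub]
      by simp
  qed
qed

lemma CHECK_correct:
  assumes c: "ctx s" and v: "valid (s bST) FX"
  shows "sem CHECK s bOK 0 \<noteq> 0 \<longleftrightarrow> good (s bST)"
proof -
  define s1 where "s1 = upd (upd s bOK 0 1) bTI 0 1"
  have c1: "ctx s1" using c by (simp add: s1_def)
  define s2 where "s2 = sem CHECK_TREE s1"
  have fr2: "s2 b = s1 b" if "b \<notin> writes CHECK_TREE" for b
    unfolding s2_def by (rule sem_frame[OF that])
  have c2: "ctx s2" using c1 by (rule ctx_cong) (auto intro!: fr2)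
  define s3 where "s3 = upd s2 bTI 0 2"
  have c3: "ctx s3" using c2 by (simp add: s3_def)
  have ST: "s1 bST = s bST" "s3 bST = s bST" using fr2 by (simp_all add: s3_def s1_def)
  have st: "(\<forall>u<n. conn (tr (s bST) i) r u) \<longleftrightarrow> stree (tr (s bST) i)" if "i = 1 \<or> i = 2" for i
    using v that by (auto simp: stree_def valid_def tr_def)
  have vals: "s1 bTI 0 = 1" "s1 bOK 0 = 1" "s3 bTI 0 = 2" "s3 bOK = s2 bOK" by (simp_all add: s1_def s3_def)
  have C1: "s2 bOK 0 \<noteq> 0 \<longleftrightarrow> stree (tr (s bST) 1) \<and> safe_edges k (tr (s bST) 1)"
    using CHECK_TREE_correct[OF c1 refl] vals ST st[of 1] unfolding s2_def by simp
  have T: "sem CHECK s = (if s2 bOK 0 \<noteq> 0 then sem CHECK_TREE s3 else s2)"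
    unfolding CHECK_def by (simp add: s3_def s2_def s1_def)
  have le2: "\<forall>e<m. s bST e \<le> 2" using v unfolding valid_def by blast
  show ?thesis
  proof (cases "s2 bOK 0 \<noteq> 0")
    case True
    then have "sem CHECK_TREE s3 bOK 0 \<noteq> 0 \<longleftrightarrow> stree (tr (s bST) 2) \<and> safe_edges k (tr (s bST) 2)"
      using CHECK_TREE_correct[OF c3 refl] vals ST st[of 2] by simp
    then show ?thesis using True C1 le2 unfolding T good_def by auto
  next
    case False
    then show ?thesis using C1 unfolding T good_def by auto
  qed
qed

definition solved :: "memory \<Rightarrow> bool" where
  "solved t \<longleftrightarrow> (\<exists>ST. good ST \<and> output_of t = 1 # encode_edges (edge_list ST 1 m) @ encode_edges (edge_list ST 2 m))"

lemma solved_cong: "t bOut = s bOut \<Longrightarrow> solved t \<longleftrightarrow> solved s"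
  by (simp add: solved_def output_of_def)

lemma TRY_correct:
  assumes c: "ctx s" and B: "1 \<le> B" and X: "s 58 0 \<le> s bX 0" and z: "\<And>e. m \<le> e \<Longrightarrow> s bFX e = 0"
    and nd: "s bDONE 0 = 0"
  shows "m \<le> e \<Longrightarrow> sem TRY s bFX e = 0"
    and "if sem TRY s bDONE 0 = 0 then \<not> success (s 58 0) else solved (sem TRY s)"
proof -
  define s1 where "s1 = sem TREES s"
  have fr1: "s1 b = s b" if "b \<notin> writes TREES" for b
    unfolding s1_def by (rule sem_frame[OF that])
  have c1: "ctx s1" using c by (rule ctx_cong) (auto intro!: fr1)
  note S1 = TREES_correct[OF c B X z, folded s1_def]
  define s2 where "s2 = sem CHECK s1"
  have fr2: "s2 b = s1 b" if "b \<notin> writes CHECK" for b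
    unfolding s2_def by (rule sem_frame[OF that])
  have c2: "ctx s2" using c1 by (rule ctx_cong) (auto intro!: fr2)
  have ok: "s2 bOK 0 \<noteq> 0 \<longleftrightarrow> good (s1 bST)"
    unfolding s2_def by (rule CHECK_correct[OF c1 S1(2)])
  have ST2: "s2 bST = s1 bST" and FX2: "s2 bFX = s1 bFX" and D2: "s2 bDONE 0 = 0" using fr2 fr1 nd by simp_all
  have T: "sem TRY s = (if s2 bOK 0 \<noteq> 0 then sem OUTPUT (upd s2 bDONE 0 1) else s2)"
    using nd unfolding TRY_def by (simp add: s2_def s1_def)
  let ?u = "upd s2 bDONE 0 1"
  have cu: "ctx ?u" using c2 by simp
  have "sem OUTPUT ?u bFX = s1 bFX" using sem_frame[of bFX OUTPUT ?u] FX2 by simp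
  then have "sem TRY s bFX = s1 bFX" unfolding T using FX2 by simp
  then show "m \<le> e \<Longrightarrow> sem TRY s bFX e = 0" using S1(1) by simp
  show "if sem TRY s bDONE 0 = 0 then \<not> success (s 58 0) else solved (sem TRY s)"
  proof (cases "s2 bOK 0 \<noteq> 0")
    case True
    then have "sem TRY s = sem OUTPUT ?u" using T by simp
    moreover have "sem OUTPUT ?u bDONE 0 = 1" using sem_frame[of bDONE OUTPUT ?u] by simp
    moreover have "solved (sem OUTPUT ?u)"
      unfolding solved_def using OUTPUT_correct[OF cu] ok True ST2 by auto
    ultimately show ?thesis by simp
  next
    case False
    then have "\<not> success (s 58 0)" using ok S1(3) by blast
    then show ?thesis using False D2 unfolding T by simp
  qed
qed

definition solvable :: bool where
  "solvable \<longleftrightarrow> (\<exists>S S'. stree S \<and> stree S' \<and> S \<inter> S' = {} \<and> safe_edges k S \<and> safe_edges k S')"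

lemma good_solvable: "good ST \<Longrightarrow> solvable"
proof -
  assume "good ST"
  moreover have "tr ST 1 \<inter> tr ST 2 = {}" by (auto simp: tr_def)
  ultimately show ?thesis unfolding good_def solvable_def by blast
qed

text \<open>The first core is grown towards \<open>F\<close>, with the core \<open>F'\<close> of the
  second tree as its companion. Then the finished first core becomes the companion and blocks its
  edges for the second run. Each run consumes \<open>N\<close> digits, so \<open>N + N\<close>
  digits encode both.\<close>

lemma solvable_success:
  assumes so: "solvable" and k: "1 \<le> k" and N: "k * k \<le> N" and M: "4 * N + 5 \<le> M" and Bb: "Suc N * M < B"
  shows "\<exists>\<tau><B ^ (N + N). success \<tau>"
proof -
  obtain S S' where S: "stree S" "stree S'" "S \<inter> S' = {}" "safe_edges k S" "safe_edges k S'"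
    using so unfolding solvable_def by blast
  obtain F W where F: "rtree F W" "F \<subseteq> S" "safe_edges k F" "card F \<le> k * k" using safe_core[OF S(1,4) k] by blast
  obtain F' W' where F': "rtree F' W'" "F' \<subseteq> S'" "safe_edges k F'" "card F' \<le> k * k" using safe_core[OF S(2,5) k] by blast
  have cN: "card F \<le> N" "card F' \<le> N" using F F' N by auto
  have ex: "extendable F F'" using S F F' unfolding extendable_def by blast
  have t0: "tr (\<lambda>_. 0) 1 = {}" by (simp add: tr_def)
  have s0: "tr (\<lambda>_. 0) 1 \<subseteq> F" using t0 by simp
  have n0: "card F \<le> card (tr (\<lambda>_. 0) 1) + N" using cN by simp
  obtain \<tau>1 FX1 W1 where r1: "\<tau>1 < B ^ N" "\<And>\<rho>. run 1 N (\<tau>1 + B ^ N * \<rho>) (\<lambda>_. 0, {r}) = ((FX1, W1), \<rho>)"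
    "safe_edges k (tr FX1 1)" "extendable (tr FX1 1) F'" "card (tr FX1 1) \<le> N"
    using run_complete[OF grown_init F(1) s0 F(3) ex _ cN n0 M Bb] by blast
  have g1: "grown 1 {} FX1 W1" "tr FX1 2 = {}"
    using run_grown[OF grown_init r1(2)[of 0]] by (auto simp: tr_def)
  have g2: "grown 2 (tr FX1 1) FX1 {r}" by (rule grown_second[OF g1])
  have s2: "tr FX1 2 \<subseteq> F'" using g1 by simp
  have n2: "card F' \<le> card (tr FX1 2) + N" using cN by simp
  obtain \<tau>2 FX2 W2 where r2: "\<tau>2 < B ^ N" "\<And>\<rho>. run 2 N (\<tau>2 + B ^ N * \<rho>) (FX1, {r}) = ((FX2, W2), \<rho>)"
    "safe_edges k (tr FX2 2)" "extendable (tr FX2 2) (tr FX1 1)"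
    using run_complete[OF g2 F'(1) s2 F'(3) extendable_commute[OF r1(4)] order_refl cN(2) r1(5) n2 M Bb] by blast
  have tr1: "tr FX2 1 = tr FX1 1" using run_grown[OF g2 r2(2)[of 0]] by simp
  let ?t = "\<tau>1 + B ^ N * \<tau>2"
  have a: "run 1 N ?t (\<lambda>_. 0, {r}) = ((FX1, W1), \<tau>2)" by (rule r1(2))
  have b: "run 2 N \<tau>2 (FX1, {r}) = ((FX2, W2), 0)" using r2(2)[of 0] by simp
  have "success ?t" unfolding success_def a using b r1(3) r2(3) extendable_commute[OF r2(4)] tr1 by simp
  moreover have "?t < B ^ (N + N)"
  proof -
    have "?t < B ^ N + B ^ N * \<tau>2" using r1 by simp
    also have "\<dots> = B ^ N * Suc \<tau>2" by simp
    also have "\<dots> \<le> B ^ N * B ^ N" using r2 by (intro mult_le_mono) auto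
    finally show ?thesis by (simp add: power_add)
  qed
  ultimately show ?thesis by blast
qed

text \<open>Whatever is printed as a solution has been checked, so acceptance is sound for any
  guess. If all guesses are rejected, none is successful, and by \<open>solvable_success\<close>
  there is no solution.\<close>

lemma SEARCH_correct:
  assumes c: "ctx s" and z: "\<And>e. m \<le> e \<Longrightarrow> s bFX e = 0" and nd: "s bDONE 0 = 0"
    and X: "s bX 0 = B ^ (N + N)" and k: "1 \<le> k" and N: "k * k \<le> N" and M: "4 * N + 5 \<le> M" and Bb: "Suc N * M < B"
  shows "if solvable then solved (sem SEARCH s) else output_of (sem SEARCH s) = [0]"
proof -
  have B: "1 \<le> B" using Bb by simp
  define s1 where "s1 = sem (LFor 58 bX TRY) s"
  let ?P = "\<lambda>j t. (\<forall>e\<ge>m. t bFX e = 0) \<and> (if t bDONE 0 = 0 then \<forall>\<tau><j. \<not> success \<tau> else solved t)"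
  have "?P (s bX 0) s1"
    unfolding s1_def
  proof (rule sem_For_inv[where P = ?P])
    show "?P 0 (upd s 58 0 0)" using z nd by simp
  next
    fix j t assume j: "j < s bX 0" and P: "?P j t" and tj: "t 58 0 = j"
      and fr: "\<And>b. b \<notin> insert 58 (writes TRY) \<Longrightarrow> t b = s b"
    have ct: "ctx t" using c by (rule ctx_cong) (auto intro!: fr)
    have X': "t 58 0 \<le> t bX 0" using fr[of bX] j tj by simp
    show "?P (Suc j) (upd (sem TRY t) 58 0 (Suc j))"
    proof (cases "t bDONE 0 = 0")
      case True
      have zt: "\<And>e. m \<le> e \<Longrightarrow> t bFX e = 0" using P by blast
      note R = TRY_correct[OF ct B X' zt True]
      have "solved (upd (sem TRY t) 58 0 (Suc j)) \<longleftrightarrow> solved (sem TRY t)" by (rule solved_cong) simp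
      then show ?thesis using R P True tj by (auto simp: less_Suc_eq)
    next
      case False
      then have "sem TRY t = t" unfolding TRY_def by simp
      moreover have "solved (upd t 58 0 (Suc j)) \<longleftrightarrow> solved t" by (rule solved_cong) simp
      ultimately show ?thesis using P False by simp
    qed
  qed
  then have P: "if s1 bDONE 0 = 0 then \<forall>\<tau><B ^ (N + N). \<not> success \<tau> else solved s1" using X by simp
  have T: "sem SEARCH s = (if s1 bDONE 0 = 0 then upd (upd s1 bOut 0 1) bOut 1 0 else s1)"
    unfolding SEARCH_def by (simp add: s1_def del: sem.simps(5))
  show ?thesis
  proof (cases "s1 bDONE 0 = 0")
    case True
    then have "\<not> solvable" using P solvable_success[OF _ k N M Bb] by auto
    then show ?thesis using True unfolding T by (simp add: output_of_def)
  next
    case False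
    then have "solved s1" using P by simp
    moreover from this have solvable unfolding solved_def using good_solvable by blast
    ultimately show ?thesis using False unfolding T by simp
  qed
qed

end

section \<open>Relation to spanning trees of multigraphs\<close>

lemma adj_image:
  fixes ends :: "'e \<Rightarrow> 'v set" and ends' :: "'f \<Rightarrow> 'v set"
  assumes "\<And>e. e \<in> X \<Longrightarrow> ends' (f e) = ends e"
  shows "edge_ends.adj ends' (f ` X) = edge_ends.adj ends X"
  using assms by (auto simp: edge_ends.adj_def)

text \<open>Connectivity sees edges only through their end sets, so even a renaming that identifies
  parallel edges preserves it. Injectivity enters for forests.\<close>

lemma conn_image:
  fixes ends :: "'e \<Rightarrow> 'v set" and ends' :: "'f \<Rightarrow> 'v set"
  assumes "\<And>e. e \<in> X \<Longrightarrow> ends' (f e) = ends e"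
  shows "edge_ends.conn ends' (f ` X) a b \<longleftrightarrow> edge_ends.conn ends X a b"
  unfolding edge_ends.conn_def by (subst adj_image[of X ends' f ends]) (simp_all add: assms)

lemma forest_image:
  fixes ends :: "'e \<Rightarrow> 'v set" and ends' :: "'f \<Rightarrow> 'v set"
  assumes "\<And>e. e \<in> X \<Longrightarrow> ends' (f e) = ends e" and inj: "inj_on f X"
  shows "edge_ends.forest ends' (f ` X) \<longleftrightarrow> edge_ends.forest ends X"
proof -
  have "edge_ends.conn ends' (f ` X - {f e}) a b \<longleftrightarrow> edge_ends.conn ends (X - {e}) a b" if "e \<in> X" for e a b
  proof -
    have "f ` X - {f e} = f ` (X - {e})" using that inj by (auto simp: inj_on_def)
    then show ?thesis using conn_image[of "X - {e}" ends' f ends] assms by simp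
  qed
  then show ?thesis using assms by (simp add: edge_ends.forest_def)
qed

context edge_ends
begin

text \<open>Simple paths as lists, needed to exhibit a witness of \<open>is_cycle\<close>.\<close>

definition spath :: "'e set \<Rightarrow> 'v list \<Rightarrow> 'e list \<Rightarrow> bool" where
  "spath X vs es \<longleftrightarrow> length vs = Suc (length es) \<and> distinct vs \<and> distinct es \<and> set es \<subseteq> X \<and>
     (\<forall>i<length es. ends (es ! i) = {vs ! i, vs ! Suc i})"

lemma conn_spath:
  assumes "conn X a b"
  shows "\<exists>vs es. spath X vs es \<and> hd vs = a \<and> last vs = b"
  using assms unfolding conn_def
proof (induction rule: rtrancl_induct)
  case base
  have "spath X [a] [] \<and> hd [a] = a \<and> last [a] = a" by (simp add: spath_def)
  then show ?case by blast
next
  case (step b c)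
  then obtain vs es where p: "length vs = Suc (length es)" "distinct vs" "distinct es" "set es \<subseteq> X"
    "\<And>i. i < length es \<Longrightarrow> ends (es ! i) = {vs ! i, vs ! Suc i}" "hd vs = a" "last vs = b"
    unfolding spath_def by blast
  obtain f where f: "f \<in> X" "ends f = {b, c}" using step(2) by (auto simp: adj_def)
  have ne: "vs \<noteq> []" using p(1) by auto
  have lastb: "vs ! length es = b" using p(1,7) ne by (simp add: last_conv_nth)
  show ?case
  proof (cases "c \<in> set vs")
    case True
    then obtain j where j: "j < length vs" "vs ! j = c" by (auto simp: in_set_conv_nth)
    let ?vs = "take (Suc j) vs" and ?es = "take j es"
    have "spath X ?vs ?es"
      unfolding spath_def using p(1-5) j set_take_subset[of j es] by auto
    moreover have "hd ?vs = a" using p(6) ne by (simp add: hd_take)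
    moreover have "last ?vs = c" using j ne by (simp add: last_conv_nth)
    ultimately show ?thesis by blast
  next
    case False
    have fe: "f \<notin> set es"
    proof
      assume "f \<in> set es"
      then obtain i where i: "i < length es" "es ! i = f" by (auto simp: in_set_conv_nth)
      then have "c \<in> {vs ! i, vs ! Suc i}" using p(5)[OF i(1)] f by auto
      then show False using False i p(1) by auto
    qed
    have "spath X (vs @ [c]) (es @ [f])"
      unfolding spath_def using p(1-4) False fe f p(5) lastb by (auto simp: nth_append less_Suc_eq)
    moreover have "hd (vs @ [c]) = a" "last (vs @ [c]) = c" using p(6) ne by simp_all
    ultimately show ?thesis by blast
  qed
qed

end

lemma adjacency_eq: "adjacency T = edge_ends.adj (ends T) (edges T)"
  by (simp add: adjacency_def edge_ends.adj_def)

text \<open>A cycle without its first edge still connects the ends of that edge. Conversely, an edge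
  that is not a bridge closes a simple path between its ends. These are distinct, so the cycle has
  length at least 2, with equality for parallel edges.\<close>

lemma forest_iff_acyclic:
  assumes T: "loopless_multigraph T"
  shows "edge_ends.forest (ends T) (edges T) \<longleftrightarrow> \<not> (\<exists>vs es. is_cycle T vs es)"
proof -
  interpret edge_ends "ends T" .
  show ?thesis
  proof (rule iffI; rule ccontr)
    assume fo: "forest (edges T)" and "\<not> \<not> (\<exists>vs es. is_cycle T vs es)"
    then obtain vs es where c: "2 \<le> length vs" "length es = length vs" "distinct es" "set es \<subseteq> edges T"
      "\<And>i. i < length vs \<Longrightarrow> ends T (es ! i) = {vs ! i, vs ! (Suc i mod length vs)}"
      unfolding is_cycle_def by blast
    let ?e = "es ! 0" and ?l = "length vs"
    let ?X = "edges T - {?e}"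
    have eX: "es ! i \<in> ?X" if "0 < i" "i < ?l" for i
    proof -
      have lt: "i < length es" "0 < length es" using that c(2) by linarith+
      have "es ! i \<noteq> es ! 0" using nth_eq_iff_index_eq[OF c(3) lt] that by simp
      moreover have "es ! i \<in> edges T" using c(4) nth_mem[of i es] that c(2) by auto
      ultimately show ?thesis by simp
    qed
    have path: "Suc i < ?l \<Longrightarrow> conn ?X (vs ! 1) (vs ! Suc i)" for i
    proof (induction i)
      case (Suc i)
      have "ends T (es ! Suc i) = {vs ! Suc i, vs ! Suc (Suc i)}" using c(5)[of "Suc i"] Suc.prems by simp
      then have "conn ?X (vs ! Suc i) (vs ! Suc (Suc i))"
        using conn_edge[OF eX[of "Suc i"]] Suc.prems by auto
      then show ?case using Suc.IH[OF Suc_lessD[OF Suc.prems]] conn_trans by blast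
    qed simp
    obtain l where l: "?l = Suc (Suc l)" using c(1) by (metis Suc_le_D numeral_2_eq_2 Suc_le_mono)
    have "conn ?X (vs ! 1) (vs ! Suc l)" using path[of l] l by simp
    moreover have "conn ?X (vs ! Suc l) (vs ! 0)"
      using conn_edge[OF eX[of "Suc l"]] c(5)[of "Suc l"] l by simp
    ultimately have "conn ?X (vs ! 1) (vs ! 0)" by (rule conn_trans)
    then have "conn ?X (vs ! 0) (vs ! 1)" by (rule conn_sym)
    moreover have "?e \<in> edges T" using c nth_mem[of 0 es] by (auto simp: l)
    moreover have "ends T ?e = {vs ! 0, vs ! 1}" using c(5)[of 0] l by simp
    ultimately show False using forestD[OF fo] by blast
  next
    assume ac: "\<not> (\<exists>vs es. is_cycle T vs es)" and "\<not> forest (edges T)"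
    then obtain e a b where e: "e \<in> edges T" "ends T e = {a, b}" "conn (edges T - {e}) a b"
      unfolding forest_def by blast
    have ab: "a \<noteq> b" using T e unfolding loopless_multigraph_def by auto
    obtain vs es where p: "spath (edges T - {e}) vs es" "hd vs = a" "last vs = b"
      using conn_spath[OF e(3)] by blast
    have q: "length vs = Suc (length es)" "distinct vs" "distinct es" "set es \<subseteq> edges T - {e}"
      "\<And>i. i < length es \<Longrightarrow> ends T (es ! i) = {vs ! i, vs ! Suc i}"
      using p(1) unfolding spath_def by blast+
    have ne: "vs \<noteq> []" using q(1) by auto
    have es: "es \<noteq> []"
    proof
      assume "es = []"
      then obtain v where "vs = [v]" using q(1) by (metis length_0_conv length_Suc_conv)
      then show False using p ab by simp
    qed
    have h: "vs ! 0 = a" "vs ! length es = b" using p ne q(1) by (simp_all add: hd_conv_nth last_conv_nth)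
    have VT: "ends T f \<subseteq> verts T" if "f \<in> edges T" for f using T that by (auto simp: loopless_multigraph_def)
    have "set vs \<subseteq> verts T"
    proof
      fix v assume "v \<in> set vs"
      then obtain i where i: "i < length vs" "vs ! i = v" by (auto simp: in_set_conv_nth)
      show "v \<in> verts T"
      proof (cases "i < length es")
        case True
        then have "es ! i \<in> edges T" using q(4) nth_mem by blast
        then show ?thesis using VT[of "es ! i"] q(5)[OF True] i by auto
      next
        case False
        then have "v = b" using i q(1) h by (simp add: less_Suc_eq)
        then show ?thesis using VT[OF e(1)] e(2) by auto
      qed
    qed
    moreover have "ends T ((es @ [e]) ! i) = {vs ! i, vs ! (Suc i mod length vs)}" if "i < length vs" for i
    proof (cases "i < length es")
      case True
      then show ?thesis using q(1,5) by (simp add: nth_append)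
    next
      case False
      then have "i = length es" using that q(1) by simp
      then show ?thesis using h e q(1) by (simp add: insert_commute)
    qed
    ultimately have "is_cycle T vs (es @ [e])"
      unfolding is_cycle_def using q es e(1) by (auto simp: Suc_le_eq)
    then show False using ac by blast
  qed
qed

text \<open>\<open>cut_part\<close> keeps exactly the vertices other than \<open>v\<close> that the
  root no longer reaches. What it omits among the non-root vertices is \<open>v\<close> and the
  vertices still reached.\<close>

lemma card_safe_set:
  assumes fin: "finite (verts T)" and r: "r \<in> verts T" and v: "v \<in> verts T - {r}"
  shows "card ((verts T - {r}) - verts (cut_part T r v)) =
    Suc (card {w \<in> verts T - {r, v}. edge_ends.conn (ends T) {e \<in> edges T. v \<notin> ends T e} r w})"
proof -
  have "adjacency (del_verts T {v}) = edge_ends.adj (ends T) {e \<in> edges T. v \<notin> ends T e}"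
    by (simp add: adjacency_eq del_verts_def)
  then have "component_verts (del_verts T {v}) r =
      {w \<in> verts T - {v}. edge_ends.conn (ends T) {e \<in> edges T. v \<notin> ends T e} r w}"
    by (simp add: component_verts_def edge_ends.conn_def del_verts_def)
  then have "(verts T - {r}) - verts (cut_part T r v) =
      insert v {w \<in> verts T - {r, v}. edge_ends.conn (ends T) {e \<in> edges T. v \<notin> ends T e} r w}"
    using v by (auto simp: cut_part_def del_verts_def)
  then show ?thesis using fin by simp
qed

fun triple_ends :: "nat \<times> nat \<times> nat \<Rightarrow> nat set" where
  "triple_ends (u, v, i) = {u, v}"

definition tree_edges :: "nat \<Rightarrow> (nat \<Rightarrow> nat \<Rightarrow> nat) \<Rightarrow> nat \<Rightarrow> nat \<Rightarrow> (nat \<times> nat \<times> nat) set \<Rightarrow> bool" where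
  "tree_edges n \<mu> r k F \<longleftrightarrow> F \<subseteq> edges (mult_graph n \<mu>) \<and> edge_ends.forest triple_ends F \<and>
     (\<forall>v<n. edge_ends.conn triple_ends F r v) \<and>
     (\<forall>v\<in>{..<n} - {r}. k \<le> Suc (card {w \<in> {..<n} - {r, v}.
        edge_ends.conn triple_ends {e \<in> F. v \<notin> triple_ends e} r w}))"

text \<open>The record \<open>T\<close> may have arbitrary values of \<open>ends\<close> away from
  its edges, so it need not be a literal restriction of the graph. With vertices and ends fixed, all
  that remains is a condition on the edge set.\<close>

lemma safe_spanning_tree_iff:
  assumes r: "r < n"
  shows "spanning_tree T (mult_graph n \<mu>) \<and> safe r k T \<longleftrightarrow>
    verts T = {..<n} \<and> (\<forall>e\<in>edges T. ends T e = triple_ends e) \<and> tree_edges n \<mu> r k (edges T)"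
proof -
  have G: "verts (mult_graph n \<mu>) = {..<n}" "ends (mult_graph n \<mu>) = triple_ends"
    by (auto simp: mult_graph_def fun_eq_iff)
  have main: "spanning_tree T (mult_graph n \<mu>) \<and> safe r k T \<longleftrightarrow> tree_edges n \<mu> r k (edges T)"
    if V: "verts T = {..<n}" and en: "\<forall>e\<in>edges T. ends T e = triple_ends e"
  proof -
    have cc: "edge_ends.conn (ends T) X a b \<longleftrightarrow> edge_ends.conn triple_ends X a b"
      if "X \<subseteq> edges T" for X a b
    proof -
      have "triple_ends (id e) = ends T e" if "e \<in> X" for e
        using en that \<open>X \<subseteq> edges T\<close> by auto
      from conn_image[of X triple_ends id "ends T" a b, OF this] show ?thesis by simp
    qed
    have ff: "edge_ends.forest (ends T) (edges T) \<longleftrightarrow> edge_ends.forest triple_ends (edges T)"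
    proof -
      have "triple_ends (id e) = ends T e" if "e \<in> edges T" for e
        using en that by auto
      from forest_image[of "edges T" triple_ends id "ends T", OF this] show ?thesis by simp
    qed
    have av: "{e \<in> edges T. v \<notin> ends T e} = {e \<in> edges T. v \<notin> triple_ends e}" for v
      using en by auto
    have sub: "subgraph T (mult_graph n \<mu>) \<longleftrightarrow> edges T \<subseteq> edges (mult_graph n \<mu>)"
    proof
      show "edges T \<subseteq> edges (mult_graph n \<mu>)" if "subgraph T (mult_graph n \<mu>)"
        using that by (simp add: subgraph_def)
      assume s: "edges T \<subseteq> edges (mult_graph n \<mu>)"
      have L: "finite (edges (mult_graph n \<mu>))"
        "\<And>e. e \<in> edges (mult_graph n \<mu>) \<Longrightarrow> triple_ends e \<subseteq> {..<n} \<and> card (triple_ends e) = 2"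
        using loopless_mult_graph[of n \<mu>] G unfolding loopless_multigraph_def by auto
      have "ends T e \<subseteq> verts T \<and> card (ends T e) = 2" if "e \<in> edges T" for e
        using L(2)[OF subsetD[OF s that]] en that V by simp
      then have "loopless_multigraph T"
        unfolding loopless_multigraph_def using V finite_subset[OF s L(1)] by simp
      then show "subgraph T (mult_graph n \<mu>)"
        using V G en s unfolding subgraph_def by auto
    qed
    have conn_iff: "connected_graph T \<longleftrightarrow> (\<forall>v<n. edge_ends.conn triple_ends (edges T) r v)"
    proof -
      have comp: "component_verts T u = {v. v < n \<and> edge_ends.conn triple_ends (edges T) u v}" for u
        using cc[of "edges T" u] V by (auto simp: component_verts_def adjacency_eq edge_ends.conn_def)
      show ?thesis
      proof
        assume "connected_graph T"
        then show "\<forall>v<n. edge_ends.conn triple_ends (edges T) r v"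
          using r V comp unfolding connected_graph_def by auto
      next
        assume a: "\<forall>v<n. edge_ends.conn triple_ends (edges T) r v"
        have "edge_ends.conn triple_ends (edges T) u v" if "u < n" "v < n" for u v
          using a that edge_ends.conn_trans edge_ends.conn_sym by metis
        then show "connected_graph T" using r V comp unfolding connected_graph_def by auto
      qed
    qed
    have safe_iff: "safe r k T \<longleftrightarrow> (\<forall>v\<in>{..<n} - {r}. k \<le> Suc (card {w \<in> {..<n} - {r, v}.
        edge_ends.conn triple_ends {e \<in> edges T. v \<notin> triple_ends e} r w}))"
    proof -
      have "card ((verts T - {r}) - verts (cut_part T r v)) = Suc (card {w \<in> {..<n} - {r, v}.
          edge_ends.conn triple_ends {e \<in> edges T. v \<notin> triple_ends e} r w})" if v: "v \<in> {..<n} - {r}" for v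
      proof -
        have "edge_ends.conn (ends T) {e \<in> edges T. v \<notin> ends T e} r w \<longleftrightarrow>
            edge_ends.conn triple_ends {e \<in> edges T. v \<notin> triple_ends e} r w" for w
          unfolding av by (rule cc) auto
        then show ?thesis using card_safe_set[of T r v] V r v by simp
      qed
      then show ?thesis using V unfolding safe_def by simp
    qed
    have ac: "subgraph T (mult_graph n \<mu>) \<Longrightarrow>
        edge_ends.forest triple_ends (edges T) \<longleftrightarrow> \<not> (\<exists>vs es. is_cycle T vs es)"
      using forest_iff_acyclic[of T] ff by (simp add: subgraph_def)
    have ll: "subgraph T (mult_graph n \<mu>) \<Longrightarrow> loopless_multigraph T" by (simp add: subgraph_def)
    show ?thesis
      using ac ll sub conn_iff safe_iff V G unfolding spanning_tree_def tree_def tree_edges_def by blast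
  qed
  show ?thesis
  proof
    assume a: "spanning_tree T (mult_graph n \<mu>) \<and> safe r k T"
    then have "verts T = {..<n}" "\<forall>e\<in>edges T. ends T e = triple_ends e"
      using G unfolding spanning_tree_def subgraph_def by auto
    then show "verts T = {..<n} \<and> (\<forall>e\<in>edges T. ends T e = triple_ends e) \<and> tree_edges n \<mu> r k (edges T)"
      using main a by blast
  next
    assume "verts T = {..<n} \<and> (\<forall>e\<in>edges T. ends T e = triple_ends e) \<and> tree_edges n \<mu> r k (edges T)"
    then show "spanning_tree T (mult_graph n \<mu>) \<and> safe r k T" using main by blast
  qed
qed

text \<open>Two parallel copies suffice: a tree never uses two of them.\<close>

definition elist_cell :: "(nat \<Rightarrow> nat \<Rightarrow> nat) \<Rightarrow> nat \<Rightarrow> nat \<Rightarrow> (nat \<times> nat \<times> nat) list" where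
  "elist_cell \<mu> u v = (if u < v then (if 1 \<le> \<mu> u v then [(u, v, 0)] else []) @
     (if 2 \<le> \<mu> u v then [(u, v, 1)] else []) else [])"

definition elist :: "nat \<Rightarrow> (nat \<Rightarrow> nat \<Rightarrow> nat) \<Rightarrow> (nat \<times> nat \<times> nat) list" where
  "elist n \<mu> = concat (map (\<lambda>u. concat (map (elist_cell \<mu> u) [0..<n])) [0..<n])"

lemma set_elist_cell: "set (elist_cell \<mu> u v) = {(u', v', i). u' = u \<and> v' = v \<and> u < v \<and> i < \<mu> u v \<and> i < 2}"
  by (auto simp: elist_cell_def less_2_cases_iff)

lemma set_elist: "set (elist n \<mu>) = {(u, v, i). u < v \<and> v < n \<and> i < \<mu> u v \<and> i < 2}"
  by (auto simp: elist_def set_elist_cell)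

lemma distinct_concat_map:
  assumes "distinct xs" "\<And>x. x \<in> set xs \<Longrightarrow> distinct (f x)"
    and "\<And>x y. x \<in> set xs \<Longrightarrow> y \<in> set xs \<Longrightarrow> x \<noteq> y \<Longrightarrow> set (f x) \<inter> set (f y) = {}"
  shows "distinct (concat (map f xs))"
  using assms
proof (induction xs)
  case (Cons a xs)
  have "set (f a) \<inter> set (concat (map f xs)) = {}"
    using Cons.prems(1) Cons.prems(3)[of a] by fastforce
  moreover have "distinct (concat (map f xs))" using Cons by simp
  ultimately show ?case using Cons.prems(2)[of a] by simp
qed simp

lemma distinct_elist: "distinct (elist n \<mu>)"
  unfolding elist_def
proof (rule distinct_concat_map)
  show "distinct (concat (map (elist_cell \<mu> u) [0..<n]))" for u
    by (rule distinct_concat_map) (auto simp: elist_cell_def set_elist_cell)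
qed (auto simp: set_elist_cell)

locale encoded_instance =
  fixes k n r :: nat and \<mu> :: "nat \<Rightarrow> nat \<Rightarrow> nat" and N M B :: nat and EU EV EI :: "nat \<Rightarrow> nat"
  assumes root_less: "r < n"
    and triples: "\<And>j. j < length (elist n \<mu>) \<Longrightarrow> (EU j, EV j, EI j) = elist n \<mu> ! j"
begin

lemma in_elist: "j < length (elist n \<mu>) \<Longrightarrow> EU j < EV j \<and> EV j < n \<and> EI j < \<mu> (EU j) (EV j) \<and> EI j < 2"
  using nth_mem[of j "elist n \<mu>"] triples[of j, symmetric] by (auto simp: set_elist)

lemma triple_inj: "inj_on (\<lambda>j. (EU j, EV j, EI j)) {..<length (elist n \<mu>)}"
  unfolding inj_on_def using triples nth_eq_iff_index_eq[OF distinct_elist[of n \<mu>]] by simp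

sublocale instance_params k n "length (elist n \<mu>)" r N M B EU EV EI
proof
  fix a b
  let ?A = "{e. e < length (elist n \<mu>) \<and> {EU e, EV e} = {a, b}}"
  have "inj_on (\<lambda>j. (EU j, EV j, EI j)) ?A" by (rule inj_on_subset[OF triple_inj]) auto
  then have "card ?A = card ((\<lambda>j. (EU j, EV j, EI j)) ` ?A)" by (rule card_image[symmetric])
  also have "\<dots> \<le> card {(min a b, max a b, 0 :: nat), (min a b, max a b, 1)}"
  proof (rule card_mono)
    show "(\<lambda>j. (EU j, EV j, EI j)) ` ?A \<subseteq> {(min a b, max a b, 0 :: nat), (min a b, max a b, 1)}"
    proof
      fix x assume "x \<in> (\<lambda>j. (EU j, EV j, EI j)) ` ?A"
      then obtain j where j: "j < length (elist n \<mu>)" "{EU j, EV j} = {a, b}" "x = (EU j, EV j, EI j)" by blast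
      have lt: "EU j < EV j" "EI j < 2" using in_elist[OF j(1)] by auto
      then have "EU j = min a b" "EV j = max a b" using j(2) by (auto simp: doubleton_eq_iff min_def max_def)
      then show "x \<in> {(min a b, max a b, 0), (min a b, max a b, 1)}" using lt j(3) by (auto simp: less_2_cases_iff)
    qed
  qed simp
  also have "\<dots> \<le> 2" by (simp add: card_insert_if)
  finally show "card ?A \<le> 2" .
next
  show "EU e < n" if "e < length (elist n \<mu>)" for e using in_elist[OF that] by linarith
  show "EU e \<noteq> EV e" if "e < length (elist n \<mu>)" for e using in_elist[OF that] by linarith
qed (use root_less in_elist in auto)

abbreviation "mm \<equiv> length (elist n \<mu>)"

lemma triple_ends_triple: "triple_ends (triple j) = {EU j, EV j}"
  by (simp add: triple_def)

lemma inj_triple: "J \<subseteq> {..<mm} \<Longrightarrow> inj_on triple J"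
  using inj_on_subset[OF triple_inj] by (simp add: triple_def[abs_def])

lemma triple_image_edges: "J \<subseteq> {..<mm} \<Longrightarrow> triple ` J \<subseteq> edges (mult_graph n \<mu>)"
  using in_elist by (force simp: triple_def mult_graph_def)

text \<open>\<open>f\<close> must preserve end sets and be injective on \<open>X\<close>, but it may
  exchange a copy of an edge for a parallel one. This moves trees of the full multigraph into the
  truncated edge list.\<close>

lemma stree_image:
  assumes ends: "\<And>e. e \<in> X \<Longrightarrow> {EU (f e), EV (f e)} = triple_ends e" and inj: "inj_on f X"
    and sub: "f ` X \<subseteq> {..<mm}" and X: "X \<subseteq> edges (mult_graph n \<mu>)"
  shows "tree_edges n \<mu> r k X \<longleftrightarrow> stree (f ` X) \<and> safe_edges k (f ` X)"
proof -
  have cc: "conn (f ` Y) a b \<longleftrightarrow> edge_ends.conn triple_ends Y a b" if "Y \<subseteq> X" for Y a b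
    using that ends by (intro conn_image) blast
  have ff: "forest (f ` X) \<longleftrightarrow> edge_ends.forest triple_ends X"
    using ends inj by (intro forest_image) auto
  have av: "avoid (f ` X) v = f ` {e \<in> X. v \<notin> triple_ends e}" for v
  proof -
    have "v \<in> {EU (f e), EV (f e)} \<longleftrightarrow> v \<in> triple_ends e" if "e \<in> X" for e using ends[OF that] by (simp only:)
    then show ?thesis unfolding avoid_def by blast
  qed
  have "conn (avoid (f ` X) v) r w \<longleftrightarrow> edge_ends.conn triple_ends {e \<in> X. v \<notin> triple_ends e} r w" for v w
    unfolding av by (rule cc) auto
  then show ?thesis
    using cc[of X] ff sub X unfolding tree_edges_def stree_def safe_edges_def by auto
qed

lemma tree_edges_triple:
  assumes J: "J \<subseteq> {..<mm}"
  shows "tree_edges n \<mu> r k (triple ` J) \<longleftrightarrow> stree J \<and> safe_edges k J"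
proof -
  let ?f = "inv_into J triple"
  have inj: "inj_on triple J" by (rule inj_triple[OF J])
  have fj: "?f (triple j) = j" if "j \<in> J" for j using inv_into_f_f[OF inj that] .
  have img: "?f ` (triple ` J) = J" using fj by force
  have "tree_edges n \<mu> r k (triple ` J) \<longleftrightarrow> stree (?f ` triple ` J) \<and> safe_edges k (?f ` triple ` J)"
  proof (rule stree_image)
    show "{EU (?f e), EV (?f e)} = triple_ends e" if "e \<in> triple ` J" for e
      using that fj triple_ends_triple by auto
    show "inj_on ?f (triple ` J)" by (rule inj_on_inv_into) simp
    show "?f ` triple ` J \<subseteq> {..<mm}" using J unfolding img .
    show "triple ` J \<subseteq> edges (mult_graph n \<mu>)" by (rule triple_image_edges[OF J])
  qed
  then show ?thesis unfolding img .
qed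

lemma set_edge_list: "set (edge_list ST i mm) = triple ` tr ST i"
  by (auto simp: edge_list_def tr_def)

lemma good_output:
  assumes "good ST"
  shows "disjoint_safe_spanning_trees (mult_graph n \<mu>) r k
    ((mult_graph n \<mu>)\<lparr>edges := set (edge_list ST 1 mm)\<rparr>) ((mult_graph n \<mu>)\<lparr>edges := set (edge_list ST 2 mm)\<rparr>)"
proof -
  have sub: "tr ST i \<subseteq> {..<mm}" for i by (auto simp: tr_def)
  have t: "tree_edges n \<mu> r k (triple ` tr ST 1)" "tree_edges n \<mu> r k (triple ` tr ST 2)"
    using assms tree_edges_triple[OF sub] unfolding good_def by auto
  have sp: "spanning_tree ((mult_graph n \<mu>)\<lparr>edges := triple ` tr ST i\<rparr>) (mult_graph n \<mu>) \<and>
      safe r k ((mult_graph n \<mu>)\<lparr>edges := triple ` tr ST i\<rparr>)" if "tree_edges n \<mu> r k (triple ` tr ST i)" for i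
    using safe_spanning_tree_iff[OF root_less, of "(mult_graph n \<mu>)\<lparr>edges := triple ` tr ST i\<rparr>" \<mu> k] that
    by (auto simp: mult_graph_def)
  have "inj_on triple {..<mm}" by (rule inj_triple) simp
  then have "triple ` tr ST 1 \<inter> triple ` tr ST 2 = triple ` (tr ST 1 \<inter> tr ST 2)"
    using inj_on_image_Int[OF _ sub sub] by metis
  also have "tr ST 1 \<inter> tr ST 2 = {}" by (auto simp: tr_def)
  finally show ?thesis
    using sp[OF t(1)] sp[OF t(2)] unfolding disjoint_safe_spanning_trees_def set_edge_list by simp
qed

lemma forest_no_parallel:
  assumes F: "edge_ends.forest triple_ends F" and e: "(u, v, i) \<in> F" "(u, v, j) \<in> F"
  shows "i = j"
proof (rule ccontr)
  assume "i \<noteq> j"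
  then have "edge_ends.conn triple_ends (F - {(u, v, i)}) u v"
    using e by (intro edge_ends.conn_edge[of "(u, v, j)"]) auto
  then show False using edge_ends.forestD[OF F e(1)] by simp
qed

text \<open>\<open>F\<close> is moved to the copies numbered 0. \<open>F'\<close> takes copy 1 where
  \<open>F\<close> uses the same pair of vertices, and copy 0 elsewhere. If both use a pair, they
  use different copies of it, so its multiplicity is at least 2 and copy 1 is in the list. The maps
  are injective since a forest contains no two parallel edges.\<close>

lemma solvable_if_trees:
  assumes T: "tree_edges n \<mu> r k F" "tree_edges n \<mu> r k F'" and dis: "F \<inter> F' = {}"
  shows solvable
proof -
  have FE: "F \<subseteq> edges (mult_graph n \<mu>)" "F' \<subseteq> edges (mult_graph n \<mu>)"
    and fo: "edge_ends.forest triple_ends F" "edge_ends.forest triple_ends F'"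
    using T unfolding tree_edges_def by auto
  define c :: "nat \<Rightarrow> nat \<Rightarrow> nat" where "c u v = (if \<exists>i. (u, v, i) \<in> F then 1 else 0)" for u v
  have ex: "\<exists>j. j < mm \<and> triple j = x" if "x \<in> set (elist n \<mu>)" for x
    using that triples by (auto simp: in_set_conv_nth triple_def)
  then obtain idx where idx: "\<And>x. x \<in> set (elist n \<mu>) \<Longrightarrow> idx x < mm \<and> triple (idx x) = x" by metis
  define f where "f = (\<lambda>(u, v, i :: nat). idx (u, v, 0))"
  define f' where "f' = (\<lambda>(u, v, i :: nat). idx (u, v, c u v))"
  have m0: "(u, v, 0) \<in> set (elist n \<mu>)" if "(u, v, i) \<in> F" for u v i
    using that FE by (auto simp: set_elist mult_graph_def)
  have m1: "(u, v, c u v) \<in> set (elist n \<mu>)" if e: "(u, v, i) \<in> F'" for u v i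
  proof (cases "\<exists>j. (u, v, j) \<in> F")
    case True
    then obtain j where j: "(u, v, j) \<in> F" by blast
    then have "i \<noteq> j" using dis e by auto
    moreover have "i < \<mu> u v" "j < \<mu> u v" "u < v" "v < n" using j e FE by (auto simp: mult_graph_def)
    ultimately show ?thesis using True by (auto simp: set_elist c_def)
  next
    case False
    then show ?thesis using e FE by (auto simp: set_elist mult_graph_def c_def)
  qed
  have tf: "f e < mm \<and> triple (f e) = (fst e, fst (snd e), 0)" if "e \<in> F" for e
    using idx[OF m0] that by (cases e) (auto simp: f_def)
  have tf': "f' e < mm \<and> triple (f' e) = (fst e, fst (snd e), c (fst e) (fst (snd e)))" if "e \<in> F'" for e
    using idx[OF m1] that by (cases e) (auto simp: f'_def)
  have te: "{EU j, EV j} = {u, v}" if "triple j = (u, v, i)" for j u v i using that by (simp add: triple_def)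
  have inj: "inj_on f F"
  proof (rule inj_onI)
    fix e e' assume e: "e \<in> F" "e' \<in> F" "f e = f e'"
    obtain u v i u' v' i' where [simp]: "e = (u, v, i)" "e' = (u', v', i')" by (metis prod_cases3)
    have "u = u' \<and> v = v'" using tf[OF e(1)] tf[OF e(2)] e(3) by simp
    then show "e = e'" using forest_no_parallel[OF fo(1), of u v i i'] e by simp
  qed
  have inj': "inj_on f' F'"
  proof (rule inj_onI)
    fix e e' assume e: "e \<in> F'" "e' \<in> F'" "f' e = f' e'"
    obtain u v i u' v' i' where [simp]: "e = (u, v, i)" "e' = (u', v', i')" by (metis prod_cases3)
    have "u = u' \<and> v = v'" using tf'[OF e(1)] tf'[OF e(2)] e(3) by simp
    then show "e = e'" using forest_no_parallel[OF fo(2), of u v i i'] e by simp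
  qed
  have 1: "stree (f ` F) \<and> safe_edges k (f ` F)"
  proof -
    have "{EU (f e), EV (f e)} = triple_ends e" if "e \<in> F" for e
      using te[OF conjunct2[OF tf[OF that]]] by (cases e) simp
    moreover have "f ` F \<subseteq> {..<mm}" using tf by auto
    ultimately show ?thesis using stree_image[OF _ inj _ FE(1)] T(1) by blast
  qed
  have 2: "stree (f' ` F') \<and> safe_edges k (f' ` F')"
  proof -
    have "{EU (f' e), EV (f' e)} = triple_ends e" if "e \<in> F'" for e
      using te[OF conjunct2[OF tf'[OF that]]] by (cases e) simp
    moreover have "f' ` F' \<subseteq> {..<mm}" using tf' by auto
    ultimately show ?thesis using stree_image[OF _ inj' _ FE(2)] T(2) by blast
  qed
  have "f e \<noteq> f' e'" if e: "e \<in> F" "e' \<in> F'" for e e'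
  proof
    assume eq: "f e = f' e'"
    obtain u v i u' v' i' where [simp]: "e = (u, v, i)" "e' = (u', v', i')" by (metis prod_cases3)
    have "u = u'" "v = v'" "c u' v' = 0" using tf[OF e(1)] tf'[OF e(2)] eq by auto
    then have "c u v = 0" by (simp only:)
    then show False using e by (auto simp: c_def split: if_splits)
  qed
  then have "f ` F \<inter> f' ` F' = {}" by auto
  then show ?thesis using 1 2 unfolding solvable_def by blast
qed

lemma solvable_iff:
  assumes k: "1 \<le> k"
  shows "solvable \<longleftrightarrow> (k, n, r, \<mu>) \<in> yes_instances"
proof
  assume "(k, n, r, \<mu>) \<in> yes_instances"
  then obtain T1 T2 where "disjoint_safe_spanning_trees (mult_graph n \<mu>) r k T1 T2"
    unfolding yes_instances_def by blast
  then have T: "tree_edges n \<mu> r k (edges T1)" "tree_edges n \<mu> r k (edges T2)" "edges T1 \<inter> edges T2 = {}"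
    using safe_spanning_tree_iff[OF root_less] unfolding disjoint_safe_spanning_trees_def by blast+
  show solvable by (rule solvable_if_trees[OF T])
next
  assume solvable
  then obtain S S' where S: "stree S" "stree S'" "S \<inter> S' = {}" "safe_edges k S" "safe_edges k S'"
    unfolding solvable_def by blast
  define ST where "ST e = (if e \<in> S then 1 else if e \<in> S' then 2 else (0 :: nat))" for e
  have "tr ST 1 = S" "tr ST 2 = S'" using S unfolding ST_def tr_def stree_def by (auto split: if_splits)
  then have "good ST" using S unfolding good_def by (auto simp: ST_def)
  then show "(k, n, r, \<mu>) \<in> yes_instances"
    using good_output k root_less unfolding yes_instances_def instances_def by blast
qed

end

section \<open>Reading the input\<close>

definition PARAMS_INIT :: lp where
  "PARAMS_INIT = assign bK (Cell bIn (Const 1)) ;; assign bn (Cell bIn (Const 2)) ;;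
     assign br (Cell bIn (Const 3)) ;; assign bTWO (Const 2) ;; assign bN (Const 0)"

definition PARAMS_N :: lp where
  "PARAMS_N = LFor 50 bK (assign bN (Plus (rd bN) (rd bK))) ;;
     assign bM (Plus (Plus (Plus (rd bN) (rd bN)) (Plus (rd bN) (rd bN))) (Const 5)) ;; assign bB (Const 1)"

definition PARAMS_B :: lp where
  "PARAMS_B = LFor 50 bN (assign bB (Plus (rd bB) (rd bM))) ;; assign bB (Plus (rd bB) (rd bM)) ;;
     assign bL (Plus (rd bN) (rd bN)) ;; assign bX (Const 1)"

text \<open>A power without multiplication: each round of the outer loop multiplies
  \<open>bX\<close> by the content of \<open>bB\<close> through repeated addition.\<close>

definition PARAMS_X :: lp where
  "PARAMS_X = LFor 50 bL (assign bY (Const 0) ;; LFor 51 bB (assign bY (Plus (rd bY) (rd bX))) ;; assign bX (rd bY))"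

definition PUSH :: "nat \<Rightarrow> lp" where
  "PUSH i = LStore bEU (rd bm) (rd 50) ;; LStore bEV (rd bm) (rd 51) ;; LStore bEI (rd bm) (Const i) ;;
     assign bm (Plus (rd bm) (Const 1))"

text \<open>Only entries above the diagonal are used, and of each multiplicity only whether it
  reaches 1 and 2, so the time does not depend on the size of these numbers.\<close>

definition READ_CELL :: lp where
  "READ_CELL = LWhen (leE (Plus (rd 50) (Const 1)) (rd 51))
      (LWhen (Cell bIn (rd bQP)) (PUSH 0) ;; LWhen (leE (Const 2) (Cell bIn (rd bQP))) (PUSH 1)) ;;
     assign bQP (Plus (rd bQP) (Const 1))"

definition READ_EDGES :: lp where
  "READ_EDGES = assign bm (Const 0) ;; assign bQP (Const 4) ;; LFor 50 bn (LFor 51 bn READ_CELL) ;;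
     assign bR2 (Plus (rd bm) (rd bm))"

definition PARAMS :: lp where
  "PARAMS = PARAMS_INIT ;; PARAMS_N ;; PARAMS_B ;; PARAMS_X"

definition MAIN :: lp where
  "MAIN = PARAMS_INIT ;; PARAMS_N ;; PARAMS_B ;; PARAMS_X ;; READ_EDGES ;; SEARCH"

text \<open>\<open>par_N\<close> bounds the size of a core, \<open>par_M\<close> is the number of
  candidates that forces an exchange, \<open>par_B\<close> exceeds the number of choices in a step,
  and \<open>par_X\<close> counts the strings with \<open>par_N\<close> digits for each of the two
  trees.\<close>

definition par_N :: "nat \<Rightarrow> nat" where "par_N k = k * k"
definition par_M :: "nat \<Rightarrow> nat" where "par_M k = 4 * par_N k + 5"
definition par_B :: "nat \<Rightarrow> nat" where "par_B k = Suc (Suc (par_N k) * par_M k)"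
definition par_X :: "nat \<Rightarrow> nat" where "par_X k = par_B k ^ (par_N k + par_N k)"

lemma PARAMS_INIT_correct:
  "sem PARAMS_INIT s b = (if b = bK then (s bK)(0 := s bIn 1) else if b = bn then (s bn)(0 := s bIn 2)
     else if b = br then (s br)(0 := s bIn 3) else if b = bTWO then (s bTWO)(0 := 2)
     else if b = bN then (s bN)(0 := 0) else s b)"
  unfolding PARAMS_INIT_def by (simp add: fun_upd_def)

lemma PARAMS_N_correct:
  assumes "s bK 0 = k" "s bN 0 = 0"
  shows "sem PARAMS_N s bN 0 = par_N k" "sem PARAMS_N s bM 0 = par_M k" "sem PARAMS_N s bB 0 = 1"
proof -
  define s1 where "s1 = sem (LFor 50 bK (assign bN (Plus (rd bN) (rd bK)))) s"
  have "(\<lambda>j t. t bN 0 = j * k) (s bK 0) s1"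
    unfolding s1_def
    by (rule sem_For_inv[where P = "\<lambda>j t. t bN 0 = j * k"]) (use assms in auto)
  then have 1: "s1 bN 0 = par_N k" using assms by (simp add: par_N_def)
  have T: "sem PARAMS_N s = upd (upd s1 bM 0 (s1 bN 0 + s1 bN 0 + (s1 bN 0 + s1 bN 0) + 5)) bB 0 1"
    unfolding PARAMS_N_def by (simp add: s1_def del: sem.simps(5))
  show "sem PARAMS_N s bN 0 = par_N k" "sem PARAMS_N s bM 0 = par_M k" "sem PARAMS_N s bB 0 = 1"
    unfolding T using 1 by (simp_all add: par_M_def)
qed

lemma PARAMS_B_correct:
  assumes "s bN 0 = par_N k" "s bM 0 = par_M k" "s bB 0 = 1"
  shows "sem PARAMS_B s bB 0 = par_B k" "sem PARAMS_B s bL 0 = par_N k + par_N k" "sem PARAMS_B s bX 0 = 1"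
    "sem PARAMS_B s bN 0 = par_N k" "sem PARAMS_B s bM 0 = par_M k"
proof -
  define s1 where "s1 = sem (LFor 50 bN (assign bB (Plus (rd bB) (rd bM)))) s"
  have fr: "s1 b = s b" if "b \<notin> {bB, 50}" for b
    unfolding s1_def by (rule sem_frame) (use that in simp)
  have "(\<lambda>j t. t bB 0 = Suc (j * par_M k)) (s bN 0) s1"
    unfolding s1_def
    by (rule sem_For_inv[where P = "\<lambda>j t. t bB 0 = Suc (j * par_M k)"]) (use assms in auto)
  then have 1: "s1 bB 0 = Suc (par_N k * par_M k)" using assms by simp
  have T: "sem PARAMS_B s = upd (upd (upd s1 bB 0 (s1 bB 0 + s1 bM 0)) bL 0 (s1 bN 0 + s1 bN 0)) bX 0 1"
    unfolding PARAMS_B_def by (simp add: s1_def del: sem.simps(5))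
  have 2: "s1 bM = s bM" "s1 bN = s bN" using fr by simp_all
  show "sem PARAMS_B s bB 0 = par_B k" "sem PARAMS_B s bL 0 = par_N k + par_N k" "sem PARAMS_B s bX 0 = 1"
    "sem PARAMS_B s bN 0 = par_N k" "sem PARAMS_B s bM 0 = par_M k"
    unfolding T using 1 2 assms by (simp_all add: par_B_def)
qed

lemma sum_loop:
  assumes "z \<noteq> b" "z \<noteq> i" "x \<noteq> z" "x \<noteq> i" "b \<noteq> i" "s z 0 = 0"
  shows "sem (LFor i b (assign z (Plus (rd z) (rd x)))) s z 0 = s b 0 * s x 0"
proof -
  have "(\<lambda>j t. t z 0 = j * s x 0) (s b 0) (sem (LFor i b (assign z (Plus (rd z) (rd x)))) s)"
    by (rule sem_For_inv[where P = "\<lambda>j t. t z 0 = j * s x 0"]) (use assms in auto)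
  then show ?thesis .
qed

text \<open>Kept generic in the banks, as it serves both the number of guesses and the program
  \<open>BOUND\<close>.\<close>

lemma power_loop:
  assumes neq: "distinct [i, l, z, j, b, x]" and x: "s x 0 = c"
  shows "sem (LFor i l (assign z (Const 0) ;; LFor j b (assign z (Plus (rd z) (rd x))) ;; assign x (rd z))) s x 0 =
    c * s b 0 ^ s l 0"
proof -
  have ne: "x \<noteq> i" "b \<noteq> i" "b \<noteq> z" "x \<noteq> z" "x \<noteq> j" "b \<noteq> j" "z \<noteq> j" "z \<noteq> b" "z \<noteq> x" "i \<noteq> x" "z \<noteq> i" "b \<noteq> x"
    using neq by auto
  let ?in = "LFor j b (assign z (Plus (rd z) (rd x)))"
  let ?body = "assign z (Const 0) ;; ?in ;; assign x (rd z)"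
  have "(\<lambda>q t. t x 0 = c * s b 0 ^ q) (s l 0) (sem (LFor i l ?body) s)"
  proof (rule sem_For_inv[where P = "\<lambda>q t. t x 0 = c * s b 0 ^ q"])
    show "upd s i 0 0 x 0 = c * s b 0 ^ 0" using ne x by simp
  next
    fix q t assume P: "t x 0 = c * s b 0 ^ q" and fr: "\<And>d. d \<notin> insert i (writes ?body) \<Longrightarrow> t d = s d"
    have tb: "t b = s b" using fr[of b] ne by auto
    have "sem ?in (upd t z 0 0) z 0 = t b 0 * t x 0"
      using sum_loop[of z b j x "upd t z 0 0"] ne by auto
    then have "sem ?body t x 0 = c * s b 0 ^ Suc q"
      using P tb ne by (simp del: sem.simps(5))
    then show "upd (sem ?body t) i 0 (Suc q) x 0 = c * s b 0 ^ Suc q" using ne by simp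
  qed
  then show ?thesis .
qed

lemma PARAMS_X_correct:
  assumes "s bX 0 = 1" "s bL 0 = par_N k + par_N k" "s bB 0 = par_B k"
  shows "sem PARAMS_X s bX 0 = par_X k"
  unfolding PARAMS_X_def using power_loop[of 50 bL bY 51 bB bX s 1] assms by (simp add: par_X_def del: sem.simps)

lemma writes_PARAMS:
  "writes PARAMS_INIT = {bK, bn, br, bTWO, bN}" "writes PARAMS_N = {50, bN, bM, bB}"
  "writes PARAMS_B = {50, bB, bL, bX}" "writes PARAMS_X = {50, 51, bY, bX}"
  unfolding PARAMS_INIT_def PARAMS_N_def PARAMS_B_def PARAMS_X_def writes.simps by blast+

lemma PARAMS_correct:
  assumes "s bIn 1 = k"
  shows "sem PARAMS s bK 0 = k" "sem PARAMS s bn 0 = s bIn 2" "sem PARAMS s br 0 = s bIn 3"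
    "sem PARAMS s bTWO 0 = 2" "sem PARAMS s bN 0 = par_N k" "sem PARAMS s bM 0 = par_M k"
    "sem PARAMS s bB 0 = par_B k" "sem PARAMS s bX 0 = par_X k"
proof -
  define s1 where "s1 = sem PARAMS_INIT s"
  define s2 where "s2 = sem PARAMS_N s1"
  define s3 where "s3 = sem PARAMS_B s2"
  define s4 where "s4 = sem PARAMS_X s3"
  have T: "sem PARAMS s = s4" by (simp add: PARAMS_def s4_def s3_def s2_def s1_def)
  have v1: "s1 bK 0 = k" "s1 bn 0 = s bIn 2" "s1 br 0 = s bIn 3" "s1 bTWO 0 = 2" "s1 bN 0 = 0"
    unfolding s1_def PARAMS_INIT_correct using assms by simp_all
  have fr2: "s2 b = s1 b" if "b \<notin> {50, bN, bM, bB}" for b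
    unfolding s2_def by (rule sem_frame) (use that writes_PARAMS in simp)
  have fr3: "s3 b = s2 b" if "b \<notin> {50, bB, bL, bX}" for b
    unfolding s3_def by (rule sem_frame) (use that writes_PARAMS in simp)
  have fr4: "s4 b = s3 b" if "b \<notin> {50, 51, bY, bX}" for b
    unfolding s4_def by (rule sem_frame) (use that writes_PARAMS in simp)
  note v2 = PARAMS_N_correct[of s1 k, OF v1(1,5), folded s2_def]
  note v3 = PARAMS_B_correct[of s2 k, OF v2, folded s3_def]
  note v4 = PARAMS_X_correct[of s3 k, OF v3(3,2,1), folded s4_def]
  show "sem PARAMS s bK 0 = k" "sem PARAMS s bn 0 = s bIn 2" "sem PARAMS s br 0 = s bIn 3"
    "sem PARAMS s bTWO 0 = 2" "sem PARAMS s bN 0 = par_N k" "sem PARAMS s bM 0 = par_M k"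
    "sem PARAMS s bB 0 = par_B k" "sem PARAMS s bX 0 = par_X k"
    unfolding T using v1 v3 v4 fr2 fr3 fr4 by simp_all
qed

section \<open>Reading the truncated edge list\<close>

definition holds_list :: "memory \<Rightarrow> (nat \<times> nat \<times> nat) list \<Rightarrow> bool" where
  "holds_list t L \<longleftrightarrow> t bm 0 = length L \<and> (\<forall>j<length L. (t bEU j, t bEV j, t bEI j) = L ! j)"

lemma writes_PUSH [simp]: "writes (PUSH i) = {bEU, bEV, bEI, bm}"
  unfolding PUSH_def writes.simps by blast

lemma writes_READ_CELL [simp]: "writes READ_CELL = {bEU, bEV, bEI, bm, bQP}"
  unfolding READ_CELL_def writes.simps writes_PUSH by blast

lemma writes_READ_EDGES [simp]: "writes READ_EDGES = {bEU, bEV, bEI, bm, bQP, 50, 51, bR2}"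
  unfolding READ_EDGES_def writes.simps writes_READ_CELL by blast

lemma PUSH_correct:
  assumes "holds_list t L"
  shows "holds_list (sem (PUSH i) t) (L @ [(t 50 0, t 51 0, i)])"
proof -
  have T: "sem (PUSH i) t = upd (upd (upd (upd t bEU (length L) (t 50 0)) bEV (length L) (t 51 0)) bEI (length L) i)
      bm 0 (Suc (length L))"
    using assms unfolding PUSH_def holds_list_def by simp
  show ?thesis
    unfolding T using assms by (auto simp: holds_list_def nth_append less_Suc_eq)
qed

lemma PUSH_frame: "b \<notin> {bEU, bEV, bEI, bm} \<Longrightarrow> sem (PUSH i) t b = t b"
  by (rule sem_frame) simp

lemma READ_CELL_correct:
  assumes h: "holds_list t L" and uv: "t 50 0 = u" "t 51 0 = v"
    and x: "u < v \<Longrightarrow> t bIn (t bQP 0) = \<mu> u v"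
  shows "holds_list (sem READ_CELL t) (L @ elist_cell \<mu> u v)" "sem READ_CELL t bQP 0 = Suc (t bQP 0)"
proof -
  define t1 where "t1 = (if 1 \<le> \<mu> u v then sem (PUSH 0) t else t)"
  define t2 where "t2 = (if 2 \<le> \<mu> u v then sem (PUSH 1) t1 else t1)"
  have fr1: "t1 b = t b" if "b \<notin> {bEU, bEV, bEI, bm}" for b using PUSH_frame[OF that] by (simp add: t1_def)
  have fr2: "t2 b = t b" if "b \<notin> {bEU, bEV, bEI, bm}" for b using PUSH_frame[OF that] fr1[OF that] by (simp add: t2_def)
  have h1: "holds_list t1 (L @ (if 1 \<le> \<mu> u v then [(u, v, 0)] else []))"
    using PUSH_correct[OF h, of 0] h uv by (simp add: t1_def)
  have h2: "holds_list t2 ((L @ (if 1 \<le> \<mu> u v then [(u, v, 0)] else [])) @ (if 2 \<le> \<mu> u v then [(u, v, 1)] else []))"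
  proof (cases "2 \<le> \<mu> u v")
    case True
    then have "1 \<le> \<mu> u v" by simp
    then show ?thesis using PUSH_correct[OF h1, of 1] uv fr1[of 50] fr1[of 51] True by (simp add: t2_def)
  next
    case False
    then show ?thesis using h1 by (simp add: t2_def)
  qed
  have t1i: "t1 bIn = t bIn" "t1 bQP = t bQP" using fr1 by simp_all
  have T: "sem READ_CELL t = (if u < v then upd t2 bQP 0 (Suc (t bQP 0)) else upd t bQP 0 (Suc (t bQP 0)))"
  proof (cases "u < v")
    case True
    have m: "t bIn (t bQP 0) = \<mu> u v" by (rule x[OF True])
    have "sem (LWhen (Cell bIn (rd bQP)) (PUSH 0)) t = t1"
      using m by (auto simp: t1_def)
    moreover have "sem (LWhen (leE (Const 2) (Cell bIn (rd bQP))) (PUSH 1)) t1 = t2"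
      using m t1i by (auto simp: t2_def)
    ultimately have "sem (LWhen (Cell bIn (rd bQP)) (PUSH 0) ;; LWhen (leE (Const 2) (Cell bIn (rd bQP))) (PUSH 1)) t = t2"
      by (simp only: sem.simps(3))
    then show ?thesis using True uv fr2[of bQP] unfolding READ_CELL_def by simp
  next
    case False
    then show ?thesis using uv unfolding READ_CELL_def by simp
  qed
  show "holds_list (sem READ_CELL t) (L @ elist_cell \<mu> u v)"
    unfolding T using h h2 by (auto simp: elist_cell_def holds_list_def)
  show "sem READ_CELL t bQP 0 = Suc (t bQP 0)" unfolding T by simp
qed

lemma READ_EDGES_correct:
  assumes n: "s bn 0 = n"
    and inp: "\<And>u v. u < v \<Longrightarrow> v < n \<Longrightarrow> s bIn (4 + u * n + v) = \<mu> u v"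
  shows "holds_list (sem READ_EDGES s) (elist n \<mu>)"
    "sem READ_EDGES s bR2 0 = length (elist n \<mu>) + length (elist n \<mu>)"
proof -
  define s1 where "s1 = upd (upd s bm 0 0) bQP 0 4"
  define s2 where "s2 = sem (LFor 50 bn (LFor 51 bn READ_CELL)) s1"
  let ?row = "\<lambda>u j. concat (map (elist_cell \<mu> u) [0..<j])"
  let ?P = "\<lambda>u t. holds_list t (concat (map (\<lambda>u. ?row u n) [0..<u])) \<and> t bQP 0 = 4 + u * n"
  have "?P (s1 bn 0) s2"
    unfolding s2_def
  proof (rule sem_For_inv[where P = ?P])
    show "?P 0 (upd s1 50 0 0)" by (simp add: s1_def holds_list_def)
  next
    fix u t assume u: "u < s1 bn 0" and P: "?P u t" and tu: "t 50 0 = u"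
      and fr: "\<And>b. b \<notin> insert 50 (writes (LFor 51 bn READ_CELL)) \<Longrightarrow> t b = s1 b"
    let ?L = "concat (map (\<lambda>u. ?row u n) [0..<u])"
    let ?Q = "\<lambda>v w. holds_list w (?L @ ?row u v) \<and> w bQP 0 = 4 + u * n + v"
    have tn: "t bn 0 = n" and tin: "t bIn = s bIn" using fr n by (simp_all add: s1_def)
    have "?Q (t bn 0) (sem (LFor 51 bn READ_CELL) t)"
    proof (rule sem_For_inv[where P = ?Q])
      show "?Q 0 (upd t 51 0 0)" using P by (simp add: holds_list_def)
    next
      fix v w assume v: "v < t bn 0" and Q: "?Q v w" and wv: "w 51 0 = v"
        and frw: "\<And>b. b \<notin> insert 51 (writes READ_CELL) \<Longrightarrow> w b = t b"
      have wu: "w 50 0 = u" "w bIn = s bIn" using frw tu tin by simp_all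
      have "w bIn (w bQP 0) = \<mu> u v" if "u < v" using Q wu inp[OF that] v tn by simp
      note R = READ_CELL_correct[of w _ u v \<mu>, OF conjunct1[OF Q] wu(1) wv this]
      show "?Q (Suc v) (upd (sem READ_CELL w) 51 0 (Suc v))"
        using R Q by (simp add: holds_list_def)
    qed
    then show "?P (Suc u) (upd (sem (LFor 51 bn READ_CELL) t) 50 0 (Suc u))"
      using tn by (simp add: holds_list_def del: sem.simps)
  qed
  moreover have "s1 bn 0 = n" using n by (simp add: s1_def)
  ultimately have h: "holds_list s2 (elist n \<mu>)" by (simp add: elist_def)
  have T: "sem READ_EDGES s = upd s2 bR2 0 (s2 bm 0 + s2 bm 0)"
    unfolding READ_EDGES_def by (simp add: s2_def s1_def del: sem.simps(5))
  show "holds_list (sem READ_EDGES s) (elist n \<mu>)" unfolding T using h by (simp add: holds_list_def)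
  show "sem READ_EDGES s bR2 0 = length (elist n \<mu>) + length (elist n \<mu>)"
    unfolding T using h by (simp add: holds_list_def)
qed

lemma nth_concat_map_upt:
  assumes "\<And>u. u < m \<Longrightarrow> length (f u) = n" "u < m" "v < n"
  shows "concat (map f [0..<m]) ! (u * n + v) = f u ! v"
proof -
  have len: "length (concat (map f [0..<j])) = j * n" if "j \<le> m" for j
    using that assms(1) by (induction j) auto
  have "u < j \<Longrightarrow> j \<le> m \<Longrightarrow> concat (map f [0..<j]) ! (u * n + v) = f u ! v" for j
  proof (induction j)
    case (Suc j)
    show ?case
    proof (cases "u = j")
      case True
      then show ?thesis using len[of j] Suc.prems by (simp add: nth_append)
    next
      case False
      then have "u < j" using Suc.prems by simp
      then have "u * n + v < j * n"
        using assms(3) mult_le_mono1[of "Suc u" j n] by simp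
      then show ?thesis using len[of j] Suc \<open>u < j\<close> by (simp add: nth_append)
    qed
  qed simp
  then show ?thesis using assms(2) by blast
qed

lemma length_encode: "length (encode_inst (k, n, r, \<mu>)) = 3 + n * n"
proof -
  have "length (concat (map (\<lambda>u. map (g u) [0..<n]) [0..<j])) = j * n" for g :: "nat \<Rightarrow> nat \<Rightarrow> nat" and j
    by (induction j) auto
  then show ?thesis by simp
qed

text \<open>Cell 0 holds the length of the input and cells 1 to 3 hold \<open>k\<close>,
  \<open>n\<close> and \<open>r\<close>, so the matrix starts at address 4.\<close>

lemma encode_entry:
  assumes "u < v" "v < n"
  shows "input_memory (encode_inst (k, n, r, \<mu>)) bIn (4 + u * n + v) = \<mu> u v"
proof -
  let ?f = "\<lambda>u. map (\<lambda>v. if u = v then 0 else \<mu> (min u v) (max u v)) [0..<n]"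
  have "u * n + v < n * n"
  proof -
    have "u * n + v < Suc u * n" using assms by simp
    also have "\<dots> \<le> n * n" using assms by (intro mult_le_mono1) simp
    finally show ?thesis .
  qed
  then have "input_memory (encode_inst (k, n, r, \<mu>)) bIn (4 + u * n + v) =
      encode_inst (k, n, r, \<mu>) ! (3 + u * n + v)"
    using length_encode[of k n r \<mu>] by (simp add: input_memory_def add.assoc del: encode_inst.simps)
  also have "\<dots> = concat (map ?f [0..<n]) ! (u * n + v)" by (simp add: numeral_3_eq_3)
  also have "\<dots> = ?f u ! v" by (rule nth_concat_map_upt) (use assms in auto)
  also have "\<dots> = \<mu> u v" using assms by (simp add: min_def max_def)
  finally show ?thesis .
qed

lemma encode_params:
  "input_memory (encode_inst (k, n, r, \<mu>)) bIn 1 = k" "input_memory (encode_inst (k, n, r, \<mu>)) bIn 2 = n"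
  "input_memory (encode_inst (k, n, r, \<mu>)) bIn 3 = r"
  by (simp_all add: input_memory_def numeral_3_eq_3 numeral_2_eq_2)

lemma output_of_Cons: "output_of s = x # xs \<Longrightarrow> s 1 1 = x"
proof -
  assume a: "output_of s = x # xs"
  then have "1 < Suc (s 1 0)" unfolding output_of_def by (metis list.distinct(1) list.simps(8) not_less upt_conv_Nil)
  then have "output_of s = s 1 1 # map (s 1) [Suc 1..<Suc (s 1 0)]"
    unfolding output_of_def by (subst upt_conv_Cons) auto
  then show ?thesis using a by simp
qed

text \<open>The second fact is for the decision version, which prints the first output cell only.
  The last two are the loop bounds that enter the running time.\<close>

lemma MAIN_correct:
  assumes I: "(k, n, r, \<mu>) \<in> instances"
  defines "s \<equiv> input_memory (encode_inst (k, n, r, \<mu>))"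
  shows "correct_output (k, n, r, \<mu>) (output_of (sem MAIN s))"
    and "sem MAIN s 1 1 = (if (k, n, r, \<mu>) \<in> yes_instances then 1 else 0)"
    and "sem READ_EDGES (sem PARAMS s) bm 0 = length (elist n \<mu>)"
    and "sem READ_EDGES (sem PARAMS s) bR2 0 = length (elist n \<mu>) + length (elist n \<mu>)"
proof -
  have k: "1 \<le> k" and r: "r < n" using I by (auto simp: instances_def)
  have in1: "s bIn 1 = k" and in2: "s bIn 2 = n" and in3: "s bIn 3 = r"
    unfolding s_def by (rule encode_params)+
  define s1 where "s1 = sem PARAMS s"
  note P = PARAMS_correct[of s k, OF in1, folded s1_def, unfolded in2 in3]
  have fr1: "s1 b = s b" if "b \<notin> {bK, bn, br, bTWO, bN, 50, bM, bB, bL, bX, 51, bY}" for b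
    unfolding s1_def PARAMS_def by (rule sem_frame) (use that writes_PARAMS in simp)
  define s2 where "s2 = sem READ_EDGES s1"
  have "s1 bIn (4 + u * n + v) = \<mu> u v" if "u < v" "v < n" for u v
    using fr1[of bIn] encode_entry[OF that] by (simp add: s_def)
  note R = READ_EDGES_correct[of s1 n \<mu>, OF P(2) this, folded s2_def]
  have fr2: "s2 b = s1 b" if "b \<notin> writes READ_EDGES" for b
    unfolding s2_def by (rule sem_frame[OF that])
  interpret encoded_instance k n r \<mu> "par_N k" "par_M k" "par_B k" "s2 bEU" "s2 bEV" "s2 bEI"
    by unfold_locales (use r R in \<open>auto simp: holds_list_def\<close>)
  have c: "ctx s2" unfolding ctx_def using P fr2 R by (simp add: holds_list_def)
  have zero: "s2 bFX e = 0" "s2 bDONE 0 = 0" for e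
    using fr2 fr1 by (simp_all add: s_def input_memory_def)
  have X: "s2 bX 0 = par_B k ^ (par_N k + par_N k)" using P fr2 by (simp add: par_X_def)
  have S: "if solvable then solved (sem SEARCH s2) else output_of (sem SEARCH s2) = [0]"
    by (rule SEARCH_correct[OF c zero(1,2) X k]) (simp_all add: par_N_def par_M_def par_B_def)
  have T: "sem MAIN s = sem SEARCH s2" by (simp add: MAIN_def PARAMS_def s2_def s1_def)
  show "correct_output (k, n, r, \<mu>) (output_of (sem MAIN s))"
  proof (cases "(k, n, r, \<mu>) \<in> yes_instances")
    case True
    then have "solved (sem SEARCH s2)" using S solvable_iff[OF k] by simp
    then obtain ST where "good ST"
      "output_of (sem SEARCH s2) = 1 # encode_edges (edge_list ST 1 mm) @ encode_edges (edge_list ST 2 mm)"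
      unfolding solved_def by blast
    then show ?thesis unfolding T using True good_output by auto
  next
    case False
    then show ?thesis unfolding T using S solvable_iff[OF k] by simp
  qed
  show "sem MAIN s 1 1 = (if (k, n, r, \<mu>) \<in> yes_instances then 1 else 0)"
    unfolding T using S solvable_iff[OF k] output_of_Cons unfolding solved_def by (auto split: if_splits)
  show "sem READ_EDGES (sem PARAMS s) bm 0 = length (elist n \<mu>)"
    "sem READ_EDGES (sem PARAMS s) bR2 0 = length (elist n \<mu>) + length (elist n \<mu>)"
    using R unfolding s2_def s1_def holds_list_def by simp_all
qed

section \<open>Running time\<close>

definition halts_within :: "lp \<Rightarrow> memory \<Rightarrow> nat \<Rightarrow> bool" where
  "halts_within p s a \<longleftrightarrow> (\<exists>t\<le>a. exec (compile p) s t (sem p s))"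

text \<open>\<open>exec_compile\<close> forbids writing to loop bounds, but the set-up computes the
  bounds of later loops. The program is therefore cut into stages that each respect this, all
  measured with a common \<open>Z\<close> and a common exponent \<open>D\<close>.\<close>

lemma halts_within_stage:
  assumes "wf_lp p" "bnds p \<inter> writes p = {}" "\<And>b. b \<in> bnds p \<Longrightarrow> s b 0 \<le> Z" "1 \<le> Z" "depth p \<le> D"
  shows "halts_within p s (cost p * Z ^ D)"
proof -
  obtain t where t: "exec (compile p) s t (sem p s)" "t \<le> cost p * Z ^ depth p"
    using exec_compile[of p s Z, OF assms(1-4)] by blast
  have "Z ^ depth p \<le> Z ^ D" using assms(4,5) by (intro power_increasing) auto
  then have "cost p * Z ^ depth p \<le> cost p * Z ^ D" by simp
  then show ?thesis using t unfolding halts_within_def by (meson le_trans)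
qed

lemma halts_within_Seq:
  assumes "halts_within p s (cost p * Y)" "halts_within q (sem p s) (cost q * Y)"
  shows "halts_within (p ;; q) s (cost (p ;; q) * Y)"
proof -
  obtain t u where t: "exec (compile p) s t (sem p s)" "t \<le> cost p * Y"
    and u: "exec (compile q) (sem p s) u (sem q (sem p s))" "u \<le> cost q * Y"
    using assms unfolding halts_within_def by blast
  have "exec (compile (p ;; q)) s (t + u) (sem (p ;; q) s)" using exec.Seq[OF t(1) u(1)] by simp
  moreover have "t + u \<le> cost (p ;; q) * Y" using t u by (simp add: distrib_right)
  ultimately show ?thesis unfolding halts_within_def by blast
qed

lemma finite_bnds: "finite (bnds p)"
  by (induction p) auto

lemma halts:
  assumes "wf_lp p" "bnds p \<inter> writes p = {}"
  shows "\<exists>t. exec (compile p) s t (sem p s)"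
proof -
  let ?Z = "Suc (\<Sum>b\<in>bnds p. s b 0)"
  have "s b 0 \<le> ?Z" if "b \<in> bnds p" for b
    using member_le_sum[of b "bnds p" "\<lambda>b. s b 0"] that finite_bnds[of p] by simp
  then show ?thesis using exec_compile[OF assms, of s ?Z] by auto
qed

lemma wf_procedures:
  "wf_lp REACH" "wf_lp SELECT" "wf_lp AUG" "wf_lp UNION" "wf_lp GROW" "wf_lp CHECK_TREE" "wf_lp OUTPUT" "wf_lp SEARCH"
proof -
  show R: "wf_lp REACH" by (simp add: REACH_def REACH_EDGE_def)
  show S: "wf_lp SELECT" by (simp add: SELECT_def)
  have E: "wf_lp EXPAND_EDGE" using R by (simp add: EXPAND_EDGE_def)
  then have "wf_lp EXPAND" using R S by (simp add: EXPAND_def)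
  then have "wf_lp EXPAND_TREE" by (simp add: EXPAND_TREE_def)
  then have "wf_lp LEVEL_EDGE" by (simp add: LEVEL_EDGE_def)
  then have "wf_lp LEVELS" by (simp add: LEVELS_def)
  moreover have "wf_lp BFS_INIT" "wf_lp WALK_STEP" by (simp_all add: BFS_INIT_def WALK_STEP_def)
  ultimately show A: "wf_lp AUG" by (simp add: AUG_def)
  then show U: "wf_lp UNION" by (simp add: UNION_def)
  have "wf_lp DIVMOD" "wf_lp SCAN" by (simp_all add: DIVMOD_def SCAN_def)
  then have "wf_lp GROW_STEP" by (simp add: GROW_STEP_def)
  then show G: "wf_lp GROW" by (simp add: GROW_def)
  have "wf_lp AVOID" "wf_lp COUNT" by (simp_all add: AVOID_def COUNT_def)
  then have "wf_lp CHECK_VERTEX" using R by (simp add: CHECK_VERTEX_def)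
  then show C: "wf_lp CHECK_TREE" using R S by (simp add: CHECK_TREE_def)
  have "wf_lp OUT_EDGE" by (simp add: OUT_EDGE_def)
  then have "wf_lp OUT_TREE" by (simp add: OUT_TREE_def)
  then show O: "wf_lp OUTPUT" by (simp add: OUTPUT_def)
  have "wf_lp TREES" using G U by (simp add: TREES_def)
  moreover have "wf_lp CHECK" using C by (simp add: CHECK_def)
  ultimately have "wf_lp TRY" using O by (simp add: TRY_def)
  then show "wf_lp SEARCH" by (simp add: SEARCH_def)
qed

lemma wf_params:
  "wf_lp PARAMS_INIT" "wf_lp PARAMS_N" "wf_lp PARAMS_B" "wf_lp PARAMS_X" "wf_lp READ_EDGES"
  by (simp_all add: PARAMS_INIT_def PARAMS_N_def PARAMS_B_def PARAMS_X_def READ_EDGES_def)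
    (simp add: READ_CELL_def PUSH_def)

lemma bnds_params:
  "bnds PARAMS_INIT = {}" "bnds PARAMS_N = {bK}" "bnds PARAMS_B = {bN}" "bnds PARAMS_X = {bL, bB}" "bnds READ_EDGES = {bn}"
  unfolding PARAMS_INIT_def PARAMS_N_def PARAMS_B_def PARAMS_X_def READ_EDGES_def READ_CELL_def PUSH_def bnds.simps
  by blast+

lemma bnds_SEARCH: "bnds SEARCH \<subseteq> {bn, bm, bR2, bTWO, bN, bX}"
  unfolding SEARCH_def TRY_def TREES_def CHECK_def OUTPUT_def OUT_TREE_def OUT_EDGE_def CHECK_TREE_def CHECK_VERTEX_def
    COUNT_def AVOID_def GROW_def GROW_STEP_def SCAN_def DIVMOD_def UNION_def AUG_def WALK_STEP_def BFS_INIT_def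
    LEVELS_def LEVEL_EDGE_def EXPAND_TREE_def EXPAND_def EXPAND_EDGE_def SELECT_def REACH_def REACH_EDGE_def bnds.simps
  by blast

lemma bnds_SEARCH_writes: "bnds SEARCH \<inter> writes SEARCH = {}"
proof -
  have "writes SEARCH = insert 58 (writes TRY) \<union> {bOut}" unfolding SEARCH_def writes.simps by blast
  then have "writes SEARCH \<inter> {bn, bm, bR2, bTWO, bN, bX} = {}" by simp
  then show ?thesis using bnds_SEARCH by blast
qed

lemma length_elist: "length (elist n \<mu>) \<le> 2 * n\<^sup>2"
proof -
  have "length (elist n \<mu>) = card (set (elist n \<mu>))" by (rule distinct_card[OF distinct_elist, symmetric])
  also have "\<dots> \<le> card ({..<n} \<times> {..<n} \<times> {..<2 :: nat})"
    by (intro card_mono) (auto simp: set_elist)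
  finally show ?thesis by (simp add: power2_eq_square)
qed

lemma par_bounds:
  assumes "1 \<le> k"
  shows "k \<le> par_X k" "par_N k \<le> par_X k" "par_N k + par_N k \<le> par_X k" "par_B k \<le> par_X k" "1 \<le> par_X k"
proof -
  have N: "1 \<le> par_N k" "k \<le> par_N k" using assms by (simp_all add: par_N_def)
  have B: "1 \<le> par_B k" "par_N k + par_N k \<le> par_B k" by (simp_all add: par_B_def par_M_def)
  show X: "par_B k \<le> par_X k" unfolding par_X_def using N B(1) by (intro self_le_power) auto
  show "k \<le> par_X k" "par_N k \<le> par_X k" "par_N k + par_N k \<le> par_X k" "1 \<le> par_X k"
    using X N B by linarith+
qed

text \<open>The parameters are at most \<open>par_X k\<close>. The number \<open>n\<close>, the at
  most \<open>2 * n\<^sup>2\<close> listed edges and twice their number are at most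
  \<open>4 * n\<^sup>2\<close>. Hence the product bounds every loop.\<close>

lemma MAIN_halts:
  assumes I: "(k, n, r, \<mu>) \<in> instances"
  shows "halts_within MAIN (input_memory (encode_inst (k, n, r, \<mu>))) (cost MAIN * (4 * par_X k * n\<^sup>2) ^ depth MAIN)"
proof -
  have k: "1 \<le> k" and n1: "1 \<le> n" using I by (auto simp: instances_def)
  define s where "s = input_memory (encode_inst (k, n, r, \<mu>))"
  define s1 where "s1 = sem PARAMS_INIT s"
  define s2 where "s2 = sem PARAMS_N s1"
  define s3 where "s3 = sem PARAMS_B s2"
  define s4 where "s4 = sem PARAMS_X s3"
  define s5 where "s5 = sem READ_EDGES s4"
  let ?Z = "4 * par_X k * n\<^sup>2" and ?D = "depth MAIN"
  have in1: "s bIn 1 = k" and in2: "s bIn 2 = n" unfolding s_def by (rule encode_params)+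
  have P4: "sem PARAMS s = s4" by (simp add: PARAMS_def s4_def s3_def s2_def s1_def)
  have v1: "s1 bK 0 = k" "s1 bN 0 = 0" unfolding s1_def PARAMS_INIT_correct using in1 by simp_all
  note v2 = PARAMS_N_correct[of s1 k, OF v1, folded s2_def]
  note v3 = PARAMS_B_correct[of s2 k, OF v2, folded s3_def]
  note v4 = PARAMS_correct[of s k, OF in1, unfolded P4 in2]
  have v5: "s5 bm 0 = length (elist n \<mu>)" "s5 bR2 0 = length (elist n \<mu>) + length (elist n \<mu>)"
    using MAIN_correct(3,4)[OF I] P4 unfolding s_def s5_def by simp_all
  have fr5: "s5 b = s4 b" if "b \<notin> writes READ_EDGES" for b
    unfolding s5_def by (rule sem_frame[OF that])
  have nn: "n \<le> n\<^sup>2" "1 \<le> n\<^sup>2" using n1 by (simp_all add: power2_eq_square)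
  note pb = par_bounds[OF k]
  have X: "y \<le> ?Z" if "y \<le> par_X k" for y
  proof -
    have "y * 1 \<le> (4 * par_X k) * n\<^sup>2" using that nn by (intro mult_le_mono) auto
    then show ?thesis by simp
  qed
  have Nn: "y \<le> ?Z" if "y \<le> 4 * n\<^sup>2" for y
  proof -
    have "y * 1 \<le> (4 * n\<^sup>2) * par_X k" by (rule mult_le_mono[OF that pb(5)])
    also have "\<dots> = ?Z" by simp
    finally show ?thesis by simp
  qed
  have Z1: "1 \<le> ?Z" by (rule X[OF pb(5)])
  have h1: "halts_within PARAMS_INIT s (cost PARAMS_INIT * ?Z ^ ?D)"
    by (rule halts_within_stage) (use wf_params bnds_params Z1 in \<open>auto simp: MAIN_def\<close>)
  have h2: "halts_within PARAMS_N s1 (cost PARAMS_N * ?Z ^ ?D)"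
    by (rule halts_within_stage) (use wf_params bnds_params writes_PARAMS Z1 v1 X pb in \<open>auto simp: MAIN_def\<close>)
  have h3: "halts_within PARAMS_B s2 (cost PARAMS_B * ?Z ^ ?D)"
    by (rule halts_within_stage) (use wf_params bnds_params writes_PARAMS Z1 v2 X pb in \<open>auto simp: MAIN_def\<close>)
  have h4: "halts_within PARAMS_X s3 (cost PARAMS_X * ?Z ^ ?D)"
    by (rule halts_within_stage) (use wf_params bnds_params writes_PARAMS Z1 v3 X pb in \<open>auto simp: MAIN_def\<close>)
  have h5: "halts_within READ_EDGES s4 (cost READ_EDGES * ?Z ^ ?D)"
    by (rule halts_within_stage) (use wf_params bnds_params Z1 v4 Nn nn in \<open>auto simp: MAIN_def\<close>)
  have h6: "halts_within SEARCH s5 (cost SEARCH * ?Z ^ ?D)"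
  proof (rule halts_within_stage[OF wf_procedures(8) bnds_SEARCH_writes _ Z1])
    fix b assume b: "b \<in> bnds SEARCH"
    have "s5 bn 0 \<le> ?Z" "s5 bm 0 \<le> ?Z" "s5 bR2 0 \<le> ?Z" "s5 bTWO 0 \<le> ?Z"
      using Nn nn v4 v5 fr5 length_elist[of n \<mu>] by simp_all
    moreover have "s5 bN 0 \<le> ?Z" "s5 bX 0 \<le> ?Z" using X pb v4 fr5 by simp_all
    ultimately show "s5 b 0 \<le> ?Z" using subsetD[OF bnds_SEARCH b] by blast
  qed (simp add: MAIN_def)
  show ?thesis
    unfolding s_def[symmetric] MAIN_def
    using h1 h2 h3 h4 h5 h6
    unfolding MAIN_def s5_def s4_def s3_def s2_def s1_def by (intro halts_within_Seq)
qed

section \<open>Computability and growth of the time bound\<close>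

text \<open>Computes the factor of the time bound that depends on \<open>k\<close> alone, reusing
  the parameter stages. Computability asks for termination without a time bound, so
  \<open>halts\<close> suffices for each stage.\<close>

definition BOUND :: "nat \<Rightarrow> nat \<Rightarrow> lp" where
  "BOUND c d = PARAMS_INIT ;; PARAMS_N ;; PARAMS_B ;; PARAMS_X ;;
     (assign bCT (Const c) ;; assign bQ (Plus (Plus (rd bX) (rd bX)) (Plus (rd bX) (rd bX))) ;; assign bC (Const d)) ;;
     LFor 50 bC (assign bY (Const 0) ;; LFor 51 bQ (assign bY (Plus (rd bY) (rd bCT))) ;; assign bCT (rd bY)) ;;
     LStore bOut (Const 0) (Const 1) ;; LStore bOut (Const 1) (rd bCT)"

lemma exec_Seq_ex:
  "\<exists>t. exec (compile p) s t (sem p s) \<Longrightarrow> \<exists>t. exec (compile q) (sem p s) t (sem q (sem p s)) \<Longrightarrow>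
    \<exists>t. exec (compile (p ;; q)) s t (sem (p ;; q) s)"
  using exec.Seq by fastforce

lemma computable_bound: "computable (\<lambda>k. c * (4 * par_X k) ^ d)"
  unfolding computable_def
proof (rule exI[of _ "compile (BOUND c d)"], rule allI)
  fix k
  let ?s = "input_memory [k]"
  let ?loop = "LFor 50 bC (assign bY (Const 0) ;; LFor 51 bQ (assign bY (Plus (rd bY) (rd bCT))) ;; assign bCT (rd bY))"
  let ?init = "assign bCT (Const c) ;; assign bQ (Plus (Plus (rd bX) (rd bX)) (Plus (rd bX) (rd bX))) ;; assign bC (Const d)"
  define s1 where "s1 = sem PARAMS ?s"
  define s2 where "s2 = sem ?init s1"
  have "?s bIn 1 = k" by (simp add: input_memory_def)
  then have X: "s1 bX 0 = par_X k" unfolding s1_def by (rule PARAMS_correct(8))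
  have s2: "s2 bCT 0 = c" "s2 bQ 0 = 4 * par_X k" "s2 bC 0 = d" using X by (simp_all add: s2_def)
  have L: "sem ?loop s2 bCT 0 = c * (4 * par_X k) ^ d"
    using power_loop[of 50 bC bY 51 bQ bCT s2, OF _ s2(1)] s2 by simp
  have T: "sem (BOUND c d) ?s = upd (upd (sem ?loop s2) bOut 0 1) bOut 1 (sem ?loop s2 bCT 0)"
    by (simp add: BOUND_def s2_def s1_def PARAMS_def del: sem.simps(5))
  have "output_of (sem (BOUND c d) ?s) = [c * (4 * par_X k) ^ d]"
    unfolding T L by (simp add: output_of_def)
  moreover have "\<exists>t. exec (compile (BOUND c d)) ?s t (sem (BOUND c d) ?s)"
    unfolding BOUND_def
    by (intro exec_Seq_ex halts) (use wf_params bnds_params writes_PARAMS in simp_all)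
  ultimately show "\<exists>t. runs (compile (BOUND c d)) [k] t [c * (4 * par_X k) ^ d]"
    unfolding runs_def by blast
qed

text \<open>With \<open>N = k * k\<close> the value is at most \<open>18 * N * N + 1\<close>. It is
  rounded up to \<open>32 * N * N\<close> so that the logarithm of the constant is 5.\<close>

lemma par_B_le:
  assumes "1 \<le> k"
  shows "par_B k \<le> 32 * k ^ 4"
proof -
  define N where "N = k * k"
  have N: "1 \<le> N" using assms by (simp add: N_def)
  have "Suc N * (4 * N + 5) \<le> (2 * N) * (9 * N)" using N by (intro mult_le_mono) auto
  moreover have "1 \<le> N * N" using N by simp
  ultimately have "Suc (Suc N * (4 * N + 5)) \<le> 32 * (N * N)" by linarith
  then show ?thesis by (simp add: par_B_def par_M_def par_N_def N_def eval_nat_numeral algebra_simps)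
qed

text \<open>\<open>par_X k\<close> is a power with exponent \<open>2 * k\<^sup>2\<close>, and for
  \<open>k \<ge> 2\<close> the logarithm of its base is at most \<open>5 + 4 * log 2 k\<close>,
  hence at most \<open>9 * log 2 k\<close>. The factor 20 consists of 18 from this and 2 from the 4
  in \<open>4 * par_X k\<close>.\<close>

lemma bound_bigo:
  assumes c: "1 \<le> c"
  shows "(\<lambda>k. log 2 (real (c * (4 * par_X k) ^ d))) \<in> O(\<lambda>k. real k ^ 2 * log 2 (real k))"
proof (rule bigoI[where c = "log 2 (real c) + 20 * real d"])
  show "\<forall>\<^sub>F k in at_top. norm (log 2 (real (c * (4 * par_X k) ^ d))) \<le>
      (log 2 (real c) + 20 * real d) * norm (real k ^ 2 * log 2 (real k))"
    unfolding eventually_at_top_linorder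
  proof (intro exI allI impI)
    fix k :: nat assume k: "2 \<le> k"
    have B1: "1 \<le> par_B k" by (simp add: par_B_def)
    have lk: "1 \<le> log 2 (real k)" using k by (simp add: le_log_iff)
    have k2: "1 \<le> real k ^ 2" using k by simp
    have "real (par_B k) \<le> real (32 * k ^ 4)" using par_B_le[of k] k by (intro of_nat_mono) simp
    then have "log 2 (real (par_B k)) \<le> log 2 (2 ^ 5 * real k ^ 4)"
      using B1 by (intro log_mono) auto
    also have "\<dots> = 5 + 4 * log 2 (real k)"
      using k log_pow_cancel[of 2 5] by (simp add: log_mult log_nat_power)
    also have "\<dots> \<le> 9 * log 2 (real k)" using lk by simp
    finally have lB: "log 2 (real (par_B k)) \<le> 9 * log 2 (real k)" .
    have X: "log 2 (real (par_X k)) = 2 * real k ^ 2 * log 2 (real (par_B k))"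
      using B1 by (simp add: par_X_def par_N_def log_nat_power power2_eq_square)
    let ?l = "real k ^ 2 * log 2 (real k)"
    have l1: "1 \<le> ?l" using mult_mono[OF k2 lk] by simp
    have "real k ^ 2 * log 2 (real (par_B k)) \<le> real k ^ 2 * (9 * log 2 (real k))"
      using lB by (intro mult_left_mono) auto
    then have lX: "log 2 (real (par_X k)) \<le> 18 * ?l" unfolding X by simp
    have Xp: "0 < real (par_X k)" using B1 by (simp add: par_X_def)
    have eq: "log 2 (real (c * (4 * par_X k) ^ d)) = log 2 (real c) + real d * (2 + log 2 (real (par_X k)))"
    proof -
      have "log 2 (real (c * (4 * par_X k) ^ d)) = log 2 (real c) + log 2 ((4 * real (par_X k)) ^ d)"
        using c Xp by (simp add: log_mult)
      also have "log 2 ((4 * real (par_X k)) ^ d) = real d * log 2 (4 * real (par_X k))"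
        by (rule log_nat_power) (use Xp in simp)
      also have "log 2 (4 * real (par_X k)) = log 2 (2 ^ 2) + log 2 (real (par_X k))"
        using Xp by (simp add: log_mult)
      also have "log 2 (2 ^ 2 :: real) = 2" by (simp add: log_nat_power del: power_numeral)
      finally show ?thesis .
    qed
    have "1 \<le> real (par_X k)" using B1 by (simp add: par_X_def)
    then have X0: "0 \<le> log 2 (real (par_X k))" by simp
    have c0: "0 \<le> log 2 (real c)" using c by simp
    have "real d * (2 + log 2 (real (par_X k))) \<le> real d * (20 * ?l)"
      using lX l1 by (intro mult_left_mono) auto
    moreover have "log 2 (real c) \<le> log 2 (real c) * ?l"
      using mult_left_mono[OF l1 c0] by simp
    ultimately have "log 2 (real (c * (4 * par_X k) ^ d)) \<le> (log 2 (real c) + 20 * real d) * ?l"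
      unfolding eq by (simp add: algebra_simps)
    moreover have "0 \<le> log 2 (real (c * (4 * par_X k) ^ d))" unfolding eq using X0 c0 by simp
    ultimately show "norm (log 2 (real (c * (4 * par_X k) ^ d))) \<le>
      (log 2 (real c) + 20 * real d) * norm (real k ^ 2 * log 2 (real k))" using l1 by simp
  qed
qed

lemma bit_size_ge: "length ws \<le> bit_size ws"
  by (induction ws) (auto simp: bit_size_def)

theorem theorem13:
  shows "(\<exists>(p :: prog) (f :: nat \<Rightarrow> real) (c :: nat).
            f \<in> O(\<lambda>k. real k ^ 2 * log 2 (real k)) \<and>
            (\<forall>k n r \<mu>. (k, n, r, \<mu>) \<in> instances \<longrightarrow>
               (\<exists>t out. runs p (encode_inst (k, n, r, \<mu>)) t out \<and>
                  correct_output (k, n, r, \<mu>) out \<and>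
                  real t \<le> 2 powr f k * real n ^ c))) \<and>
         fixed_parameter_tractable instances encode_inst fst yes_instances"
proof
  \<comment> \<open>The exponent is the nesting depth of a fixed program, hence independent of the
    input.\<close>
  define d where "d = depth MAIN"
  \<comment> \<open>The 3 pays for the additional store of the decision version.\<close>
  define c where "c = cost MAIN + 3"
  have c1: "1 \<le> c" by (simp add: c_def)
  have run: "\<exists>t. exec (compile MAIN) (input_memory (encode_inst (k, n, r, \<mu>))) t
        (sem MAIN (input_memory (encode_inst (k, n, r, \<mu>)))) \<and> t + 3 \<le> c * (4 * par_X k) ^ d * n ^ (2 * d)"
    if I: "(k, n, r, \<mu>) \<in> instances" for k n r \<mu>
  proof -
    obtain t where t: "exec (compile MAIN) (input_memory (encode_inst (k, n, r, \<mu>))) t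
        (sem MAIN (input_memory (encode_inst (k, n, r, \<mu>))))" "t \<le> cost MAIN * (4 * par_X k * n\<^sup>2) ^ d"
      using MAIN_halts[OF I] unfolding halts_within_def d_def by blast
    have "1 \<le> k" "1 \<le> n" using I by (auto simp: instances_def)
    then have "1 \<le> (4 * par_X k * n\<^sup>2) ^ d" using par_bounds(5)[of k] by (intro one_le_power) simp
    then have "t + 3 \<le> c * (4 * par_X k * n\<^sup>2) ^ d" using t(2) by (simp add: c_def distrib_right)
    also have "\<dots> = c * (4 * par_X k) ^ d * n ^ (2 * d)"
      by (simp only: power_mult_distrib power_mult mult.assoc)
    finally show ?thesis using t(1) by blast
  qed
  show "\<exists>(p :: prog) (f :: nat \<Rightarrow> real) (c :: nat).
            f \<in> O(\<lambda>k. real k ^ 2 * log 2 (real k)) \<and>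
            (\<forall>k n r \<mu>. (k, n, r, \<mu>) \<in> instances \<longrightarrow>
               (\<exists>t out. runs p (encode_inst (k, n, r, \<mu>)) t out \<and>
                  correct_output (k, n, r, \<mu>) out \<and>
                  real t \<le> 2 powr f k * real n ^ c))"
  proof (rule exI[of _ "compile MAIN"], rule exI[of _ "\<lambda>k. log 2 (real (c * (4 * par_X k) ^ d))"],
      rule exI[of _ "2 * d"], intro conjI allI impI)
    show "(\<lambda>k. log 2 (real (c * (4 * par_X k) ^ d))) \<in> O(\<lambda>k. real k ^ 2 * log 2 (real k))"
      by (rule bound_bigo[OF c1])
    fix k n r \<mu> assume I: "(k, n, r, \<mu>) \<in> instances"
    let ?s = "input_memory (encode_inst (k, n, r, \<mu>))"
    obtain t where t: "exec (compile MAIN) ?s t (sem MAIN ?s)" "t + 3 \<le> c * (4 * par_X k) ^ d * n ^ (2 * d)"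
      using run[OF I] by blast
    have "1 \<le> k" using I by (simp add: instances_def)
    then have "0 < c * (4 * par_X k) ^ d" using par_bounds(5)[of k] c1 by simp
    then have "0 < real (c * (4 * par_X k) ^ d)" by (simp only: of_nat_0_less_iff)
    then have "2 powr log 2 (real (c * (4 * par_X k) ^ d)) = real (c * (4 * par_X k) ^ d)"
      by (intro powr_log_cancel) simp_all
    moreover have "real t \<le> real (c * (4 * par_X k) ^ d * n ^ (2 * d))" using t(2) by (intro of_nat_mono) simp
    ultimately have le: "real t \<le> 2 powr log 2 (real (c * (4 * par_X k) ^ d)) * real n ^ (2 * d)"
      by (simp only: of_nat_mult[symmetric] of_nat_power[symmetric])
    show "\<exists>t out. runs (compile MAIN) (encode_inst (k, n, r, \<mu>)) t out \<and> correct_output (k, n, r, \<mu>) out \<and>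
        real t \<le> 2 powr log 2 (real (c * (4 * par_X k) ^ d)) * real n ^ (2 * d)"
      using t(1) le MAIN_correct(1)[OF I] unfolding runs_def by blast
  qed
  show "fixed_parameter_tractable instances encode_inst fst yes_instances"
    unfolding fixed_parameter_tractable_def
  \<comment> \<open>Setting the output length to 1 keeps only the first cell, which is the
    answer.\<close>
  proof (rule exI[of _ "Seq (compile MAIN) (Store 1 (Const 0) (Const 1))"],
      rule exI[of _ "\<lambda>k. c * (4 * par_X k) ^ d"], rule exI[of _ "2 * d"], intro conjI ballI)
    show "computable (\<lambda>k. c * (4 * par_X k) ^ d)" by (rule computable_bound)
    fix x assume x: "x \<in> instances"
    obtain k n r \<mu> where xe: "x = (k, n, r, \<mu>)" by (metis prod_cases4)
    have I: "(k, n, r, \<mu>) \<in> instances" using x xe by simp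
    let ?s = "input_memory (encode_inst x)"
    obtain t where t: "exec (compile MAIN) ?s t (sem MAIN ?s)" "t + 3 \<le> c * (4 * par_X k) ^ d * n ^ (2 * d)"
      using run[OF I] unfolding xe by blast
    have "exec (Store 1 (Const 0) (Const 1)) (sem MAIN ?s) 3 (upd (sem MAIN ?s) 1 0 1)"
      using exec_Store[of 1 "Const 0" "Const 1" "sem MAIN ?s"] by (simp add: eval_nat_numeral)
    then have "exec (Seq (compile MAIN) (Store 1 (Const 0) (Const 1))) ?s (t + 3) (upd (sem MAIN ?s) 1 0 1)"
      by (rule exec.Seq[OF t(1)])
    moreover have "output_of (upd (sem MAIN ?s) 1 0 1) = (if x \<in> yes_instances then [1] else [0])"
      using MAIN_correct(2)[OF I] unfolding xe output_of_def by simp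
    moreover have "t + 3 \<le> c * (4 * par_X (fst x)) ^ d * bit_size (encode_inst x) ^ (2 * d)"
    proof -
      \<comment> \<open>The input lists all \<open>n * n\<close> matrix entries, and each word
        contributes at least its delimiter to \<open>bit_size\<close>, so \<open>n\<close> is
        bounded by the size of the input.\<close>
      have "n \<le> 3 + n * n" by (cases n) auto
      also have "\<dots> \<le> bit_size (encode_inst x)"
        using bit_size_ge[of "encode_inst x"] length_encode[of k n r \<mu>] xe by simp
      finally have "n ^ (2 * d) \<le> bit_size (encode_inst x) ^ (2 * d)" by (intro power_mono) auto
      then have "c * (4 * par_X k) ^ d * n ^ (2 * d) \<le> c * (4 * par_X k) ^ d * bit_size (encode_inst x) ^ (2 * d)"
        by (rule mult_le_mono2)
      with t(2) have "t + 3 \<le> c * (4 * par_X k) ^ d * bit_size (encode_inst x) ^ (2 * d)" by (rule le_trans)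
      then show ?thesis by (simp only: xe fst_conv)
    qed
    ultimately show "\<exists>t. runs (Seq (compile MAIN) (Store 1 (Const 0) (Const 1))) (encode_inst x) t
          (if x \<in> yes_instances then [1] else [0]) \<and>
        t \<le> c * (4 * par_X (fst x)) ^ d * bit_size (encode_inst x) ^ (2 * d)"
      unfolding runs_def by blast
  qed
qed

end
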